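(* Fix a finite field $\mathbb{F}_q$. For each $n\ge 1$ let $g$ be a matrix chosen uniformly at random from $\mathrm{GL}_n(\mathbb{F}_q)$, and let $k=k(n)$ be a positive integer such that $\log k=o(n^2)$ as $n\to\infty$. Then the distribution of $\mathrm{Tr}(g^k)\in\mathbb{F}_q$ tends to the uniform distribution on $\mathbb{F}_q$ as $n\to\infty$ (i.e. $\sum_{x\in\mathbb{F}_q}|\mathbb{P}(\mathrm{Tr}(g^k)=x)-q^{-1}|\to 0$).
   Context: $q$ is a fixed prime power; $\mathrm{GL}_n(\mathbb{F}_q)$ carries the uniform probability measure. *)

theory Defs
  imports
    "HOL-Probability.Probability_Mass_Function"
    "HOL-Library.Landau_Symbols"
    "Jordan_Normal_Form.Determinant"
begin

text \<open>The finite field is the type \<open>'a\<close>, so \<open>q = CARD('a)\<close>. The size \<open>n\<close> varies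
  inside the statement, hence matrices with explicit carriers are used.\<close>

definition GL :: "nat \<Rightarrow> 'a::field mat set" where
  "GL n = {A \<in> carrier_mat n n. invertible_mat A}"

definition mat_trace :: "'a::comm_monoid_add mat \<Rightarrow> 'a" where
  "mat_trace A = (\<Sum>i<dim_row A. A $$ (i, i))"

text \<open>\<open>pmf_of_set\<close> is the uniform distribution only on finite nonempty sets; this is the content
  of the following two facts.\<close>

lemma finite_GL: "finite (GL n :: 'a::{finite,field} mat set)"
proof -
  let ?I = "{..<n} \<times> {..<n}"
  have "A \<in> (\<lambda>f. mat n n f) ` (?I \<rightarrow>\<^sub>E UNIV)" if "A \<in> carrier_mat n n" for A :: "'a mat"
  proof (rule image_eqI)
    show "A = mat n n (restrict (\<lambda>ij. A $$ ij) ?I)"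
      using that by (intro eq_matI) auto
  qed auto
  then have "carrier_mat n n \<subseteq> (\<lambda>f. mat n n f) ` (?I \<rightarrow>\<^sub>E (UNIV :: 'a set))"
    by blast
  moreover have "finite (?I \<rightarrow>\<^sub>E (UNIV :: 'a set))"
    by (intro finite_PiE) auto
  ultimately show ?thesis
    unfolding GL_def by (auto intro: finite_subset)
qed

lemma GL_nonempty: "GL n \<noteq> {}"
proof -
  have "1\<^sub>m n \<in> GL n"
    unfolding GL_def invertible_mat_def inverts_mat_def
    by (auto intro!: exI[of _ "1\<^sub>m n"])
  then show ?thesis by blast
qed

end

theory Submission
  imports Defs "Jordan_Normal_Form.Char_Poly" "HOL-Algebra.Algebraic_Closure_Type"
    "HOL-Number_Theory.Residues" "HOL-Real_Asymp.Real_Asymp"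
begin

text \<open>Let \<open>\<psi>\<close> be a nontrivial additive character of the field with \<open>q\<close> elements and \<open>E\<^sub>n\<close> the mean of
  \<open>\<psi>(Tr g\<^sup>k)\<close> over \<open>GL\<^sub>n\<close>; by Fourier inversion it suffices that \<open>E\<^sub>n \<rightarrow> 0\<close>.

  Counting pairs of \<open>g\<close> and a vector \<open>v\<close> by the dimension \<open>j\<close> of the cyclic subspace generated by \<open>v\<close>
  gives \<open>q\<^sup>n E\<^sub>n = \<Sum>\<^sub>j A\<^sub>j E\<^bsub>n-j\<^esub>\<close>, where \<open>A\<^sub>j\<close> sums the multiplicative function \<open>f \<mapsto> \<psi>(\<Sum> x\<^sup>k)\<close>
  (over the roots \<open>x\<close> of \<open>f\<close>) over the monic polynomials of degree \<open>j\<close> with nonzero constant term. The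
  logarithmic derivative of the corresponding L-function is \<open>j A\<^sub>j = \<Sum>\<^sub>i S\<^sub>i A\<^bsub>j-i\<^esub>\<close> with
  \<open>S\<^sub>i = \<Sum> \<psi>(Tr x\<^sup>k)\<close> over the nonzero \<open>x\<close> of the field with \<open>q\<^sup>i\<close> elements. Together they yield
  \<open>n E\<^sub>n = \<Sum>\<^sub>i s\<^sub>i E\<^bsub>n-i\<^esub>\<close> with \<open>s\<^sub>i = S\<^sub>i / (q\<^sup>i - 1)\<close>, \<open>|s\<^sub>i| \<le> 1\<close>, as for the cycles of a
  random permutation, and hence \<open>|E\<^sub>n| \<le> e exp(- \<Sum>\<^bsub>i\<le>n\<^esub> (1 - |s\<^sub>i|) / i)\<close>.

  A second-moment bound gives \<open>|s\<^sub>i| \<le> 1/2\<close> unless \<open>gcd(k, q\<^sup>i - 1)\<close> exceeds \<open>q\<^bsup>i/2\<^esup> / 4\<close>. If this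
  happened for too many \<open>i \<equiv> 1 (mod 6)\<close> in a dyadic interval of size about \<open>n\<close>, then \<open>k\<close>, a common multiple
  of these gcds, would be at least \<open>exp(c n\<^sup>2)\<close>. So each of arbitrarily many dyadic intervals contributes a fixed
  positive amount to the exponent.\<close>

hide_const (open) Polynomials.degree Polynomials.lead_coeff up_ring.monom up_ring.coeff Coset.order
  Divisibility.prime module.smult

unbundle no vec_syntax
unbundle no Formal_Power_Series.fps_syntax

subsection \<open>Counting in the general linear group\<close>

text \<open>The size of k is the real obstacle. If k is a multiple of the exponent of the group,
  which requires only log k of order n^2, then g^k is the identity and its trace is constant. So no
  single s_i can be controlled: k may be divisible by q^i - 1 for many i. What helps is that such
  divisibilities accumulate, because distinct q^i - 1 share only factors q^f - 1 with f a common
  proper divisor. The residue class modulo 6 is chosen to keep this overlap small. Over all integers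
  the proper divisors of i add up to about 0.64 i on average, more than the exponent i/2 supplied by
  a large gcd; for i coprime to 6 they add up to less than 0.1 i on average.

  The denominators q^i - 1 come from iterating F(qu) = A(u) F(u), where F is the generating function
  of the means. Formally F(u) is the product of A(u / q^r) over r \<ge> 1, and its logarithmic
  derivative contains the geometric series of the q^(-ri). The proof verifies the resulting identity
  directly instead of forming the infinite product.\<close>

lemma GL_iff_det: "A \<in> GL n \<longleftrightarrow> A \<in> carrier_mat n n \<and> det A \<noteq> (0::'a::field)"
proof
  assume "A \<in> GL n"
  then obtain B where A: "A \<in> carrier_mat n n" and B: "A * B = 1\<^sub>m n" "B * A = 1\<^sub>m (dim_row B)"
    unfolding GL_def invertible_mat_def inverts_mat_def by auto
  have "dim_col B = n" using arg_cong[OF B(1), of dim_col] by simp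
  moreover have "dim_row B = n" using arg_cong[OF B(2), of dim_col] A by simp
  ultimately have "det A * det B = 1" using det_mult[OF A, of B] B(1) by auto
  then show "A \<in> carrier_mat n n \<and> det A \<noteq> 0" using A by auto
next
  assume A: "A \<in> carrier_mat n n \<and> det A \<noteq> 0"
  then obtain B where "B \<in> carrier_mat n n" "A * B = 1\<^sub>m n" "B * A = 1\<^sub>m n"
    using det_non_zero_imp_unit[of A n "()"] by (auto simp: Units_def ring_mat_def)
  then show "A \<in> GL n"
    using A unfolding GL_def invertible_mat_def inverts_mat_def by auto
qed

lemma GL_carrier: "A \<in> GL n \<Longrightarrow> A \<in> carrier_mat n n"
  by (simp add: GL_def)

lemma GL_mult: "A \<in> GL n \<Longrightarrow> B \<in> GL n \<Longrightarrow> A * B \<in> GL n"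
  for A B :: "'a::field mat"
  by (auto simp: GL_iff_det det_mult)

lemma GL_ex_inverse:
  fixes A :: "'a::field mat"
  assumes "A \<in> GL n"
  shows "\<exists>B\<in>GL n. A * B = 1\<^sub>m n \<and> B * A = 1\<^sub>m n"
proof -
  have A: "A \<in> carrier_mat n n" "det A \<noteq> 0"
    using assms by (auto simp: GL_iff_det)
  from det_non_zero_imp_unit[OF A, of "()"] obtain B where B: "B \<in> carrier_mat n n"
    "A * B = 1\<^sub>m n" "B * A = 1\<^sub>m n"
    by (auto simp: Units_def ring_mat_def)
  have "det A * det B = 1"
    using det_mult[OF A(1) B(1)] B(2) by simp
  then have "B \<in> GL n"
    using B by (auto simp: GL_iff_det)
  with B show ?thesis by blast
qed

definition GL_inv :: "nat \<Rightarrow> 'a::field mat \<Rightarrow> 'a mat" where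
  "GL_inv n A = (SOME B. B \<in> GL n \<and> A * B = 1\<^sub>m n \<and> B * A = 1\<^sub>m n)"

lemma GL_inv:
  fixes A :: "'a::field mat"
  assumes "A \<in> GL n"
  shows "GL_inv n A \<in> GL n" "A * GL_inv n A = 1\<^sub>m n" "GL_inv n A * A = 1\<^sub>m n"
  using someI_ex[OF GL_ex_inverse[OF assms, unfolded Bex_def]] by (auto simp: GL_inv_def)

lemma GL_cancel:
  fixes A :: "'a::field mat"
  assumes "A \<in> GL n" "B \<in> carrier_mat n m"
  shows "A * (GL_inv n A * B) = B" "GL_inv n A * (A * B) = B"
proof -
  note c = GL_carrier[OF assms(1)] GL_carrier[OF GL_inv(1)[OF assms(1)]]
  show "A * (GL_inv n A * B) = B"
    using assoc_mult_mat[OF c(1,2) assms(2)] assms GL_inv[OF assms(1)] by simp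
  show "GL_inv n A * (A * B) = B"
    using assoc_mult_mat[OF c(2,1) assms(2)] assms GL_inv[OF assms(1)] by simp
qed

lemma GL_cancel_vec:
  fixes A :: "'a::field mat"
  assumes "A \<in> GL n" "x \<in> carrier_vec n"
  shows "A *\<^sub>v (GL_inv n A *\<^sub>v x) = x" "GL_inv n A *\<^sub>v (A *\<^sub>v x) = x"
proof -
  note c = GL_carrier[OF assms(1)] GL_carrier[OF GL_inv(1)[OF assms(1)]]
  show "A *\<^sub>v (GL_inv n A *\<^sub>v x) = x"
    using assoc_mult_mat_vec[OF c(1,2) assms(2)] assms GL_inv[OF assms(1)] by simp
  show "GL_inv n A *\<^sub>v (A *\<^sub>v x) = x"
    using assoc_mult_mat_vec[OF c(2,1) assms(2)] assms GL_inv[OF assms(1)] by simp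
qed

lemma mat_mult_unit_vec:
  fixes A :: "'a::semiring_1 mat"
  assumes "A \<in> carrier_mat nr n" "i < n"
  shows "A *\<^sub>v unit_vec n i = col A i"
  using assms by (intro eq_vecI) auto

lemma finite_carrier_mat: "finite (carrier_mat m n :: 'a::finite mat set)"
proof -
  let ?I = "{..<m} \<times> {..<n}"
  have "A \<in> (\<lambda>f. mat m n f) ` (?I \<rightarrow>\<^sub>E UNIV)" if "A \<in> carrier_mat m n" for A :: "'a mat"
  proof (rule image_eqI)
    show "A = mat m n (restrict (\<lambda>ij. A $$ ij) ?I)"
      using that by (intro eq_matI) auto
  qed auto
  then have "carrier_mat m n \<subseteq> (\<lambda>f. mat m n f) ` (?I \<rightarrow>\<^sub>E (UNIV :: 'a set))"
    by blast
  moreover have "finite (?I \<rightarrow>\<^sub>E (UNIV :: 'a set))"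
    by (intro finite_PiE) auto
  ultimately show ?thesis
    by (auto intro: finite_subset)
qed

lemma bij_betw_carrier_vec:
  "bij_betw (\<lambda>f. vec n f) ({..<n} \<rightarrow>\<^sub>E UNIV) (carrier_vec n :: 'a vec set)"
proof (rule bij_betw_byWitness[where f' = "\<lambda>v. restrict (\<lambda>i. v $ i) {..<n}"])
  show "\<forall>f\<in>{..<n} \<rightarrow>\<^sub>E (UNIV :: 'a set). restrict (\<lambda>i. vec n f $ i) {..<n} = f"
    by (auto simp: PiE_def extensional_def restrict_def fun_eq_iff)
  show "\<forall>v\<in>carrier_vec n. vec n (restrict (\<lambda>i. v $ i) {..<n}) = (v :: 'a vec)"
    by (auto intro!: eq_vecI)
  show "(\<lambda>f. vec n f) ` ({..<n} \<rightarrow>\<^sub>E (UNIV :: 'a set)) \<subseteq> carrier_vec n"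
    by (rule image_subsetI) (rule vec_carrier)
  show "(\<lambda>v. restrict (\<lambda>i. v $ i) {..<n}) ` carrier_vec n \<subseteq> {..<n} \<rightarrow>\<^sub>E (UNIV :: 'a set)"
    by (rule image_subsetI) simp
qed

lemma finite_carrier_vec: "finite (carrier_vec n :: 'a::finite vec set)"
proof -
  have "bij_betw (\<lambda>f. vec n f) ({..<n} \<rightarrow>\<^sub>E UNIV) (carrier_vec n :: 'a vec set)"
    by (rule bij_betw_carrier_vec)
  moreover have "finite ({..<n} \<rightarrow>\<^sub>E (UNIV :: 'a set))"
    by (intro finite_PiE) auto
  ultimately show ?thesis using bij_betw_finite by blast
qed

lemma card_carrier_vec: "card (carrier_vec n :: 'a::finite vec set) = CARD('a) ^ n"
proof -
  have "bij_betw (\<lambda>f. vec n f) ({..<n} \<rightarrow>\<^sub>E UNIV) (carrier_vec n :: 'a vec set)"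
    by (rule bij_betw_carrier_vec)
  from bij_betw_same_card[OF this] show ?thesis by (simp add: card_PiE)
qed

lemma card_carrier_mat_pos: "card (carrier_mat m n :: 'a::{finite,zero} mat set) > 0"
  using finite_carrier_mat[of m n, where 'a = 'a] zero_carrier_mat[of m n, where 'a = 'a]
  by (auto simp: card_gt_0_iff)

text \<open>In the standard basis, replace \<open>e\<^sub>j\<close> by \<open>w\<close> and \<open>e\<^sub>l\<close> by \<open>e\<^sub>j\<close>.\<close>

lemma GL_extend_unit_vecs:
  fixes w :: "'a::field vec"
  assumes w: "w \<in> carrier_vec n" and l: "j \<le> l" "l < n" "w $ l \<noteq> 0"
  shows "\<exists>N\<in>GL n. (\<forall>i<j. col N i = unit_vec n i) \<and> col N j = w"
proof -
  define N where "N = mat n n (\<lambda>(r,c). if c = j then w $ r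
     else if c = l then (if r = j then 1 else 0) else if r = c then 1 else 0)"
  have N: "N \<in> carrier_mat n n" by (simp add: N_def)
  have j: "j < n" using l by simp
  \<comment> \<open>Row \<open>l\<close> has the single nonzero entry \<open>w $ l\<close>, in
    column \<open>j\<close>, and forces \<open>x $ j = 0\<close>. The rows other than
    \<open>j\<close> and \<open>l\<close> then give the other coordinates, and row \<open>j\<close>
    gives \<open>x $ l\<close>.\<close>
  have "x = 0\<^sub>v n" if x: "x \<in> carrier_vec n" and "N *\<^sub>v x = 0\<^sub>v n" for x
  proof -
    have row: "(\<Sum>c\<in>{0..<n}. N $$ (r,c) * x $ c) = 0" if "r < n" for r
    proof -
      have "(N *\<^sub>v x) $ r = 0" using \<open>N *\<^sub>v x = 0\<^sub>v n\<close> that by simp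
      then show ?thesis using that x N by (simp add: scalar_prod_def)
    qed
    have "N $$ (l,c) * x $ c = (if c = j then w $ l * x $ j else 0)" if "c < n" for c
      using that l j by (auto simp: N_def)
    then have "(\<Sum>c\<in>{0..<n}. N $$ (l,c) * x $ c) = w $ l * x $ j"
      using j by (simp add: sum.delta cong: sum.cong_simp)
    with row[OF l(2)] l(3) have xj: "x $ j = 0" by simp
    have other: "x $ r = 0" if r: "r < n" "r \<noteq> j" "r \<noteq> l" for r
    proof -
      have "N $$ (r,c) * x $ c = (if c = r then x $ r else 0)" if "c < n" for c
        using that r xj by (auto simp: N_def)
      then have "(\<Sum>c\<in>{0..<n}. N $$ (r,c) * x $ c) = x $ r"
        using r by (simp add: sum.delta cong: sum.cong_simp)
      with row[OF r(1)] show ?thesis by simp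
    qed
    have "N $$ (j,c) * x $ c = (if c = l then x $ l else 0)" if "c < n" for c
      using that xj l other by (auto simp: N_def)
    then have "(\<Sum>c\<in>{0..<n}. N $$ (j,c) * x $ c) = x $ l"
      using l by (simp add: sum.delta cong: sum.cong_simp)
    with row[OF j] have "x $ l = 0" by simp
    with xj other have "x $ r = 0" if "r < n" for r using that by metis
    then show ?thesis using x by (intro eq_vecI) auto
  qed
  then have "det N \<noteq> 0" using det_0_iff_vec_prod_zero_field[OF N] by blast
  then have "N \<in> GL n" using N by (simp add: GL_iff_det)
  moreover have "\<forall>i<j. col N i = unit_vec n i"
    using l j by (auto simp: N_def intro!: eq_vecI)
  moreover have "col N j = w"
    using w j by (auto simp: N_def intro!: eq_vecI)
  ultimately show ?thesis by blast
qed

section \<open>Block triangular matrices with a companion block\<close>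

definition companions :: "nat \<Rightarrow> 'a::field mat set" where
  "companions j = {C \<in> GL j. \<forall>r<j. \<forall>c. Suc c < j \<longrightarrow> C $$ (r, c) = (if r = Suc c then 1 else 0)}"

text \<open>The matrix of \<open>g\<close> in a basis whose first \<open>j\<close> vectors are
  \<open>v, g v, ..., g^(j-1) v\<close> and span an invariant subspace: \<open>C\<close> acts on
  that subspace, \<open>G\<close> on the quotient.\<close>

definition block_companions :: "nat \<Rightarrow> nat \<Rightarrow> 'a::field mat set" where
  "block_companions j n = (\<lambda>(C, D, G). four_block_mat C D (0\<^sub>m (n - j) j) G) `
     (companions j \<times> carrier_mat j (n - j) \<times> GL (n - j))"

text \<open>The stabilizer of the first \<open>j\<close> standard basis vectors, that is, the
  changes of basis that preserve the cyclic part of such a basis.\<close>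

definition block_units :: "nat \<Rightarrow> nat \<Rightarrow> 'a::field mat set" where
  "block_units j n = (\<lambda>(D, G). four_block_mat (1\<^sub>m j) D (0\<^sub>m (n - j) j) G) `
     (carrier_mat j (n - j) \<times> GL (n - j))"

lemma four_block_mat_eq_iff:
  assumes "A \<in> carrier_mat a b" "B \<in> carrier_mat a d" "C \<in> carrier_mat c b" "D \<in> carrier_mat c d"
    and "A' \<in> carrier_mat a b" "B' \<in> carrier_mat a d" "C' \<in> carrier_mat c b" "D' \<in> carrier_mat c d"
  shows "four_block_mat A B C D = four_block_mat A' B' C' D' \<longleftrightarrow> A = A' \<and> B = B' \<and> C = C' \<and> D = D'"
proof
  assume eq: "four_block_mat A B C D = four_block_mat A' B' C' D'"
  have ix: "four_block_mat A B C D $$ (i, j) = four_block_mat A' B' C' D' $$ (i, j)" for i j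
    using eq by simp
  have "A $$ (i, j) = A' $$ (i, j)" if "i < a" "j < b" for i j
    using ix[of i j] that assms by auto
  moreover have "B $$ (i, j) = B' $$ (i, j)" if "i < a" "j < d" for i j
    using ix[of i "b + j"] that assms by auto
  moreover have "C $$ (i, j) = C' $$ (i, j)" if "i < c" "j < b" for i j
    using ix[of "a + i" j] that assms by auto
  moreover have "D $$ (i, j) = D' $$ (i, j)" if "i < c" "j < d" for i j
    using ix[of "a + i" "b + j"] that assms by auto
  ultimately show "A = A' \<and> B = B' \<and> C = C' \<and> D = D'"
    using assms by (intro conjI eq_matI) auto
qed simp

lemma companions_subset_GL: "companions j \<subseteq> GL j"
  by (auto simp: companions_def)

lemma finite_companions: "finite (companions j :: 'a::{finite,field} mat set)"
  using finite_subset[OF companions_subset_GL finite_GL] .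

lemma GL_four_block:
  fixes A :: "'a::field mat"
  assumes "j \<le> n" "A \<in> carrier_mat j j" "D \<in> carrier_mat j (n - j)" "G \<in> carrier_mat (n - j) (n - j)"
  shows "four_block_mat A D (0\<^sub>m (n - j) j) G \<in> GL n \<longleftrightarrow> A \<in> GL j \<and> G \<in> GL (n - j)"
  using assms det_four_block_mat_lower_left_zero[OF assms(2,3) refl assms(4)]
    four_block_carrier_mat[OF assms(2,4)]
  by (auto simp: GL_iff_det)

text \<open>The matrix determines its blocks and \<open>\<phi>\<close> ignores the upper right one,
  so the sum factors and \<open>D\<close> contributes only its number of choices.\<close>

lemma sum_block_companions:
  fixes \<phi> :: "'a::{finite,field} mat \<Rightarrow> complex"
  assumes mult: "\<And>C D G. C \<in> GL j \<Longrightarrow> D \<in> carrier_mat j (n - j) \<Longrightarrow> G \<in> GL (n - j) \<Longrightarrow>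
      \<phi> (four_block_mat C D (0\<^sub>m (n - j) j) G) = \<phi> C * \<phi> G"
  shows "(\<Sum>b\<in>block_companions j n. \<phi> b) =
    of_nat (card (carrier_mat j (n - j) :: 'a mat set)) * (\<Sum>C\<in>companions j. \<phi> C) * (\<Sum>G\<in>GL (n - j). \<phi> G)"
proof -
  let ?f = "\<lambda>(C, D, G). four_block_mat C D (0\<^sub>m (n - j) j) G :: 'a mat"
  let ?S = "companions j \<times> carrier_mat j (n - j) \<times> GL (n - j)"
  have inj: "inj_on ?f ?S"
  proof (rule inj_onI)
    fix x y assume xy: "x \<in> ?S" "y \<in> ?S" "?f x = ?f y"
    obtain C D G where x: "x = (C, D, G)" by (cases x)
    obtain C' D' G' where y: "y = (C', D', G')" by (cases y)
    have "C \<in> carrier_mat j j" "C' \<in> carrier_mat j j" "G \<in> carrier_mat (n - j) (n - j)" "G' \<in> carrier_mat (n - j) (n - j)"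
      using xy x y companions_subset_GL GL_carrier by blast+
    then show "x = y"
      using xy four_block_mat_eq_iff[of C j j D "n - j" "0\<^sub>m (n - j) j" "n - j" G C' D' "0\<^sub>m (n - j) j" G']
      unfolding x y by simp
  qed
  have "(\<Sum>b\<in>block_companions j n. \<phi> b) = (\<Sum>x\<in>?S. \<phi> (?f x))"
    unfolding block_companions_def by (subst sum.reindex[OF inj]) simp
  also have "\<dots> = (\<Sum>C\<in>companions j. \<Sum>D\<in>(carrier_mat j (n - j) :: 'a mat set). \<Sum>G\<in>GL (n - j). \<phi> C * \<phi> G)"
    unfolding sum.cartesian_product
    by (rule sum.cong) (auto intro!: mult subsetD[OF companions_subset_GL])
  also have "\<dots> = of_nat (card (carrier_mat j (n - j) :: 'a mat set)) * (\<Sum>C\<in>companions j. \<phi> C) * (\<Sum>G\<in>GL (n - j). \<phi> G)"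
    by (simp add: sum_distrib_left[symmetric] sum_distrib_right[symmetric] mult.assoc)
  finally show ?thesis .
qed

lemma card_block_units:
  "card (block_units j n :: 'a::{finite,field} mat set) =
    card (carrier_mat j (n - j) :: 'a mat set) * card (GL (n - j) :: 'a mat set)"
proof -
  let ?f = "\<lambda>(D, G). four_block_mat (1\<^sub>m j) D (0\<^sub>m (n - j) j) G :: 'a mat"
  have "inj_on ?f (carrier_mat j (n - j) \<times> GL (n - j))"
  proof (intro inj_onI, clarify)
    fix D G D' G' :: "'a mat"
    assume *: "D \<in> carrier_mat j (n - j)" "D' \<in> carrier_mat j (n - j)"
      "G \<in> GL (n - j)" "G' \<in> GL (n - j)"
      "four_block_mat (1\<^sub>m j) D (0\<^sub>m (n - j) j) G = four_block_mat (1\<^sub>m j) D' (0\<^sub>m (n - j) j) G'"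
    then show "D = D' \<and> G = G'"
      using GL_carrier[OF *(3)] GL_carrier[OF *(4)]
      by (subst (asm) four_block_mat_eq_iff[of _ j j _ "n - j" _ "n - j"]) auto
  qed
  then show ?thesis
    unfolding block_units_def by (subst card_image) (auto simp: card_cartesian_product)
qed

lemma four_block_lower_left_zero_ex:
  fixes b :: "'a::zero mat"
  assumes "j \<le> n" "b \<in> carrier_mat n n" "\<And>r c. r < n \<Longrightarrow> j \<le> r \<Longrightarrow> c < j \<Longrightarrow> b $$ (r, c) = 0"
  obtains A D G where "A \<in> carrier_mat j j" "D \<in> carrier_mat j (n - j)" "G \<in> carrier_mat (n - j) (n - j)"
    "b = four_block_mat A D (0\<^sub>m (n - j) j) G" "\<And>r c. r < j \<Longrightarrow> c < j \<Longrightarrow> A $$ (r, c) = b $$ (r, c)"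
proof
  let ?A = "mat j j (\<lambda>(r,c). b $$ (r, c))" and ?D = "mat j (n - j) (\<lambda>(r,c). b $$ (r, c + j))"
  let ?G = "mat (n - j) (n - j) (\<lambda>(r,c). b $$ (r + j, c + j))"
  show "b = four_block_mat ?A ?D (0\<^sub>m (n - j) j) ?G"
    using assms by (intro eq_matI) auto
qed auto

text \<open>In the columns before \<open>j - 1\<close> the unit vector condition already makes the
  lower left block vanish; only column \<open>j - 1\<close> needs the separate clause.\<close>

lemma block_companions_iff:
  fixes b :: "'a::field mat"
  assumes "j \<le> n"
  shows "b \<in> block_companions j n \<longleftrightarrow> b \<in> GL n \<and> (\<forall>r<n. \<forall>c<j. Suc c < j \<longrightarrow> b $$ (r, c) = (if r = Suc c then 1 else 0))
     \<and> (\<forall>r<n. \<forall>c. j \<le> r \<and> Suc c = j \<longrightarrow> b $$ (r, c) = 0)" (is "_ \<longleftrightarrow> ?R")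
proof
  assume "b \<in> block_companions j n"
  then obtain C D G where *: "C \<in> companions j" "D \<in> carrier_mat j (n - j)" "G \<in> GL (n - j)"
    and b: "b = four_block_mat C D (0\<^sub>m (n - j) j) G"
    by (auto simp: block_companions_def)
  have C: "C \<in> GL j" "C \<in> carrier_mat j j" using * companions_subset_GL GL_carrier by blast+
  have G: "G \<in> carrier_mat (n - j) (n - j)" using * GL_carrier by blast
  have "b \<in> GL n" unfolding b using GL_four_block[OF assms C(2) *(2) G] C * by blast
  moreover have "b $$ (r, c) = (if r = Suc c then 1 else 0)" if "r < n" "Suc c < j" for r c
    using that * C G assms unfolding b companions_def by auto
  moreover have "b $$ (r, c) = 0" if "r < n" "j \<le> r" "Suc c = j" for r c
    using that * C G assms unfolding b by auto
  ultimately show ?R by auto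
next
  assume R: ?R
  have "b $$ (r, c) = 0" if "r < n" "j \<le> r" "c < j" for r c
    using R that by (cases "Suc c < j") auto
  then obtain A D G where *: "A \<in> carrier_mat j j" "D \<in> carrier_mat j (n - j)" "G \<in> carrier_mat (n - j) (n - j)"
    and b: "b = four_block_mat A D (0\<^sub>m (n - j) j) G" and ent: "\<And>r c. r < j \<Longrightarrow> c < j \<Longrightarrow> A $$ (r, c) = b $$ (r, c)"
    using four_block_lower_left_zero_ex[OF assms GL_carrier] R by metis
  have "A \<in> GL j" "G \<in> GL (n - j)" using GL_four_block[OF assms *] R b by blast+
  moreover have "A \<in> companions j"
    unfolding companions_def using \<open>A \<in> GL j\<close> ent R assms by auto
  ultimately show "b \<in> block_companions j n"
    unfolding block_companions_def b using * by (intro image_eqI[of _ _ "(A, D, G)"]) auto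
qed

lemma block_units_iff:
  fixes b :: "'a::field mat"
  assumes "j \<le> n"
  shows "b \<in> block_units j n \<longleftrightarrow> b \<in> GL n \<and> (\<forall>i<j. col b i = unit_vec n i)" (is "_ \<longleftrightarrow> ?R")
proof
  assume "b \<in> block_units j n"
  then obtain D G where *: "D \<in> carrier_mat j (n - j)" "G \<in> GL (n - j)"
    and b: "b = four_block_mat (1\<^sub>m j) D (0\<^sub>m (n - j) j) G"
    by (auto simp: block_units_def)
  have G: "G \<in> carrier_mat (n - j) (n - j)" using * GL_carrier by blast
  have "b \<in> GL n" unfolding b using GL_four_block[OF assms one_carrier_mat *(1) G] *
    by (simp add: GL_iff_det)
  moreover have "col b i = unit_vec n i" if "i < j" for i
    using that * G assms unfolding b by (intro eq_vecI) auto
  ultimately show ?R by auto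
next
  assume R: ?R
  have bc: "b \<in> carrier_mat n n" using R GL_carrier by blast
  have ent': "b $$ (r, c) = (if r = c then 1 else 0)" if "r < n" "c < j" for r c
  proof -
    have "col b c $ r = unit_vec n c $ r" using R that by simp
    then show ?thesis using that assms bc by auto
  qed
  then have "b $$ (r, c) = 0" if "r < n" "j \<le> r" "c < j" for r c
    using that by auto
  then obtain A D G where *: "A \<in> carrier_mat j j" "D \<in> carrier_mat j (n - j)" "G \<in> carrier_mat (n - j) (n - j)"
    and b: "b = four_block_mat A D (0\<^sub>m (n - j) j) G" and ent: "\<And>r c. r < j \<Longrightarrow> c < j \<Longrightarrow> A $$ (r, c) = b $$ (r, c)"
    using four_block_lower_left_zero_ex[OF assms bc] by metis
  have "G \<in> GL (n - j)" using GL_four_block[OF assms *] R b by blast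
  moreover have "A = 1\<^sub>m j"
    using * ent ent' assms by (intro eq_matI) auto
  ultimately show "b \<in> block_units j n"
    unfolding block_units_def b using * by (intro image_eqI[of _ _ "(D, G)"]) auto
qed

section \<open>Bases that begin with a cyclic sequence\<close>

text \<open>Bases take the place of subspaces: \<open>M\<close> is a basis beginning with
  \<open>v, g v, ..., g^(j-1) v\<close>, and \<open>w\<close> holds the coordinates of
  \<open>g^j v\<close>, which vanish from index \<open>j\<close> on. For \<open>j \<le> n\<close>
  this makes \<open>j\<close> the dimension of the cyclic subspace of \<open>v\<close>.\<close>

definition krylov_frame :: "nat \<Rightarrow> 'a::field mat \<Rightarrow> 'a vec \<Rightarrow> nat \<Rightarrow> 'a mat \<Rightarrow> bool" where
  "krylov_frame n g v j M \<longleftrightarrow> M \<in> GL n \<and> (\<forall>i<j. col M i = (g ^\<^sub>m i) *\<^sub>v v) \<and>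
     (\<exists>w\<in>carrier_vec n. (\<forall>l<n. j \<le> l \<longrightarrow> w $ l = 0) \<and> (g ^\<^sub>m j) *\<^sub>v v = M *\<^sub>v w)"

lemma pow_mat_Suc_left:
  fixes g :: "'a::semiring_1 mat"
  assumes "g \<in> carrier_mat n n"
  shows "g ^\<^sub>m Suc i = g * g ^\<^sub>m i"
proof (induction i)
  case (Suc i)
  have "g ^\<^sub>m Suc (Suc i) = g * g ^\<^sub>m i * g" using Suc by simp
  also have "\<dots> = g * (g ^\<^sub>m i * g)" using assms by (intro assoc_mult_mat[of _ n n _ n _ n]) auto
  finally show ?case by simp
qed (use assms in auto)

lemma pow_mat_Suc_vec:
  fixes g :: "'a::semiring_1 mat"
  assumes "g \<in> carrier_mat n n" "v \<in> carrier_vec n"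
  shows "(g ^\<^sub>m Suc i) *\<^sub>v v = g *\<^sub>v ((g ^\<^sub>m i) *\<^sub>v v)"
  unfolding pow_mat_Suc_left[OF assms(1)]
  using assms by (intro assoc_mult_mat_vec) auto

lemma col_mult_vec:
  assumes "A \<in> carrier_mat m n" "B \<in> carrier_mat n k" "i < k"
  shows "col (A * B) i = A *\<^sub>v col B i"
  using assms by (intro eq_vecI) auto

text \<open>Take \<open>j\<close> maximal such that the first \<open>j\<close> iterates of
  \<open>v\<close> begin a basis. A nonzero coordinate of \<open>g^j v\<close> at an index
  \<open>l \<ge> j\<close> would allow an exchange and hence a longer beginning.\<close>

lemma krylov_frame_exists:
  fixes g :: "'a::field mat"
  assumes g: "g \<in> carrier_mat n n" and v: "v \<in> carrier_vec n"
  shows "\<exists>j\<le>n. \<exists>M. krylov_frame n g v j M"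
proof -
  let ?P = "\<lambda>j. j \<le> n \<and> (\<exists>M\<in>GL n. \<forall>i<j. col M i = (g ^\<^sub>m i) *\<^sub>v v)"
  have "?P 0" using GL_nonempty[of n, where 'a = 'a] by auto
  define j where "j = Greatest ?P"
  have Pj: "?P j" unfolding j_def by (rule GreatestI_nat[of ?P, OF \<open>?P 0\<close>, of n]) auto
  have max: "i \<le> j" if "?P i" for i
    unfolding j_def by (rule Greatest_le_nat[of ?P, OF that, of n]) auto
  obtain M where M: "M \<in> GL n" and col: "\<forall>i<j. col M i = (g ^\<^sub>m i) *\<^sub>v v" using Pj by blast
  have Mc: "M \<in> carrier_mat n n" using M GL_carrier by blast
  have gv: "(g ^\<^sub>m i) *\<^sub>v v \<in> carrier_vec n" for i
    using g v by (intro mult_mat_vec_carrier[of _ n n] pow_carrier_mat)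
  define w where "w = GL_inv n M *\<^sub>v ((g ^\<^sub>m j) *\<^sub>v v)"
  have w: "w \<in> carrier_vec n"
    unfolding w_def using GL_inv(1)[OF M] GL_carrier gv by (metis mult_mat_vec_carrier)
  have Mw: "M *\<^sub>v w = (g ^\<^sub>m j) *\<^sub>v v" unfolding w_def by (rule GL_cancel_vec[OF M gv])
  have "w $ l = 0" if l: "l < n" "j \<le> l" for l
  proof (rule ccontr)
    assume "w $ l \<noteq> 0"
    then obtain N where N: "N \<in> GL n" "\<forall>i<j. col N i = unit_vec n i" "col N j = w"
      using GL_extend_unit_vecs[OF w l(2,1)] by blast
    have "col (M * N) i = (g ^\<^sub>m i) *\<^sub>v v" if "i < Suc j" for i
    proof -
      have i: "i < n" using that l by simp
      have "col (M * N) i = M *\<^sub>v col N i" using col_mult_vec[OF Mc GL_carrier[OF N(1)] i] .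
      then show ?thesis using N(2,3) col Mw mat_mult_unit_vec[OF Mc i] that by (cases "i = j") auto
    qed
    then have "?P (Suc j)" using GL_mult[OF M N(1)] l by auto
    then show False using max[of "Suc j"] by simp
  qed
  then have "krylov_frame n g v j M"
    unfolding krylov_frame_def using M col w Mw by metis
  then show ?thesis using Pj by auto
qed

text \<open>For \<open>j < j'\<close> the vector \<open>g^j v\<close> is column \<open>j\<close> of
  \<open>M'\<close> and also a combination of the first \<open>j\<close> columns, which both frames
  share; this contradicts the invertibility of \<open>M'\<close>. Applied in both directions it
  makes the index unique.\<close>

lemma krylov_frame_index_unique:
  fixes g :: "'a::field mat"
  assumes g: "g \<in> carrier_mat n n" and v: "v \<in> carrier_vec n"
    and "krylov_frame n g v j M" "krylov_frame n g v j' M'" "j' \<le> n"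
  shows "j' \<le> j"
proof (rule ccontr)
  assume "\<not> j' \<le> j"
  then have j: "j < j'" by simp
  have M: "M \<in> GL n" "M' \<in> GL n" using assms by (auto simp: krylov_frame_def)
  note Mc = M[THEN GL_carrier]
  obtain w where w: "w \<in> carrier_vec n" "\<forall>l<n. j \<le> l \<longrightarrow> w $ l = 0" "(g ^\<^sub>m j) *\<^sub>v v = M *\<^sub>v w"
    using assms by (auto simp: krylov_frame_def)
  have cols: "col M i = col M' i" if "i < j" for i
    using assms j that by (auto simp: krylov_frame_def)
  have "M *\<^sub>v w = M' *\<^sub>v w"
  proof (intro eq_vecI)
    fix r assume r: "r < dim_vec (M' *\<^sub>v w)"
    have "M $$ (r, c) * w $ c = M' $$ (r, c) * w $ c" if "c < n" for c
    proof (cases "c < j")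
      case True
      have "col M c $ r = col M' c $ r" using cols[OF True] by simp
      then show ?thesis using Mc r that by simp
    next
      case False
      then show ?thesis using w that by simp
    qed
    then show "(M *\<^sub>v w) $ r = (M' *\<^sub>v w) $ r"
      using r Mc w(1) by (auto simp: scalar_prod_def intro!: sum.cong)
  qed (use Mc in auto)
  also have "M *\<^sub>v w = col M' j" using assms(4) j w(3) by (auto simp: krylov_frame_def)
  also have "col M' j = M' *\<^sub>v unit_vec n j" using mat_mult_unit_vec[OF Mc(2)] j assms(5) by simp
  finally have "unit_vec n j = w"
    using GL_cancel_vec(2)[OF M(2) w(1)] GL_cancel_vec(2)[OF M(2) unit_vec_carrier[of n j]] by simp
  then have "unit_vec n j $ j = w $ j" by simp
  then show False using w(2) j assms(5) by simp
qed

lemma block_units_fix: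
  fixes p :: "'a::field mat"
  assumes "j \<le> n" "p \<in> block_units j n" "w \<in> carrier_vec n" "\<forall>l<n. j \<le> l \<longrightarrow> w $ l = 0"
  shows "p *\<^sub>v w = w"
proof -
  have p: "p \<in> carrier_mat n n" and pc: "\<forall>i<j. col p i = unit_vec n i"
    using assms(2) block_units_iff[OF assms(1)] GL_carrier by blast+
  show ?thesis
  proof (intro eq_vecI)
    fix r assume "r < dim_vec w"
    then have r: "r < n" using assms(3) by simp
    have "p $$ (r, c) * w $ c = (if c = r then w $ r else 0)" if "c < n" for c
    proof (cases "c < j")
      case True
      have "col p c $ r = unit_vec n c $ r" using pc True by simp
      then show ?thesis using p r that by auto
    next
      case False
      then show ?thesis using assms(4) that by auto
    qed
    then have "(\<Sum>c\<in>{0..<n}. p $$ (r, c) * w $ c) = w $ r"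
      using r by (simp add: sum.delta cong: sum.cong_simp)
    then show "(p *\<^sub>v w) $ r = w $ r"
      using p r assms(3) by (simp add: scalar_prod_def)
  qed (use p assms(3) in auto)
qed

text \<open>Frames of the same pair differ by right multiplication with an element of
  \<open>block_units\<close>, so their number depends only on \<open>j\<close> and
  \<open>n\<close>.\<close>

lemma card_krylov_frames:
  fixes g :: "'a::{finite,field} mat"
  assumes "j \<le> n" "krylov_frame n g v j M"
  shows "card {M'. krylov_frame n g v j M'} = card (block_units j n :: 'a mat set)"
proof -
  have M: "M \<in> GL n" and Mcol: "\<forall>i<j. col M i = (g ^\<^sub>m i) *\<^sub>v v"
    using assms by (auto simp: krylov_frame_def)
  obtain w where w: "w \<in> carrier_vec n" "\<forall>l<n. j \<le> l \<longrightarrow> w $ l = 0" "(g ^\<^sub>m j) *\<^sub>v v = M *\<^sub>v w"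
    using assms by (auto simp: krylov_frame_def)
  note Mc = M[THEN GL_carrier] GL_inv(1)[OF M, THEN GL_carrier]
  have "bij_betw (\<lambda>p. M * p) (block_units j n) {M'. krylov_frame n g v j M'}"
  proof (rule bij_betw_byWitness[where f' = "\<lambda>M'. GL_inv n M * M'"])
    have car: "p \<in> carrier_mat n n" if "p \<in> block_units j n" for p :: "'a mat"
      using that block_units_iff[OF assms(1)] GL_carrier by blast
    show "\<forall>p\<in>block_units j n. GL_inv n M * (M * p) = p"
      using GL_cancel(2)[OF M] car by blast
    show "\<forall>M'\<in>{M'. krylov_frame n g v j M'}. M * (GL_inv n M * M') = M'"
      using GL_cancel(1)[OF M] GL_carrier by (auto simp: krylov_frame_def)
    show "(*) M ` block_units j n \<subseteq> {M'. krylov_frame n g v j M'}"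
    proof clarify
      fix p :: "'a mat" assume p: "p \<in> block_units j n"
      have pG: "p \<in> GL n" "\<forall>i<j. col p i = unit_vec n i"
        using p block_units_iff[OF assms(1)] by blast+
      have "col (M * p) i = (g ^\<^sub>m i) *\<^sub>v v" if "i < j" for i
        using that pG Mcol col_mult_vec[OF Mc(1) car[OF p], of i] mat_mult_unit_vec[OF Mc(1), of i] assms(1)
        by simp
      moreover have "(M * p) *\<^sub>v w = M *\<^sub>v w"
        using assoc_mult_mat_vec[OF Mc(1) car[OF p] w(1)] block_units_fix[OF assms(1) p w(1,2)] by simp
      ultimately show "krylov_frame n g v j (M * p)"
        unfolding krylov_frame_def using GL_mult[OF M pG(1)] w by metis
    qed
    show "(\<lambda>M'. GL_inv n M * M') ` {M'. krylov_frame n g v j M'} \<subseteq> block_units j n"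
    proof clarify
      fix M' assume M': "krylov_frame n g v j M'"
      have M'G: "M' \<in> GL n" "\<forall>i<j. col M' i = (g ^\<^sub>m i) *\<^sub>v v" using M' by (auto simp: krylov_frame_def)
      have "col (GL_inv n M * M') i = unit_vec n i" if "i < j" for i
      proof -
        have i: "i < n" using that assms(1) by simp
        have "col (GL_inv n M * M') i = GL_inv n M *\<^sub>v (M *\<^sub>v unit_vec n i)"
          using col_mult_vec[OF Mc(2) GL_carrier[OF M'G(1)] i] M'G(2) Mcol that mat_mult_unit_vec[OF Mc(1) i] by simp
        then show ?thesis using GL_cancel_vec(2)[OF M] by simp
      qed
      then show "GL_inv n M * M' \<in> block_units j n"
        using block_units_iff[OF assms(1)] GL_mult[OF GL_inv(1)[OF M] M'G(1)] by blast
    qed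
  qed
  then show ?thesis using bij_betw_same_card by metis
qed

text \<open>In the basis \<open>M\<close> the map becomes \<open>b\<close>. The vector
  \<open>v\<close> carries no further information: it is the first column of \<open>M\<close>, or
  zero when \<open>j = 0\<close>.\<close>

lemma krylov_frame_iff_conj:
  fixes b :: "'a::field mat"
  assumes "j \<le> n" and M: "M \<in> GL n" and b: "b \<in> GL n" and v: "v \<in> carrier_vec n"
  shows "krylov_frame n (M * (b * GL_inv n M)) v j M \<longleftrightarrow>
    b \<in> block_companions j n \<and> v = (if j = 0 then 0\<^sub>v n else col M 0)"
proof -
  let ?g = "M * (b * GL_inv n M)"
  note Mc = M[THEN GL_carrier] GL_inv(1)[OF M, THEN GL_carrier]
  note bc = GL_carrier[OF b]
  have g: "?g \<in> carrier_mat n n" using Mc bc by auto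
  have gM: "?g *\<^sub>v (M *\<^sub>v x) = M *\<^sub>v (b *\<^sub>v x)" if x: "x \<in> carrier_vec n" for x
  proof -
    have "?g *\<^sub>v (M *\<^sub>v x) = M *\<^sub>v (b *\<^sub>v (GL_inv n M *\<^sub>v (M *\<^sub>v x)))"
      using x Mc bc
      by (subst assoc_mult_mat_vec[of _ n n _ n], simp, simp, simp)
         (subst assoc_mult_mat_vec[of _ n n _ n], auto)
    then show ?thesis using GL_cancel_vec(2)[OF M x] by simp
  qed
  have inj: "x = y" if "M *\<^sub>v x = M *\<^sub>v y" "x \<in> carrier_vec n" "y \<in> carrier_vec n" for x y
    using GL_cancel_vec(2)[OF M] that by metis
  have gcol: "?g *\<^sub>v col M i = M *\<^sub>v col b i" if "i < n" for i
    using gM[of "unit_vec n i"] that mat_mult_unit_vec[OF Mc(1) that] mat_mult_unit_vec[OF bc that] by simp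
  have gS: "(?g ^\<^sub>m Suc i) *\<^sub>v v = ?g *\<^sub>v ((?g ^\<^sub>m i) *\<^sub>v v)" for i
    by (rule pow_mat_Suc_vec[OF g v])
  have cb: "col b i \<in> carrier_vec n" for i using bc by auto
  show ?thesis
  proof
    assume K: "krylov_frame n ?g v j M"
    then obtain w where w: "w \<in> carrier_vec n" "\<forall>l<n. j \<le> l \<longrightarrow> w $ l = 0" "(?g ^\<^sub>m j) *\<^sub>v v = M *\<^sub>v w"
      by (auto simp: krylov_frame_def)
    have cols: "col M i = (?g ^\<^sub>m i) *\<^sub>v v" if "i < j" for i using K that by (auto simp: krylov_frame_def)
    have "v = (if j = 0 then 0\<^sub>v n else col M 0)"
    proof (cases "j = 0")
      case True
      then have "w = 0\<^sub>v n" using w by (intro eq_vecI) auto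
      moreover have "M *\<^sub>v 0\<^sub>v n = 0\<^sub>v n" using Mc by (intro eq_vecI) auto
      ultimately show ?thesis using True w(3) v Mc by simp
    next
      case False
      then show ?thesis using cols[of 0] v Mc by simp
    qed
    moreover have "b $$ (r, c) = (if r = Suc c then 1 else 0)" if "r < n" "Suc c < j" for r c
    proof -
      have c: "c < n" "Suc c < n" using that assms(1) by auto
      have "M *\<^sub>v col b c = col M (Suc c)" using gcol[OF c(1)] cols[of c] cols[of "Suc c"] gS[of c] that by simp
      then have "M *\<^sub>v col b c = M *\<^sub>v unit_vec n (Suc c)" using mat_mult_unit_vec[OF Mc(1) c(2)] by simp
      then have "col b c = unit_vec n (Suc c)" by (rule inj) (use cb in auto)
      then have "col b c $ r = unit_vec n (Suc c) $ r" by simp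
      then show ?thesis using that c bc by auto
    qed
    moreover have "b $$ (r, c) = 0" if "r < n" "j \<le> r" "Suc c = j" for r c
    proof -
      have c: "c < n" using that assms(1) by auto
      have "M *\<^sub>v col b c = M *\<^sub>v w" using gcol[OF c] cols[of c] gS[of c] w(3) that by auto
      then have "col b c = w" by (rule inj) (use cb w in auto)
      then show ?thesis using w(2) that c bc by (metis carrier_matD index_col)
    qed
    ultimately show "b \<in> block_companions j n \<and> v = (if j = 0 then 0\<^sub>v n else col M 0)"
      using b unfolding block_companions_iff[OF assms(1)] by blast
  next
    assume R: "b \<in> block_companions j n \<and> v = (if j = 0 then 0\<^sub>v n else col M 0)"
    have ent: "b $$ (r, c) = (if r = Suc c then 1 else 0)" if "r < n" "Suc c < j" for r c
      using R block_companions_iff[OF assms(1), of b] that by auto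
    have ent0: "b $$ (r, c) = 0" if "r < n" "j \<le> r" "Suc c = j" for r c
      using R block_companions_iff[OF assms(1), of b] that by auto
    have cols: "col M i = (?g ^\<^sub>m i) *\<^sub>v v" if "i < j" for i
      using that
    proof (induction i)
      case 0
      then show ?case using R v Mc by auto
    next
      case (Suc i)
      have i: "i < n" "Suc i < n" using Suc assms(1) by auto
      have "col b i = unit_vec n (Suc i)" using ent i Suc bc by (intro eq_vecI) auto
      then have "M *\<^sub>v col b i = col M (Suc i)" using mat_mult_unit_vec[OF Mc(1) i(2)] by simp
      then show ?case using Suc gS[of i] gcol[OF i(1)] by simp
    qed
    have "\<exists>w\<in>carrier_vec n. (\<forall>l<n. j \<le> l \<longrightarrow> w $ l = 0) \<and> (?g ^\<^sub>m j) *\<^sub>v v = M *\<^sub>v w"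
    proof (cases j)
      case 0
      have "M *\<^sub>v 0\<^sub>v n = 0\<^sub>v n" using Mc by (intro eq_vecI) auto
      then show ?thesis using 0 R Mc by (intro bexI[of _ "0\<^sub>v n"]) auto
    next
      case (Suc c)
      have c: "c < n" using Suc assms(1) by simp
      have "(?g ^\<^sub>m j) *\<^sub>v v = M *\<^sub>v col b c" using Suc gS[of c] cols[of c] gcol[OF c] by simp
      moreover have "\<forall>l<n. j \<le> l \<longrightarrow> col b c $ l = 0" using ent0 Suc c bc by auto
      ultimately show ?thesis using cb[of c] by blast
    qed
    then show "krylov_frame n ?g v j M"
      unfolding krylov_frame_def using M cols by auto
  qed
qed

text \<open>Triples of \<open>g\<close>, \<open>v\<close> and a frame \<open>M\<close> are counted
  in two ways. Each pair of index \<open>j\<close> has the same number of frames; conversely,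
  passing to the basis \<open>M\<close> turns a triple into an arbitrary \<open>M\<close> and a
  block matrix, on which the class function factors.\<close>

lemma sum_GL_recursion:
  fixes \<phi> :: "'a::{finite,field} mat \<Rightarrow> complex"
  assumes conj: "\<And>M b. M \<in> GL n \<Longrightarrow> b \<in> GL n \<Longrightarrow> \<phi> (M * (b * GL_inv n M)) = \<phi> b"
    and mult: "\<And>j C D G. j \<le> n \<Longrightarrow> C \<in> GL j \<Longrightarrow> D \<in> carrier_mat j (n - j) \<Longrightarrow> G \<in> GL (n - j) \<Longrightarrow>
      \<phi> (four_block_mat C D (0\<^sub>m (n - j) j) G) = \<phi> C * \<phi> G"
  shows "of_nat (CARD('a) ^ n) * (\<Sum>g\<in>GL n. \<phi> g) / of_nat (card (GL n :: 'a mat set)) =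
    (\<Sum>j\<le>n. (\<Sum>C\<in>companions j. \<phi> C) * ((\<Sum>G\<in>GL (n - j). \<phi> G) / of_nat (card (GL (n - j) :: 'a mat set))))"
proof -
  let ?GL = "GL n :: 'a mat set" and ?V = "carrier_vec n :: 'a vec set"
  have cGL: "card (GL m :: 'a mat set) > 0" for m
    using finite_GL GL_nonempty by (metis card_gt_0_iff)
  define K where "K j = {(g, v). g \<in> ?GL \<and> v \<in> ?V \<and> (\<exists>M. krylov_frame n g v j M)}" for j
  have KU: "?GL \<times> ?V = (\<Union>j\<in>{..n}. K j)"
  proof (intro equalityI subsetI)
    fix x assume "x \<in> ?GL \<times> ?V"
    then obtain g v where x: "x = (g, v)" "g \<in> ?GL" "v \<in> ?V" by auto
    obtain j M where "j \<le> n" "krylov_frame n g v j M"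
      using krylov_frame_exists[OF GL_carrier[OF x(2)] x(3)] by blast
    then show "x \<in> (\<Union>j\<in>{..n}. K j)" using x by (auto simp: K_def)
  qed (auto simp: K_def)
  have finK: "finite (K j)" for j
    by (rule finite_subset[of _ "?GL \<times> ?V"]) (auto simp: K_def finite_GL finite_carrier_vec)
  have disj: "K i \<inter> K j = {}" if "i \<in> {..n}" "j \<in> {..n}" "i \<noteq> j" for i j
  proof (rule ccontr)
    assume "K i \<inter> K j \<noteq> {}"
    then obtain g v M M' where gv: "g \<in> ?GL" "v \<in> ?V" and "krylov_frame n g v i M" "krylov_frame n g v j M'"
      by (auto simp: K_def)
    then have "i \<le> j" "j \<le> i"
      using krylov_frame_index_unique[OF GL_carrier[OF gv(1)] gv(2)] that
      by blast+
    with that show False by simp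
  qed
  have part: "(\<Sum>(g, v)\<in>K j. \<phi> g) =
     of_nat (card ?GL) * ((\<Sum>C\<in>companions j. \<phi> C) * ((\<Sum>G\<in>GL (n - j). \<phi> G) / of_nat (card (GL (n - j) :: 'a mat set))))"
    if j: "j \<le> n" for j
  proof -
    let ?U = "card (block_units j n :: 'a mat set)"
    let ?F = "\<lambda>(g, v). {M. krylov_frame n g v j M}"
    have finF: "finite {M. krylov_frame n g v j M}" for g :: "'a mat" and v
      by (rule finite_subset[OF _ finite_GL[of n]]) (auto simp: krylov_frame_def)
    define to_pair :: "('a mat \<times> 'a vec) \<times> 'a mat \<Rightarrow> 'a mat \<times> 'a mat"
      where "to_pair = (\<lambda>((g, v), M). (M, GL_inv n M * (g * M)))"
    define from_pair :: "'a mat \<times> 'a mat \<Rightarrow> ('a mat \<times> 'a vec) \<times> 'a mat"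
      where "from_pair = (\<lambda>(M, b). ((M * (b * GL_inv n M), if j = 0 then 0\<^sub>v n else col M 0), M))"
    have "of_nat ?U * (\<Sum>(g, v)\<in>K j. \<phi> g) = (\<Sum>x\<in>K j. \<Sum>M\<in>?F x. \<phi> (fst x))"
      by (auto simp: sum_distrib_left K_def dest: card_krylov_frames[OF j] intro!: sum.cong)
    also have "\<dots> = (\<Sum>(x, M)\<in>Sigma (K j) ?F. \<phi> (fst x))"
      using finK finF by (subst sum.Sigma) auto
    also have "\<dots> = (\<Sum>(M, b)\<in>?GL \<times> (block_companions j n :: 'a mat set). \<phi> b)"
    proof (rule sum.reindex_bij_witness[where j = to_pair and i = from_pair])
      fix a assume a: "a \<in> Sigma (K j) ?F"
      obtain g v M where av: "a = ((g, v), M)" by (metis surj_pair)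
      have *: "g \<in> ?GL" "v \<in> ?V" "krylov_frame n g v j M" using a by (auto simp: av K_def)
      then have M: "M \<in> GL n" by (auto simp: krylov_frame_def)
      note c = GL_carrier[OF *(1)] GL_carrier[OF M] GL_carrier[OF GL_inv(1)[OF M]]
      let ?b = "GL_inv n M * (g * M)"
      have b: "?b \<in> GL n" using * M by (intro GL_mult GL_inv)
      have gb: "M * (?b * GL_inv n M) = g"
      proof -
        have "M * (?b * GL_inv n M) = M * ?b * GL_inv n M"
          using c GL_carrier[OF b] by (simp add: assoc_mult_mat[of _ n n _ n _ n])
        also have "M * ?b = g * M" using GL_cancel(1)[OF M, of "g * M" n] c by simp
        also have "g * M * GL_inv n M = g" using c GL_inv[OF M] by (simp add: assoc_mult_mat[of _ n n _ n _ n])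
        finally show ?thesis .
      qed
      have R: "?b \<in> block_companions j n \<and> v = (if j = 0 then 0\<^sub>v n else col M 0)"
        using krylov_frame_iff_conj[OF j M b *(2)] *(3) unfolding gb by blast
      show "from_pair (to_pair a) = a"
        using R gb by (simp add: av to_pair_def from_pair_def)
      show "to_pair a \<in> ?GL \<times> (block_companions j n :: 'a mat set)"
        using R M by (simp add: av to_pair_def)
      show "(case to_pair a of (M, b) \<Rightarrow> \<phi> b) = (case a of (x, M) \<Rightarrow> \<phi> (fst x))"
        using conj[OF M b] unfolding gb by (simp add: av to_pair_def)
    next
      fix a assume a: "a \<in> ?GL \<times> (block_companions j n :: 'a mat set)"
      obtain M b where av: "a = (M, b)" by (cases a)
      have M: "M \<in> GL n" and bb: "b \<in> block_companions j n" using a by (auto simp: av)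
      have b: "b \<in> GL n" using bb block_companions_iff[OF j] by blast
      note c = GL_carrier[OF b] GL_carrier[OF M] GL_carrier[OF GL_inv(1)[OF M]]
      let ?g = "M * (b * GL_inv n M)" and ?v = "if j = 0 then 0\<^sub>v n else col M 0"
      have v: "?v \<in> ?V" using c by auto
      have g: "?g \<in> GL n" using M b by (intro GL_mult GL_inv)
      have "?g * M = M * b"
        using c GL_inv[OF M] by (simp add: assoc_mult_mat[of _ n n _ n _ n])
      then have "GL_inv n M * (?g * M) = b" using GL_cancel(2)[OF M c(1)] by simp
      then show "to_pair (from_pair a) = a"
        by (simp add: av to_pair_def from_pair_def)
      have "krylov_frame n ?g ?v j M" using krylov_frame_iff_conj[OF j M b v] bb by blast
      then show "from_pair a \<in> Sigma (K j) ?F"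
        using g v unfolding av K_def from_pair_def
        by (simp only: prod.case mem_Sigma_iff mem_Collect_eq) (intro conjI exI[of _ M] TrueI)
    qed
    also have "\<dots> = of_nat (card ?GL) * (\<Sum>b\<in>block_companions j n. \<phi> b)"
      by (simp add: sum.cartesian_product[symmetric])
    also have "\<dots> = of_nat (card ?GL) * (of_nat (card (carrier_mat j (n - j) :: 'a mat set)) *
        (\<Sum>C\<in>companions j. \<phi> C) * (\<Sum>G\<in>GL (n - j). \<phi> G))"
      using sum_block_companions[of j n \<phi>] mult[OF j] by simp
    finally have eq: "of_nat ?U * (\<Sum>(g, v)\<in>K j. \<phi> g) =
        of_nat (card ?GL) * (of_nat (card (carrier_mat j (n - j) :: 'a mat set)) *
        (\<Sum>C\<in>companions j. \<phi> C) * (\<Sum>G\<in>GL (n - j). \<phi> G))" .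
    \<comment> \<open>Here \<open>a\<close> is the number of upper right blocks, which occurs on
      both sides and cancels; \<open>h\<close> is the order of the smaller group and turns its sum
      into a mean.\<close>
    have "s = c * (A * (B / h))" if "of_nat (a * h) * s = c * (of_nat a * A * B)" "a > 0" "h > 0"
      for s A B c :: complex and a h :: nat
      using that by (simp add: field_simps)
    from this[OF eq[unfolded card_block_units] card_carrier_mat_pos cGL] show ?thesis .
  qed
  have "of_nat (CARD('a) ^ n) * (\<Sum>g\<in>?GL. \<phi> g) = (\<Sum>(g, v)\<in>?GL \<times> ?V. \<phi> g)"
    by (simp add: sum.cartesian_product[symmetric] card_carrier_vec sum_distrib_left)
  also have "\<dots> = (\<Sum>j\<le>n. \<Sum>(g, v)\<in>K j. \<phi> g)"
    unfolding KU by (rule sum.UNION_disjoint) (use finK disj in auto)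
  also have "\<dots> = of_nat (card ?GL) * (\<Sum>j\<le>n. (\<Sum>C\<in>companions j. \<phi> C) * ((\<Sum>G\<in>GL (n - j). \<phi> G) / of_nat (card (GL (n - j) :: 'a mat set))))"
    unfolding sum_distrib_left by (intro sum.cong refl part) simp
  finally have eq: "of_nat (CARD('a) ^ n) * (\<Sum>g\<in>?GL. \<phi> g) = of_nat (card ?GL) *
    (\<Sum>j\<le>n. (\<Sum>C\<in>companions j. \<phi> C) * ((\<Sum>G\<in>GL (n - j). \<phi> G) / of_nat (card (GL (n - j) :: 'a mat set))))" .
  show ?thesis unfolding eq using cGL[of n] by simp
qed

subsection \<open>Traces of powers and characteristic polynomials\<close>

lemma mat_trace_comm:
  fixes A B :: "'a::comm_semiring_0 mat"
  assumes "A \<in> carrier_mat n m" "B \<in> carrier_mat m n"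
  shows "mat_trace (A * B) = mat_trace (B * A)"
proof -
  have "mat_trace (A * B) = (\<Sum>i<n. \<Sum>j<m. A $$ (i, j) * B $$ (j, i))"
    using assms by (simp add: mat_trace_def scalar_prod_def atLeast0LessThan)
  also have "\<dots> = (\<Sum>j<m. \<Sum>i<n. B $$ (j, i) * A $$ (i, j))"
    by (subst sum.swap) (simp add: mult.commute)
  also have "\<dots> = mat_trace (B * A)"
    using assms by (simp add: mat_trace_def scalar_prod_def atLeast0LessThan)
  finally show ?thesis .
qed

lemma mat_trace_pow_similar:
  fixes A B :: "'a::comm_ring_1 mat"
  assumes "similar_mat_wit A B P Q"
  shows "mat_trace (A ^\<^sub>m k) = mat_trace (B ^\<^sub>m k)"
proof -
  define n where "n = dim_row A"
  note w = similar_mat_witD[OF n_def assms]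
  have "A ^\<^sub>m k = P * B ^\<^sub>m k * Q" using similar_mat_wit_pow_id[OF assms] .
  moreover have "mat_trace (P * B ^\<^sub>m k * Q) = mat_trace (Q * (P * B ^\<^sub>m k))"
    using w by (intro mat_trace_comm[of _ n n]) auto
  moreover have "Q * (P * B ^\<^sub>m k) = Q * P * B ^\<^sub>m k"
    using w by (intro assoc_mult_mat[symmetric, of _ n n _ n _ n]) auto
  ultimately show ?thesis using w by simp
qed

lemma GL_conj_similar:
  fixes b :: "'a::field mat"
  assumes "M \<in> GL n" "b \<in> carrier_mat n n"
  shows "similar_mat_wit (M * (b * GL_inv n M)) b M (GL_inv n M)"
proof -
  note c = GL_carrier[OF assms(1)] GL_carrier[OF GL_inv(1)[OF assms(1)]]
  show ?thesis
  proof (rule similar_mat_witI[of _ _ n])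
    show "M * (b * GL_inv n M) = M * b * GL_inv n M"
      using c assms(2) by (intro assoc_mult_mat[symmetric, of _ n n _ n _ n])
  qed (use c assms(2) GL_inv[OF assms(1)] in auto)
qed

lemma mat_trace_four_block:
  assumes "A \<in> carrier_mat n n" "D \<in> carrier_mat m m"
  shows "mat_trace (four_block_mat A B C D) = mat_trace A + mat_trace D"
proof -
  let ?F = "four_block_mat A B C D"
  have "dim_row ?F = n + m" using assms by simp
  then have "mat_trace ?F = (\<Sum>i=0..<n+m. ?F $$ (i, i))"
    by (simp only: mat_trace_def atLeast0LessThan)
  also have "\<dots> = (\<Sum>i=0..<n. ?F $$ (i, i)) + (\<Sum>i=n..<n+m. ?F $$ (i, i))"
    by (rule sum.atLeastLessThan_concat[symmetric]) auto
  also have "(\<Sum>i=n..<n+m. ?F $$ (i, i)) = (\<Sum>i<m. ?F $$ (i + n, i + n))"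
    using sum.shift_bounds_nat_ivl[of "\<lambda>i. ?F $$ (i, i)" 0 n m] by (simp add: atLeast0LessThan add.commute)
  finally show ?thesis using assms by (simp add: mat_trace_def atLeast0LessThan)
qed

lemma pow_four_block_lower_left_zero:
  fixes A :: "'a::semiring_1 mat"
  assumes "A \<in> carrier_mat n n" "B \<in> carrier_mat n m" "D \<in> carrier_mat m m"
  shows "\<exists>B'\<in>carrier_mat n m. (four_block_mat A B (0\<^sub>m m n) D) ^\<^sub>m k = four_block_mat (A ^\<^sub>m k) B' (0\<^sub>m m n) (D ^\<^sub>m k)"
proof (induction k)
  case 0
  show ?case using assms by (intro bexI[of _ "0\<^sub>m n m"]) auto
next
  case (Suc k)
  then obtain B' where B': "B' \<in> carrier_mat n m"
    "(four_block_mat A B (0\<^sub>m m n) D) ^\<^sub>m k = four_block_mat (A ^\<^sub>m k) B' (0\<^sub>m m n) (D ^\<^sub>m k)" by blast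
  have "four_block_mat (A ^\<^sub>m k) B' (0\<^sub>m m n) (D ^\<^sub>m k) * four_block_mat A B (0\<^sub>m m n) D =
    four_block_mat (A ^\<^sub>m Suc k) (A ^\<^sub>m k * B + B' * D) (0\<^sub>m m n) (D ^\<^sub>m Suc k)"
    using assms B'(1) by (subst mult_four_block_mat[of _ n n _ m _ m _ _ n _ m]) auto
  then show ?case using assms B' by (intro bexI[of _ "A ^\<^sub>m k * B + B' * D"]) auto
qed

lemma mat_trace_pow_four_block:
  fixes A :: "'a::semiring_1 mat"
  assumes "A \<in> carrier_mat n n" "B \<in> carrier_mat n m" "D \<in> carrier_mat m m"
  shows "mat_trace ((four_block_mat A B (0\<^sub>m m n) D) ^\<^sub>m k) = mat_trace (A ^\<^sub>m k) + mat_trace (D ^\<^sub>m k)"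
proof -
  obtain B' where "(four_block_mat A B (0\<^sub>m m n) D) ^\<^sub>m k = four_block_mat (A ^\<^sub>m k) B' (0\<^sub>m m n) (D ^\<^sub>m k)"
    using pow_four_block_lower_left_zero[OF assms] by blast
  then show ?thesis using mat_trace_four_block[of "A ^\<^sub>m k" n "D ^\<^sub>m k" m] assms by simp
qed

lemma pow_mat_one: "A \<in> carrier_mat 1 1 \<Longrightarrow> (A ^\<^sub>m k) $$ (0, 0) = (A $$ (0, 0)) ^ k"
  for A :: "'a::comm_semiring_1 mat"
  by (induction k) (auto simp: scalar_prod_def mult.commute)

text \<open>Triangularize \<open>A\<close> by splitting off one eigenvector at a time.\<close>

lemma mat_trace_pow_eq_sum_roots:
  fixes A :: "'a::alg_closed_field mat"
  assumes "A \<in> carrier_mat n n"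
  shows "mat_trace (A ^\<^sub>m k) = (\<Sum>x\<in>#proots (char_poly A). x ^ k)"
  using assms
proof (induction n arbitrary: A)
  case 0
  have "char_poly A = 1" using degree_monic_char_poly[OF 0] monic_degree_0[of "char_poly A"] by simp
  then show ?case using 0 by (simp add: mat_trace_def)
next
  case (Suc m)
  let ?n = "Suc m"
  have dm: "degree (char_poly A) = ?n" "lead_coeff (char_poly A) = 1"
    using degree_monic_char_poly[OF Suc.prems] by auto
  then obtain e where "poly (char_poly A) e = 0" using alg_closed_imp_poly_has_root[of "char_poly A"] by auto
  then have "eigenvalue A e" using eigenvalue_root_char_poly[OF Suc.prems] by simp
  then obtain v where v: "v \<in> carrier_vec ?n" "v \<noteq> 0\<^sub>v ?n" "A *\<^sub>v v = e \<cdot>\<^sub>v v"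
    using Suc.prems by (auto simp: eigenvalue_def eigenvector_def)
  have "\<exists>l<?n. v $ l \<noteq> 0"
  proof (rule ccontr)
    assume "\<not> ?thesis"
    then have "v = 0\<^sub>v ?n" using v(1) by (intro eq_vecI) auto
    with v(2) show False by simp
  qed
  then obtain l where l: "l < ?n" "v $ l \<noteq> 0" by blast
  obtain N where N: "N \<in> GL ?n" "col N 0 = v"
    using GL_extend_unit_vecs[OF v(1) le0 l] by blast
  note c = Suc.prems GL_carrier[OF N(1)] GL_carrier[OF GL_inv(1)[OF N(1)]]
  define B where "B = GL_inv ?n N * (A * N)"
  have B: "B \<in> carrier_mat ?n ?n" unfolding B_def using c by auto
  have NB: "N * (B * GL_inv ?n N) = A"
  proof -
    have "N * (B * GL_inv ?n N) = N * B * GL_inv ?n N"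
      using c B by (simp add: assoc_mult_mat[of _ ?n ?n _ ?n _ ?n])
    also have "N * B = A * N" unfolding B_def using GL_cancel(1)[OF N(1), of "A * N" ?n] c by simp
    also have "A * N * GL_inv ?n N = A" using c GL_inv[OF N(1)] by (simp add: assoc_mult_mat[of _ ?n ?n _ ?n _ ?n])
    finally show ?thesis .
  qed
  have sim: "similar_mat_wit A B N (GL_inv ?n N)"
    using GL_conj_similar[OF N(1) B] unfolding NB .
  have "col B 0 = GL_inv ?n N *\<^sub>v (A *\<^sub>v v)"
    unfolding B_def using c N(2) by (subst col_mult_vec[of _ ?n ?n _ ?n], simp, simp, simp, subst col_mult_vec[of _ ?n ?n _ ?n]) auto
  also have "\<dots> = e \<cdot>\<^sub>v (GL_inv ?n N *\<^sub>v v)" unfolding v(3) using c v(1) by (intro mult_mat_vec) auto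
  also have "v = N *\<^sub>v unit_vec ?n 0" using mat_mult_unit_vec[OF c(2), of 0] N(2) by simp
  also have "GL_inv ?n N *\<^sub>v (N *\<^sub>v unit_vec ?n 0) = unit_vec ?n 0" by (rule GL_cancel_vec[OF N(1)]) simp
  finally have colB: "col B 0 = e \<cdot>\<^sub>v unit_vec ?n 0" .
  have entB: "B $$ (r, 0) = (if r = 0 then e else 0)" if "r < ?n" for r
  proof -
    have "col B 0 $ r = (e \<cdot>\<^sub>v unit_vec ?n 0) $ r" using colB by simp
    then show ?thesis using that B by auto
  qed
  have one_le: "1 \<le> ?n" by simp
  have z: "B $$ (r, c) = 0" if "r < ?n" "1 \<le> r" "c < 1" for r c using entB that by simp
  obtain A1 D G where bl: "A1 \<in> carrier_mat 1 1" "D \<in> carrier_mat 1 (?n - 1)" "G \<in> carrier_mat (?n - 1) (?n - 1)"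
    "B = four_block_mat A1 D (0\<^sub>m (?n - 1) 1) G" and A1: "\<And>r c. r < 1 \<Longrightarrow> c < 1 \<Longrightarrow> A1 $$ (r, c) = B $$ (r, c)"
    using four_block_lower_left_zero_ex[OF one_le B] z by metis
  have A1e: "A1 $$ (0, 0) = e" using A1[of 0 0] entB[of 0] by simp
  have G: "G \<in> carrier_mat m m" "D \<in> carrier_mat 1 m" using bl by auto
  have "char_poly A = char_poly B" using sim by (intro char_poly_similar) (auto simp: similar_mat_def)
  also have "\<dots> = char_poly A1 * char_poly G"
    unfolding bl(4) using char_poly_four_block_zeros_col[OF bl(1) G(2,1)] by simp
  also have "char_poly A1 = [:- e, 1:]"
    using bl(1) A1e by (simp add: char_poly_defs det_single)
  finally have cp: "char_poly A = [:- e, 1:] * char_poly G" .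
  have "char_poly G \<noteq> 0" using degree_monic_char_poly[OF G(1)] by auto
  then have "proots (char_poly A) = add_mset e (proots (char_poly G))"
    unfolding cp by (subst proots_mult) auto
  moreover have "mat_trace (A ^\<^sub>m k) = mat_trace (B ^\<^sub>m k)" by (rule mat_trace_pow_similar[OF sim])
  moreover have "mat_trace (B ^\<^sub>m k) = mat_trace (A1 ^\<^sub>m k) + mat_trace (G ^\<^sub>m k)"
    unfolding bl(4) using mat_trace_pow_four_block[OF bl(1) G(2,1)] by simp
  moreover have "mat_trace (A1 ^\<^sub>m k) = e ^ k"
    using pow_mat_one[OF bl(1), of k] A1e bl(1) by (simp add: mat_trace_def)
  ultimately show ?case using Suc.IH[OF G(1)] by simp
qed

text \<open>Laplace expansion along row 0, where only the first and the last column are nonzero. The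
  first leaves the same matrix with the coefficients shifted by one. The last leaves an upper
  triangular minor with diagonal -1, whose determinant cancels the sign of the cofactor.\<close>

lemma det_companion:
  fixes c :: "nat \<Rightarrow> 'a::comm_ring_1"
  shows "det (mat j j (\<lambda>(r, s). (if r = s then [:0, 1:] else 0) -
      (if Suc s = j then [:c r:] else if r = Suc s then 1 else 0))) = monom 1 j - (\<Sum>i<j. monom (c i) i)"
proof (induction j arbitrary: c)
  case 0
  show ?case by (simp add: monom_0 one_pCons)
next
  case (Suc m)
  let ?M = "\<lambda>j c. mat j j (\<lambda>(r, s). (if r = s then [:0, 1:] else 0) -
      (if Suc s = j then [:c r:] else if r = Suc s then 1 else 0))"
  define A where "A = ?M (Suc m) c"
  have A: "A \<in> carrier_mat (Suc m) (Suc m)" by (simp add: A_def)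
  show ?case
  proof (cases "m = 0")
    case True
    have "det A = A $$ (0, 0)" using A True by (simp add: det_single)
    then show ?thesis using True unfolding A_def by (simp add: monom_0 monom_Suc one_pCons)
  next
    case False
    have "det A = (\<Sum>s<Suc m. A $$ (0, s) * cofactor A 0 s)"
      by (rule laplace_expansion_row[OF A]) simp
    also have "\<dots> = (\<Sum>s\<in>{0, m}. A $$ (0, s) * cofactor A 0 s)"
      by (rule sum.mono_neutral_right) (use False in \<open>auto simp: A_def\<close>)
    also have "\<dots> = A $$ (0, 0) * cofactor A 0 0 + A $$ (0, m) * cofactor A 0 m"
      using False by simp
    also have "A $$ (0, 0) = [:0, 1:]" using False by (simp add: A_def)
    also have "A $$ (0, m) = - [:c 0:]" using False by (simp add: A_def)
    also have "cofactor A 0 0 = det (?M m (\<lambda>i. c (Suc i)))"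
    proof -
      have "mat_delete A 0 0 = ?M m (\<lambda>i. c (Suc i))"
        by (rule eq_matI) (auto simp: A_def mat_delete_def)
      then show ?thesis by (simp add: cofactor_def)
    qed
    also have "\<dots> = monom 1 m - (\<Sum>i<m. monom (c (Suc i)) i)" by (rule Suc.IH)
    also have "cofactor A 0 m = 1"
    proof -
      let ?D = "mat_delete A 0 m"
      have D: "?D \<in> carrier_mat m m" using A by (simp add: mat_delete_def)
      have ent: "?D $$ (r, s) = (if Suc r = s then [:0, 1:] else 0) - (if r = s then 1 else 0)"
        if "r < m" "s < m" for r s using that by (auto simp: A_def mat_delete_def)
      have "upper_triangular ?D" using D ent by (auto simp: upper_triangular_def)
      then have "det ?D = prod_list (diag_mat ?D)" by (rule det_upper_triangular[OF _ D])
      also have "diag_mat ?D = replicate m (-1)"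
        using D ent by (intro nth_equalityI) (auto simp: diag_mat_def)
      finally show ?thesis by (simp add: cofactor_def power_mult_distrib[symmetric])
    qed
    finally have "det A = [:0, 1:] * (monom 1 m - (\<Sum>i<m. monom (c (Suc i)) i)) + - [:c 0:] * 1" .
    also have "\<dots> = monom 1 (Suc m) - (\<Sum>i<Suc m. monom (c i) i)"
    proof -
      have mX: "monom a (Suc i) = [:0, 1:] * monom a i" for a :: 'a and i by (simp add: monom_Suc)
      show ?thesis
        unfolding sum.lessThan_Suc_shift mX sum_distrib_left[symmetric] right_diff_distrib
        by (simp add: monom_0)
    qed
    finally show ?thesis by (simp add: A_def)
  qed
qed

definition is_companion :: "nat \<Rightarrow> 'a::field mat \<Rightarrow> bool" where
  "is_companion j C \<longleftrightarrow> C \<in> carrier_mat j j \<and>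
     (\<forall>r<j. \<forall>c. Suc c < j \<longrightarrow> C $$ (r, c) = (if r = Suc c then 1 else 0))"

lemma companions_eq: "companions j = {C. is_companion j C \<and> det C \<noteq> 0}"
  by (auto simp: companions_def is_companion_def GL_iff_det)

lemma char_poly_companion:
  fixes C :: "'a::field mat"
  assumes "is_companion j C"
  shows "char_poly C = monom 1 j - (\<Sum>i<j. monom (C $$ (i, j - 1)) i)"
proof -
  have C: "C \<in> carrier_mat j j" using assms by (simp add: is_companion_def)
  have "char_poly_matrix C = mat j j (\<lambda>(r, s). (if r = s then [:0, 1:] else 0) -
      (if Suc s = j then [:C $$ (r, j - 1):] else if r = Suc s then 1 else 0))"
    using assms C
    by (intro eq_matI) (auto simp: char_poly_matrix_def is_companion_def one_pCons)
  then show ?thesis using det_companion[of j "\<lambda>r. C $$ (r, j - 1)"] by (simp add: char_poly_def)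
qed

lemma coeff_char_poly_companion:
  fixes C :: "'a::field mat"
  assumes "is_companion j C" "i < j"
  shows "coeff (char_poly C) i = - C $$ (i, j - 1)"
  using assms by (simp add: char_poly_companion coeff_sum sum.delta)

lemma det_nonzero_iff_char_poly:
  fixes A :: "'a::field mat"
  assumes "A \<in> carrier_mat n n"
  shows "det A \<noteq> 0 \<longleftrightarrow> coeff (char_poly A) 0 \<noteq> 0"
proof -
  have "char_matrix A 0 = A" using assms by (intro eq_matI) (auto simp: char_matrix_def)
  then have "det A = 0 \<longleftrightarrow> poly (char_poly A) 0 = 0"
    using eigenvalue_det[OF assms, of 0] eigenvalue_root_char_poly[OF assms, of 0] by simp
  then show ?thesis by (simp add: poly_0_coeff_0)
qed

definition monic_unit_polys :: "nat \<Rightarrow> 'a::field poly set" where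
  "monic_unit_polys j = {p. degree p = j \<and> lead_coeff p = 1 \<and> coeff p 0 \<noteq> 0}"

text \<open>The last column of a companion matrix holds the negated lower coefficients of its
  characteristic polynomial, and invertibility is the nonvanishing of the constant one.\<close>

lemma bij_betw_companions_char_poly:
  "bij_betw char_poly (companions j) (monic_unit_polys j :: 'a::field poly set)"
proof (rule bij_betwI')
  fix C C' :: "'a mat" assume C: "C \<in> companions j" "C' \<in> companions j"
  then have ic: "is_companion j C" "is_companion j C'" by (auto simp: companions_eq)
  show "(char_poly C = char_poly C') \<longleftrightarrow> C = C'"
  proof
    assume eq: "char_poly C = char_poly C'"
    have "C $$ (r, c) = C' $$ (r, c)" if "r < j" "c < j" for r c
    proof (cases "Suc c < j")
      case True
      then show ?thesis using ic that by (simp add: is_companion_def)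
    next
      case False
      then have "c = j - 1" using that by simp
      then show ?thesis using coeff_char_poly_companion[OF ic(1) that(1)] coeff_char_poly_companion[OF ic(2) that(1)] eq by simp
    qed
    then show "C = C'" using ic by (intro eq_matI) (auto simp: is_companion_def)
  qed simp
next
  fix C :: "'a mat" assume "C \<in> companions j"
  then have C: "C \<in> carrier_mat j j" "det C \<noteq> 0" by (auto simp: companions_eq is_companion_def)
  show "char_poly C \<in> monic_unit_polys j"
    using degree_monic_char_poly[OF C(1)] det_nonzero_iff_char_poly[OF C(1)] C(2)
    by (simp add: monic_unit_polys_def)
next
  fix p :: "'a poly" assume p: "p \<in> monic_unit_polys j"
  define C where "C = mat j j (\<lambda>(r, s). if Suc s = j then - coeff p r else if r = Suc s then 1 else 0)"
  have ic: "is_companion j C" by (auto simp: is_companion_def C_def)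
  then have C: "C \<in> carrier_mat j j" by (simp add: is_companion_def)
  have "char_poly C = p"
  proof (rule poly_eqI)
    fix i
    consider "i < j" | "i = j" | "i > j" by linarith
    then show "coeff (char_poly C) i = coeff p i"
    proof cases
      case 1
      then show ?thesis using coeff_char_poly_companion[OF ic 1] by (simp add: C_def)
    next
      case 2
      then show ?thesis using degree_monic_char_poly[OF C] p by (auto simp: monic_unit_polys_def)
    next
      case 3
      then show ?thesis using degree_monic_char_poly[OF C] p by (auto simp: monic_unit_polys_def coeff_eq_0)
    qed
  qed
  moreover have "C \<in> companions j"
    using ic det_nonzero_iff_char_poly[OF C] \<open>char_poly C = p\<close> p by (simp add: companions_eq monic_unit_polys_def)
  ultimately show "\<exists>C\<in>companions j. p = char_poly C" by metis
qed

definition root_power_sum :: "nat \<Rightarrow> 'a::field poly \<Rightarrow> 'a alg_closure" where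
  "root_power_sum k p = (\<Sum>x\<in>#proots (map_poly to_ac p). x ^ k)"

interpretation to_ac: field_hom to_ac
  by standard auto

text \<open>Extending scalars to the closure makes eigenvectors available; traces, powers and
  characteristic polynomials commute with it.\<close>

lemma to_ac_mat_trace_pow:
  fixes A :: "'a::field mat"
  assumes "A \<in> carrier_mat n n"
  shows "to_ac (mat_trace (A ^\<^sub>m k)) = root_power_sum k (char_poly A)"
proof -
  have "to_ac (mat_trace (A ^\<^sub>m k)) = mat_trace (map_mat to_ac (A ^\<^sub>m k))"
    using assms by (simp add: mat_trace_def to_ac_sum)
  also have "map_mat to_ac (A ^\<^sub>m k) = map_mat to_ac A ^\<^sub>m k"
    by (rule to_ac.mat_hom_pow[OF assms])
  also have "mat_trace \<dots> = (\<Sum>x\<in>#proots (char_poly (map_mat to_ac A)). x ^ k)"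
    by (rule mat_trace_pow_eq_sum_roots) (use assms in simp)
  also have "char_poly (map_mat to_ac A) = map_poly to_ac (char_poly A)"
    by (rule to_ac.char_poly_hom[OF assms])
  finally show ?thesis by (simp add: root_power_sum_def)
qed

lemma sum_companions:
  fixes \<psi> :: "'a::field \<Rightarrow> complex"
  shows "(\<Sum>C\<in>companions j. \<psi> (mat_trace (C ^\<^sub>m k))) =
    (\<Sum>p\<in>monic_unit_polys j. \<psi> (of_ac (root_power_sum k p)))"
proof -
  have "\<psi> (mat_trace (C ^\<^sub>m k)) = \<psi> (of_ac (root_power_sum k (char_poly C)))" if "C \<in> companions j" for C
  proof -
    have C: "C \<in> carrier_mat j j" using that companions_subset_GL GL_carrier by blast
    show ?thesis using to_ac_mat_trace_pow[OF C, of k] by (metis of_ac_to_ac)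
  qed
  then show ?thesis
    using sum.reindex_bij_betw[OF bij_betw_companions_char_poly,
        of "\<lambda>p. \<psi> (of_ac (root_power_sum k p))" j]
    by simp
qed

subsection \<open>Finite fields inside the algebraic closure\<close>

lemma power_card_field:
  fixes x :: "'a::{finite,field}"
  shows "x ^ CARD('a) = x"
proof (cases "x = 0")
  case False
  let ?U = "UNIV - {0 :: 'a}"
  have "bij_betw (\<lambda>y. x * y) ?U ?U"
    by (rule bij_betw_byWitness[where f' = "\<lambda>y. y / x"]) (use False in auto)
  then have "(\<Prod>y\<in>?U. y) = (\<Prod>y\<in>?U. x * y)"
    using prod.reindex_bij_betw[of "\<lambda>y. x * y" ?U ?U "\<lambda>y. y"] by simp
  also have "\<dots> = x ^ card ?U * (\<Prod>y\<in>?U. y)" by (simp add: prod.distrib)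
  finally have "x ^ (CARD('a) - 1) = 1" by (simp add: card_Diff_singleton)
  moreover have "CARD('a) = Suc (CARD('a) - 1)" by simp
  ultimately show ?thesis by (metis mult.right_neutral power_Suc)
qed simp

lemma CARD_ge_2: "CARD('a::{finite,field}) \<ge> 2"
proof -
  have "card {0, 1 :: 'a} \<le> CARD('a)" by (rule card_mono) auto
  then show ?thesis by simp
qed

lemma poly_eq_0_if_many_roots:
  fixes p :: "'a::idom poly"
  assumes "finite A" "degree p < card A" "\<And>a. a \<in> A \<Longrightarrow> poly p a = 0"
  shows "p = 0"
proof (rule ccontr)
  assume "p \<noteq> 0"
  then have "card {x. poly p x = 0} \<le> degree p" by (rule card_poly_roots_bound)
  moreover have "card A \<le> card {x. poly p x = 0}"
    using assms \<open>p \<noteq> 0\<close> by (intro card_mono poly_roots_finite) auto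
  ultimately show False using assms by simp
qed

abbreviation frob :: "'a::{finite,field} alg_closure \<Rightarrow> 'a alg_closure" where
  "frob x \<equiv> x ^ CARD('a)"

text \<open>\<open>X^q - X\<close> has at most \<open>q\<close> roots, and the image of the base
  field already supplies \<open>q\<close> of them.\<close>

lemma frob_eq_iff: "frob x = x \<longleftrightarrow> x \<in> range (to_ac :: 'a::{finite,field} \<Rightarrow> _)"
proof
  let ?p = "monom 1 (CARD('a)) - [:0, 1:] :: 'a alg_closure poly"
  have q: "CARD('a) > 1" using CARD_ge_2[where 'a = 'a] by simp
  have "coeff ?p (CARD('a)) = 1" using q by (simp add: coeff_pCons split: nat.splits)
  then have p0: "?p \<noteq> 0" by (metis coeff_0 zero_neq_one)
  have "degree ?p \<le> CARD('a)" using q by (intro degree_diff_le degree_monom_le) auto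
  then have "card {x. poly ?p x = 0} \<le> CARD('a)" using card_poly_roots_bound[OF p0] by simp
  moreover have "range (to_ac :: 'a \<Rightarrow> _) \<subseteq> {x. poly ?p x = 0}"
    using power_card_field[where 'a = 'a] by (auto simp: poly_monom simp flip: to_ac_power)
  moreover have "card (range (to_ac :: 'a \<Rightarrow> _)) = CARD('a)" by (simp add: card_image inj_to_ac)
  ultimately have eq: "range (to_ac :: 'a \<Rightarrow> _) = {x. poly ?p x = 0}"
    using poly_roots_finite[OF p0] by (metis card_subset_eq card_mono order_antisym)
  assume "frob x = x"
  then show "x \<in> range (to_ac :: 'a \<Rightarrow> _)" unfolding eq by (simp add: poly_monom)
next
  assume "x \<in> range (to_ac :: 'a \<Rightarrow> _)"
  then show "frob x = x" using power_card_field[where 'a = 'a] by (auto simp flip: to_ac_power)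
qed

text \<open>The polynomial \<open>X\<^sup>q - X\<close> is the product of all \<open>X - a\<close> with \<open>a\<close> in the field, hence invariant under
  translation by the field; comparing roots then shows that it is additive.\<close>

lemma frob_add: "frob (x + y) = frob x + frob (y :: 'a::{finite,field} alg_closure)"
proof -
  have q: "CARD('a) > 1" using CARD_ge_2[where 'a = 'a] by simp
  let ?R = "range (to_ac :: 'a \<Rightarrow> _)"
  have cR: "card ?R = CARD('a)" by (simp add: card_image inj_to_ac)
  have lem: "degree (P - Q) < n" if "degree P = n" "degree Q = n" "lead_coeff P = 1" "lead_coeff Q = 1" "n > 0"
    for P Q :: "'a alg_closure poly" and n
  proof -
    have "degree (P - Q) \<le> n" using that by (intro degree_diff_le) auto
    moreover have "coeff (P - Q) n = 0" using that by simp
    ultimately show ?thesis using that(5) by (metis degree_0 leading_coeff_0_iff le_neq_implies_less)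
  qed
  have L: "frob z - z = (\<Prod>a\<in>?R. z - a)" for z
  proof -
    let ?P = "\<Prod>a\<in>?R. [:-a, 1:] :: 'a alg_closure poly"
    let ?D = "monom 1 (CARD('a)) - [:0, 1:] - ?P"
    have "degree (monom 1 (CARD('a)) - ?P) < CARD('a)"
    proof (rule lem)
      show "degree ?P = CARD('a)" by (subst degree_prod_eq_sum_degree) (auto simp: cR)
      show "lead_coeff ?P = 1" by (simp add: lead_coeff_prod)
    qed (use q in \<open>auto simp: degree_monom_eq\<close>)
    then have "degree (monom 1 (CARD('a)) - ?P - [:0, 1:]) < CARD('a)"
      by (rule degree_diff_less) (use q in auto)
    then have "degree ?D < card ?R" by (simp add: cR algebra_simps)
    moreover have "poly ?D a = 0" if "a \<in> ?R" for a
      using that frob_eq_iff[of a] by (auto simp: poly_monom poly_prod)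
    ultimately have "?D = 0" by (intro poly_eq_0_if_many_roots[of ?R]) auto
    then have "poly ?D z = 0" by simp
    then show ?thesis by (simp add: poly_monom poly_prod)
  qed
  have tr: "frob (y + a) = frob y + a" if a: "a \<in> ?R" for a
  proof -
    have bij: "bij_betw (\<lambda>b. b + a) ?R ?R"
    proof (rule bij_betw_byWitness[where f' = "\<lambda>b. b - a"])
      show "(\<lambda>b. b + a) ` ?R \<subseteq> ?R" "(\<lambda>b. b - a) ` ?R \<subseteq> ?R"
        using a by (auto simp flip: to_ac_add to_ac_diff)
    qed auto
    have "frob (y + a) - (y + a) = (\<Prod>b\<in>?R. (y + a) - (b + a))"
      unfolding L using prod.reindex_bij_betw[OF bij, of "\<lambda>b. (y + a) - b"] by simp
    also have "\<dots> = frob y - y" unfolding L by simp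
    finally show ?thesis by (simp add: algebra_simps)
  qed
  \<comment> \<open>As a polynomial in \<open>x\<close> this has degree below \<open>q\<close>,
    because the leading terms cancel, while \<open>tr\<close> supplies \<open>q\<close>
    roots.\<close>
  let ?S = "[:y, 1:] ^ CARD('a) - monom 1 (CARD('a)) - [:frob y:]"
  have "degree ([:y, 1:] ^ CARD('a) - monom 1 (CARD('a))) < CARD('a)"
  proof (rule lem)
    show "lead_coeff ([:y, 1:] ^ CARD('a)) = 1" by (subst lead_coeff_power) simp
  qed (use q in \<open>auto simp: degree_monom_eq degree_power_eq\<close>)
  then have "degree ?S < CARD('a)" by (rule degree_diff_less) (use q in auto)
  then have "degree ?S < card ?R" by (simp add: cR)
  moreover have "poly ?S a = 0" if "a \<in> ?R" for a
    using tr[OF that] frob_eq_iff[of a] that by (simp add: poly_monom add.commute)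
  ultimately have "?S = 0" by (intro poly_eq_0_if_many_roots[of ?R]) auto
  then have "poly ?S x = 0" by simp
  then show ?thesis by (simp add: poly_monom algebra_simps)
qed

lemma frob_pow_add:
  "(x + y) ^ (CARD('a) ^ i) = x ^ (CARD('a) ^ i) + (y :: 'a::{finite,field} alg_closure) ^ (CARD('a) ^ i)"
  by (induction i) (simp_all add: power_mult frob_add mult.commute[of "CARD('a)"])

interpretation frob: field_hom "\<lambda>x :: 'a::{finite,field} alg_closure. frob x"
  by standard (auto simp: frob_add power_mult_distrib)

text \<open>The subfield with \<open>q^i\<close> elements, cut out as the fixed points of a
  Frobenius power. For \<open>i = 0\<close> it is the whole closure, hence the positivity
  assumptions on \<open>i\<close> in the counting lemmas.\<close>

definition ext_field :: "nat \<Rightarrow> 'a::{finite,field} alg_closure set" where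
  "ext_field i = {x. x ^ (CARD('a) ^ i) = x}"

lemma ext_field_0 [simp]: "0 \<in> ext_field i" and ext_field_1 [simp]: "1 \<in> ext_field i"
  by (simp_all add: ext_field_def)

lemma ext_field_add: "x \<in> ext_field i \<Longrightarrow> y \<in> ext_field i \<Longrightarrow> x + y \<in> ext_field i"
  by (simp add: ext_field_def frob_pow_add)

lemma ext_field_mult: "x \<in> ext_field i \<Longrightarrow> y \<in> ext_field i \<Longrightarrow> x * y \<in> ext_field i"
  by (simp add: ext_field_def power_mult_distrib)

lemma ext_field_power: "x \<in> ext_field i \<Longrightarrow> x ^ n \<in> ext_field i"
  by (induction n) (auto intro: ext_field_mult)

lemma ext_field_inverse: "x \<in> ext_field i \<Longrightarrow> inverse x \<in> ext_field i"
  by (simp add: ext_field_def power_inverse)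

lemma of_nat_CARD_alg_closure: "of_nat CARD('a) = (0 :: 'a::{finite,field} alg_closure)"
proof -
  have "of_nat CARD('a) = (0 :: 'a)" using CHAR_dvd_CARD[where 'a = 'a] by (simp add: of_nat_eq_0_iff_char_dvd)
  then show ?thesis by (metis to_ac_of_nat to_ac_0)
qed

lemma proots_alg_closed:
  fixes p :: "'a::alg_closed_field poly"
  assumes "p \<noteq> 0"
  shows "size (proots p) = degree p" "p = smult (lead_coeff p) (\<Prod>x\<in>#proots p. [:-x, 1:])"
proof -
  obtain A where A: "size A = degree p" "p = smult (lead_coeff p) (\<Prod>x\<in>#A. [:-x, 1:])"
    using alg_closed_imp_factorization[OF assms] by blast
  have nz: "(\<Prod>x\<in>#B. [:-x, 1:]) \<noteq> 0" for B :: "'a multiset"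
    by (induction B) (auto simp del: mult_pCons_left)
  have "proots (\<Prod>x\<in>#A. [:-x, 1:]) = A"
  proof (induction A)
    case (add x A)
    have "proots ([:-x, 1:] * (\<Prod>x\<in>#A. [:-x, 1:])) = {#x#} + proots (\<Prod>x\<in>#A. [:-x, 1:])"
      using nz[of A] by (subst proots_mult) auto
    then show ?case using add by (simp del: mult_pCons_left)
  qed simp
  then have "proots p = A" using A(2) assms by (metis proots_smult leading_coeff_0_iff)
  with A show "size (proots p) = degree p" "p = smult (lead_coeff p) (\<Prod>x\<in>#proots p. [:-x, 1:])" by auto
qed

text \<open>The defining polynomial \<open>X^(q^i) - X\<close> has derivative -1, so its roots are
  simple and their number equals its degree.\<close>

lemma ext_field_card:
  assumes "i > 0"
  shows "finite (ext_field i :: 'a::{finite,field} alg_closure set)"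
    and "card (ext_field i :: 'a alg_closure set) = CARD('a) ^ i"
proof -
  let ?Q = "CARD('a) ^ i"
  have "CARD('a) > 1" using CARD_ge_2[where 'a = 'a] by simp
  then have Q: "?Q > 1" using assms by (rule one_less_power)
  let ?p = "monom 1 ?Q - [:0, 1:] :: 'a alg_closure poly"
  have "coeff [:0, 1 :: 'a alg_closure:] ?Q = 0" by (rule coeff_eq_0) (use Q in simp)
  then have cq: "coeff ?p ?Q = 1" by simp
  then have p0: "?p \<noteq> 0" by (metis coeff_0 zero_neq_one)
  have deg: "degree ?p = ?Q"
  proof (rule order_antisym)
    show "degree ?p \<le> ?Q" using Q by (intro degree_diff_le degree_monom_le) auto
    show "?Q \<le> degree ?p" using cq by (intro le_degree) simp
  qed
  have F: "ext_field i = {x. poly ?p x = 0}" by (simp add: ext_field_def poly_monom)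
  show "finite (ext_field i :: 'a alg_closure set)" unfolding F by (rule poly_roots_finite[OF p0])
  have pd: "pderiv ?p = -1"
    using assms
    by (simp add: pderiv_diff pderiv_monom pderiv_pCons one_pCons of_nat_CARD_alg_closure zero_power)
  have "order a ?p \<le> 1" for a
  proof (rule ccontr)
    assume "\<not> ?thesis"
    then have "[:-a, 1:] ^ 2 dvd ?p" by (subst order_divides) simp
    then obtain r where r: "?p = [:-a, 1:] ^ 2 * r" by blast
    have "poly (pderiv ([:-a, 1:] ^ 2 * r)) a = 0"
      by (simp add: power2_eq_square pderiv_mult pderiv_pCons del: mult_pCons_left)
    then have "poly (pderiv ?p) a = 0" by (simp only: r)
    then show False by (simp add: pd)
  qed
  then have "count (proots ?p) x \<le> 1" for x using p0 by simp
  then have "proots ?p = mset_set (set_mset (proots ?p))"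
    by (metis (no_types, lifting) count_greater_eq_one_iff count_mset_set(1) count_mset_set(3) finite_set_mset
        le_antisym multiset_eqI not_in_iff)
  then have "size (proots ?p) = card (set_mset (proots ?p))" by (metis size_mset_set)
  then show "card (ext_field i :: 'a alg_closure set) = ?Q"
    using proots_alg_closed(1)[OF p0] deg p0 unfolding F by simp
qed

section \<open>Characteristic polynomials of elements of the extension fields\<close>

text \<open>For \<open>x\<close> in \<open>ext_field i\<close> with \<open>i > 0\<close> this is the
  characteristic polynomial of multiplication by \<open>x\<close>, a power of the minimal
  polynomial: conjugates are repeated when \<open>x\<close> lies in a smaller field.\<close>

definition conj_poly :: "nat \<Rightarrow> 'a::{finite,field} alg_closure \<Rightarrow> 'a alg_closure poly" where
  "conj_poly i x = (\<Prod>t<i. [:- (x ^ (CARD('a) ^ t)), 1:])"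

definition norm_poly :: "nat \<Rightarrow> 'a::{finite,field} alg_closure \<Rightarrow> 'a poly" where
  "norm_poly i x = map_poly of_ac (conj_poly i x)"

lemma degree_conj_poly: "degree (conj_poly i x) = i"
  unfolding conj_poly_def by (subst degree_prod_eq_sum_degree) auto

lemma lead_coeff_conj_poly: "lead_coeff (conj_poly i x) = 1"
  unfolding conj_poly_def by (simp add: lead_coeff_prod)

lemma conj_poly_nonzero: "conj_poly i x \<noteq> 0"
  using lead_coeff_conj_poly[of i x] by auto

text \<open>Frobenius shifts the linear factors cyclically, because the factor of index
  \<open>i\<close> is again the one of index 0.\<close>

lemma frob_conj_poly:
  fixes x :: "'a::{finite,field} alg_closure"
  assumes "x \<in> ext_field i"
  shows "map_poly (\<lambda>x. frob x) (conj_poly i x) = conj_poly i x"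
proof -
  interpret fp: map_poly_comm_ring_hom "\<lambda>x :: 'a alg_closure. frob x" ..
  let ?g = "\<lambda>t. [:- (x ^ (CARD('a) ^ t)), 1:]"
  have "map_poly (\<lambda>x. frob x) (conj_poly i x) = (\<Prod>t<i. ?g (Suc t))"
    unfolding conj_poly_def fp.hom_prod
    by (intro prod.cong refl) (simp add: frob.hom_uminus power_mult[symmetric] mult.commute)
  also have "?g 0 * \<dots> = (\<Prod>t<Suc i. ?g t)" by (simp only: prod.lessThan_Suc_shift)
  also have "\<dots> = (\<Prod>t<i. ?g t) * ?g i" by simp
  also have "?g i = ?g 0" using assms by (simp add: ext_field_def)
  finally have "?g 0 * map_poly (\<lambda>x. frob x) (conj_poly i x) = ?g 0 * conj_poly i x"
    by (simp only: conj_poly_def mult.commute)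
  then show ?thesis by (simp del: mult_pCons_left)
qed

text \<open>Coefficients fixed by Frobenius lie in the base field, so the coefficientwise descent
  loses nothing.\<close>

lemma to_ac_norm_poly:
  fixes x :: "'a::{finite,field} alg_closure"
  assumes "x \<in> ext_field i"
  shows "map_poly to_ac (norm_poly i x) = conj_poly i x"
proof (rule poly_eqI)
  fix n
  have "frob (coeff (conj_poly i x) n) = coeff (conj_poly i x) n"
    using arg_cong[OF frob_conj_poly[OF assms], of "\<lambda>p. coeff p n"] by (simp add: coeff_map_poly)
  then have "coeff (conj_poly i x) n \<in> range to_ac" by (simp only: frob_eq_iff)
  then show "coeff (map_poly to_ac (norm_poly i x)) n = coeff (conj_poly i x) n"
    by (simp add: norm_poly_def coeff_map_poly to_ac_of_ac)
qed

lemma norm_poly_in_monic_unit_polys: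
  fixes x :: "'a::{finite,field} alg_closure"
  assumes "x \<in> ext_field i" "x \<noteq> 0"
  shows "norm_poly i x \<in> monic_unit_polys i"
proof -
  have "degree (norm_poly i x) = i"
    using arg_cong[OF to_ac_norm_poly[OF assms(1)], of degree] degree_conj_poly[of i x] by (simp add: degree_map_poly)
  moreover have "to_ac (coeff (norm_poly i x) n) = coeff (conj_poly i x) n" for n
    using arg_cong[OF to_ac_norm_poly[OF assms(1)], of "\<lambda>p. coeff p n"] by (simp add: coeff_map_poly)
  moreover have "coeff (conj_poly i x) 0 \<noteq> 0"
  proof -
    have "poly (conj_poly i x) 0 \<noteq> 0" using assms(2) unfolding conj_poly_def by (simp add: poly_prod)
    then show ?thesis by (simp add: poly_0_coeff_0)
  qed
  moreover have "coeff (conj_poly i x) i = 1" using lead_coeff_conj_poly[of i x] by (simp add: degree_conj_poly)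
  ultimately show ?thesis
    unfolding monic_unit_polys_def by (simp, metis to_ac_0 to_ac_1 to_ac_eq_iff)
qed

lemma proots_conj_poly:
  fixes x :: "'a::{finite,field} alg_closure"
  shows "proots (conj_poly i x) = {#x ^ (CARD('a) ^ t). t \<in># mset_set {..<i}#}"
  unfolding conj_poly_def by (subst proots_prod) (auto simp: sum_unfold_sum_mset)

text \<open>The roots are the conjugates of \<open>x\<close>, so their power sum is the trace of
  \<open>x ^ k\<close> to the base field. This is the origin of the trace sums in
  \<open>char_sum\<close>.\<close>

lemma root_power_sum_norm_poly:
  fixes x :: "'a::{finite,field} alg_closure"
  assumes "x \<in> ext_field i"
  shows "root_power_sum k (norm_poly i x) = (\<Sum>t<i. (x ^ k) ^ (CARD('a) ^ t))"
  unfolding root_power_sum_def to_ac_norm_poly[OF assms] proots_conj_poly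
  by (simp add: sum_unfold_sum_mset power_mult[symmetric] mult.commute image_mset.compositionality o_def)

lemma root_power_sum_mult:
  fixes p r :: "'a::field poly"
  assumes "p \<noteq> 0" "r \<noteq> 0"
  shows "root_power_sum k (p * r) = root_power_sum k p + root_power_sum k r"
proof -
  interpret m: map_poly_comm_ring_hom "to_ac :: 'a \<Rightarrow> _" ..
  show ?thesis using assms unfolding root_power_sum_def m.hom_mult
    by (subst proots_mult) (auto simp: map_poly_eq_0_iff)
qed

text \<open>Every such polynomial is the characteristic polynomial of a companion matrix, so its
  power sum is the trace of a matrix over the base field.\<close>

lemma root_power_sum_range:
  fixes p :: "'a::field poly"
  assumes "p \<in> monic_unit_polys j"
  shows "root_power_sum k p \<in> range to_ac"
proof -
  obtain C where C: "C \<in> companions j" "p = char_poly C"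
    using assms bij_betw_companions_char_poly[of j, where 'a = 'a] unfolding bij_betw_def by blast
  have "C \<in> carrier_mat j j" using C companions_subset_GL GL_carrier by blast
  then show ?thesis using to_ac_mat_trace_pow[of C j k] C(2) by (metis rangeI)
qed

text \<open>Frobenius on the coefficients fixes \<open>f\<close> and turns the factor
  \<open>X - x\<close> into \<open>X - x^q\<close>.\<close>

lemma order_frob_ge:
  fixes f :: "'a::{finite,field} alg_closure poly"
  assumes "map_poly (\<lambda>x. frob x) f = f" "f \<noteq> 0"
  shows "order x f \<le> order (frob x) f"
proof -
  interpret fp: map_poly_comm_ring_hom "\<lambda>x :: 'a alg_closure. frob x" ..
  have "[:-x, 1:] ^ order x f dvd f" by (rule order_1)
  then have "map_poly (\<lambda>x. frob x) ([:-x, 1:] ^ order x f) dvd map_poly (\<lambda>x. frob x) f"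
    by (rule fp.hom_dvd)
  then have "[:- frob x, 1:] ^ order x f dvd f"
    using assms(1) by (simp add: fp.hom_power frob.hom_uminus)
  then show ?thesis using assms(2) by (simp add: order_divides)
qed

lemma order_frob_pow_ge:
  fixes f :: "'a::{finite,field} alg_closure poly"
  assumes "map_poly (\<lambda>x. frob x) f = f" "f \<noteq> 0"
  shows "order x f \<le> order (x ^ (CARD('a) ^ t)) f"
proof (induction t)
  case (Suc t)
  then show ?case using order_frob_ge[OF assms, of "x ^ (CARD('a) ^ t)"]
    by (simp add: power_mult[symmetric] mult.commute)
qed simp

lemma ext_field_mult_index:
  fixes x :: "'a::{finite,field} alg_closure"
  assumes "x \<in> ext_field d"
  shows "x ^ (CARD('a) ^ (r * d)) = x"
proof (induction r)
  case (Suc r)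
  have "x ^ (CARD('a) ^ (Suc r * d)) = (x ^ (CARD('a) ^ d)) ^ (CARD('a) ^ (r * d))"
    by (simp add: power_add power_mult)
  then show ?case using Suc assms by (simp add: ext_field_def)
qed simp

text \<open>Multiplicities can only grow along a Frobenius orbit, and the orbit returns to
  \<open>x\<close>, so they are constant on it.\<close>

lemma order_frob_pow:
  fixes f :: "'a::{finite,field} alg_closure poly"
  assumes "map_poly (\<lambda>x. frob x) f = f" "f \<noteq> 0" "x \<in> ext_field d" "d > 0"
  shows "order (x ^ (CARD('a) ^ t)) f = order x f"
proof (rule order_antisym)
  have "t \<le> t * d" using assms(4) by simp
  then have "(x ^ (CARD('a) ^ t)) ^ (CARD('a) ^ (t * d - t)) = x ^ (CARD('a) ^ (t * d))"
    by (simp add: power_mult[symmetric] power_add[symmetric])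
  then show "order (x ^ (CARD('a) ^ t)) f \<le> order x f"
    using order_frob_pow_ge[OF assms(1,2), of "x ^ (CARD('a) ^ t)" "t * d - t"] ext_field_mult_index[OF assms(3)]
    by simp
qed (rule order_frob_pow_ge[OF assms(1,2)])

lemma frob_pow_inj:
  fixes x y :: "'a::{finite,field} alg_closure"
  assumes "x ^ (CARD('a) ^ i) = y ^ (CARD('a) ^ i)"
  shows "x = y"
proof -
  have "(x - y + y) ^ (CARD('a) ^ i) = (x - y) ^ (CARD('a) ^ i) + y ^ (CARD('a) ^ i)" by (rule frob_pow_add)
  then have "(x - y) ^ (CARD('a) ^ i) = 0" using assms by simp
  then show ?thesis by simp
qed

text \<open>The Frobenius orbit of \<open>x\<close> consists of roots of \<open>f\<close>, hence is
  finite and repeats; injectivity of Frobenius moves the repetition back to \<open>x\<close>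
  itself.\<close>

lemma root_in_ext_field:
  fixes f :: "'a::{finite,field} alg_closure poly"
  assumes "map_poly (\<lambda>x. frob x) f = f" "f \<noteq> 0" "poly f x = 0"
  shows "\<exists>d>0. x \<in> ext_field d"
proof -
  have "poly f (x ^ (CARD('a) ^ t)) = 0" for t
    using order_frob_pow_ge[OF assms(1,2), of x t] assms(2,3) by (simp add: order_root)
  then have "range (\<lambda>t. x ^ (CARD('a) ^ t)) \<subseteq> {x. poly f x = 0}" by auto
  then have "finite (range (\<lambda>t. x ^ (CARD('a) ^ t)))"
    using poly_roots_finite[OF assms(2)] finite_subset by blast
  then have "\<not> inj (\<lambda>t. x ^ (CARD('a) ^ t))" using finite_imageD infinite_UNIV_nat by blast
  then obtain a b where ab: "x ^ (CARD('a) ^ a) = x ^ (CARD('a) ^ b)" "a < b"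
    unfolding inj_def by (metis linorder_neqE_nat)
  have "(x ^ (CARD('a) ^ (b - a))) ^ (CARD('a) ^ a) = x ^ (CARD('a) ^ a)"
    using ab by (simp add: power_mult[symmetric] power_add[symmetric])
  then have "x ^ (CARD('a) ^ (b - a)) = x" by (rule frob_pow_inj)
  then show ?thesis using ab(2) by (intro exI[of _ "b - a"]) (simp add: ext_field_def)
qed

lemma conj_poly_mult_index:
  fixes x :: "'a::{finite,field} alg_closure"
  assumes "x \<in> ext_field d"
  shows "conj_poly (r * d) x = conj_poly d x ^ r"
proof (induction r)
  case (Suc r)
  let ?g = "\<lambda>t. [:- (x ^ (CARD('a) ^ t)), 1:]"
  have "conj_poly (Suc r * d) x = (\<Prod>t=0..<r * d. ?g t) * (\<Prod>t=r * d..<r * d + d. ?g t)"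
    unfolding conj_poly_def by (subst prod.atLeastLessThan_concat) (auto simp: atLeast0LessThan add.commute)
  also have "(\<Prod>t=r * d..<r * d + d. ?g t) = (\<Prod>t=0..<d. ?g (t + r * d))"
    using prod.shift_bounds_nat_ivl[of ?g 0 "r * d" d] by (simp add: add.commute)
  also have "\<dots> = (\<Prod>t=0..<d. ?g t)"
  proof (intro prod.cong refl)
    fix t
    have "x ^ (CARD('a) ^ (t + r * d)) = (x ^ (CARD('a) ^ (r * d))) ^ (CARD('a) ^ t)"
      by (simp add: power_mult[symmetric] power_add mult.commute)
    then show "?g (t + r * d) = ?g t" using ext_field_mult_index[OF assms] by simp
  qed
  finally show ?case using Suc by (simp add: conj_poly_def atLeast0LessThan mult.commute)
qed (simp add: conj_poly_def)

lemma dvd_if_proots_subset: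
  fixes p f :: "'a::alg_closed_field poly"
  assumes "p \<noteq> 0" "f \<noteq> 0" "proots p \<subseteq># proots f"
  shows "p dvd f"
proof -
  have "(\<Prod>x\<in>#proots p. [:-x, 1:]) dvd (\<Prod>x\<in>#proots f. [:-x, 1:])"
    using assms(3) by (intro prod_mset_subset_imp_dvd image_mset_subseteq_mono)
  then have "smult (lead_coeff p) (\<Prod>x\<in>#proots p. [:-x, 1:]) dvd smult (lead_coeff f) (\<Prod>x\<in>#proots f. [:-x, 1:])"
    using assms by (simp add: smult_dvd_iff dvd_smult)
  then show ?thesis using proots_alg_closed(2)[OF assms(1)] proots_alg_closed(2)[OF assms(2)] by simp
qed

text \<open>Let \<open>d\<close> be the degree of \<open>x\<close>. The positive \<open>i\<close>
  with \<open>x \<in> ext_field i\<close> are the multiples \<open>r * d\<close>, for which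
  \<open>conj_poly i x\<close> is the \<open>r\<close>-th power of the minimal polynomial. It
  divides \<open>f\<close> exactly when \<open>r \<le> order x f\<close>, as all conjugates have the
  same multiplicity.\<close>

lemma card_norm_poly_dvd:
  fixes f :: "'a::{finite,field} alg_closure poly"
  assumes f: "map_poly (\<lambda>x. frob x) f = f" "f \<noteq> 0" and x: "poly f x = 0"
  shows "card {i. 0 < i \<and> x \<in> ext_field i \<and> conj_poly i x dvd f} = order x f"
proof -
  let ?P = "\<lambda>d. 0 < d \<and> x \<in> ext_field d"
  define d where "d = Least ?P"
  have d: "?P d" unfolding d_def using root_in_ext_field[OF f x] by (rule LeastI_ex)
  have min: "d \<le> i" if "?P i" for i unfolding d_def using that by (rule Least_le)
  have dvd: "\<exists>r. i = r * d" if "x \<in> ext_field i" for i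
  proof -
    have "x ^ (CARD('a) ^ i) = (x ^ (CARD('a) ^ (i div d * d))) ^ (CARD('a) ^ (i mod d))"
      by (simp add: power_mult[symmetric] power_add[symmetric])
    then have "x ^ (CARD('a) ^ (i mod d)) = x"
      using that d ext_field_mult_index[of x d "i div d"] by (simp add: ext_field_def)
    then have "0 < i mod d \<Longrightarrow> d \<le> i mod d" using min[of "i mod d"] by (simp add: ext_field_def)
    moreover have "i mod d < d" using d by (intro mod_less_divisor) simp
    ultimately have "i mod d = 0" by linarith
    then have "i = i div d * d" using div_mult_mod_eq[of i d] by simp
    then show ?thesis by blast
  qed
  have inj: "inj_on (\<lambda>t. x ^ (CARD('a) ^ t)) {..<d}"
  proof (rule inj_onI)
    fix a b assume ab: "a \<in> {..<d}" "b \<in> {..<d}" "x ^ (CARD('a) ^ a) = x ^ (CARD('a) ^ b)"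
    have *: False if "a < b" "b < d" "x ^ (CARD('a) ^ a) = x ^ (CARD('a) ^ b)" for a b
    proof -
      have "(x ^ (CARD('a) ^ (b - a))) ^ (CARD('a) ^ a) = x ^ (CARD('a) ^ a)"
        using that by (simp add: power_mult[symmetric] power_add[symmetric])
      then have "x ^ (CARD('a) ^ (b - a)) = x" by (rule frob_pow_inj)
      then show False using min[of "b - a"] that by (simp add: ext_field_def)
    qed
    show "a = b" using *[of a b] *[of b a] ab by (metis lessThan_iff linorder_neqE_nat)
  qed
  let ?O = "(\<lambda>t. x ^ (CARD('a) ^ t)) ` {..<d}"
  have pr: "proots (conj_poly d x) = mset_set ?O"
    unfolding proots_conj_poly by (rule image_mset_mset_set[OF inj])
  have iff: "conj_poly (r * d) x dvd f \<longleftrightarrow> r \<le> order x f" for r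
  proof
    assume "conj_poly (r * d) x dvd f"
    then have "conj_poly d x ^ r dvd f" using conj_poly_mult_index d by metis
    moreover have "[:- x, 1:] dvd conj_poly d x"
    proof -
      have "x \<in># proots (conj_poly d x)" unfolding pr using d by (auto intro!: image_eqI[of _ _ 0])
      then have "poly (conj_poly d x) x = 0" by (simp add: conj_poly_nonzero)
      then show ?thesis by (simp add: poly_eq_0_iff_dvd)
    qed
    ultimately have "[:- x, 1:] ^ r dvd f" using dvd_power_same dvd_trans by blast
    then show "r \<le> order x f" using f(2) by (simp add: order_divides)
  next
    assume r: "r \<le> order x f"
    have "proots (conj_poly d x ^ r) \<subseteq># proots f"
    proof (rule mset_subset_eqI)
      fix y
      show "count (proots (conj_poly d x ^ r)) y \<le> count (proots f) y"
      proof (cases "y \<in> ?O")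
        case True
        then have "order y f = order x f" using order_frob_pow[OF f, of x d] d by auto
        then show ?thesis using r f(2) True by (simp add: proots_power pr)
      next
        case False
        then show ?thesis by (simp add: proots_power pr)
      qed
    qed
    then have "conj_poly d x ^ r dvd f" by (intro dvd_if_proots_subset) (auto simp: conj_poly_nonzero f(2))
    then show "conj_poly (r * d) x dvd f" using conj_poly_mult_index d by metis
  qed
  have "{i. 0 < i \<and> x \<in> ext_field i \<and> conj_poly i x dvd f} = (\<lambda>r. r * d) ` {1..order x f}"
  proof (intro equalityI subsetI)
    fix i assume "i \<in> {i. 0 < i \<and> x \<in> ext_field i \<and> conj_poly i x dvd f}"
    then have i: "0 < i" "x \<in> ext_field i" "conj_poly i x dvd f" by auto
    obtain r where r: "i = r * d" using dvd[OF i(2)] by blast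
    then have "r \<le> order x f" "1 \<le> r" using iff i by auto
    then show "i \<in> (\<lambda>r. r * d) ` {1..order x f}" using r by auto
  next
    fix i assume "i \<in> (\<lambda>r. r * d) ` {1..order x f}"
    then obtain r where "i = r * d" "r \<in> {1..order x f}" by blast
    then have r: "i = r * d" "1 \<le> r" "r \<le> order x f" by auto
    then show "i \<in> {i. 0 < i \<and> x \<in> ext_field i \<and> conj_poly i x dvd f}"
      using iff d ext_field_mult_index[of x d r] by (simp add: ext_field_def)
  qed
  moreover have "inj_on (\<lambda>r. r * d) {1..order x f}" using d by (auto simp: inj_on_def)
  ultimately show ?thesis by (simp add: card_image)
qed

lemma norm_poly_dvd_iff:
  fixes x :: "'a::{finite,field} alg_closure"
  assumes "x \<in> ext_field i"
  shows "norm_poly i x dvd p \<longleftrightarrow> conj_poly i x dvd map_poly to_ac p"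
proof
  interpret m: map_poly_comm_ring_hom "to_ac :: 'a \<Rightarrow> _" ..
  assume "norm_poly i x dvd p"
  then show "conj_poly i x dvd map_poly to_ac p"
    using m.hom_dvd[of "norm_poly i x" p] to_ac_norm_poly[OF assms] by simp
next
  assume "conj_poly i x dvd map_poly to_ac p"
  then show "norm_poly i x dvd p"
    using to_ac.dvd_map_poly_hom_imp_dvd[of "norm_poly i x" p] to_ac_norm_poly[OF assms] by simp
qed

lemma frob_map_to_ac: "map_poly (\<lambda>x. frob x) (map_poly to_ac p) = map_poly to_ac (p :: 'a::{finite,field} poly)"
  by (rule poly_eqI) (simp add: coeff_map_poly power_card_field flip: to_ac_power)

text \<open>The polynomial analogue of log n = \<Sum> \<Lambda>(d) over the divisors d of n. A root
  of multiplicity \<open>m\<close> is accounted for by exactly \<open>m\<close> indices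
  \<open>i\<close>, so the total is the number of roots.\<close>

lemma degree_eq_sum_norm_poly:
  fixes p :: "'a::{finite,field} poly"
  assumes p: "p \<in> monic_unit_polys j"
  shows "j = (\<Sum>i=1..j. card {x \<in> ext_field i - {0}. norm_poly i x dvd p})"
proof -
  let ?f = "map_poly to_ac p"
  have p': "degree p = j" "p \<noteq> 0" "coeff p 0 \<noteq> 0" using p by (auto simp: monic_unit_polys_def)
  have f: "map_poly (\<lambda>x. frob x) ?f = ?f" "?f \<noteq> 0" using p' by (auto simp: frob_map_to_ac map_poly_eq_0_iff)
  have degf: "degree ?f = j" using p' by (simp add: degree_map_poly)
  let ?R = "{x. poly ?f x = 0}"
  have finR: "finite ?R" by (rule poly_roots_finite[OF f(2)])
  let ?I = "\<lambda>x. {i. 0 < i \<and> x \<in> ext_field i \<and> conj_poly i x dvd ?f}"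
  have le: "i \<le> j" if "conj_poly i x dvd ?f" for i x
    using dvd_imp_degree_le[OF that f(2)] p'(1) by (simp add: degree_conj_poly)
  have root: "poly ?f x = 0" if "conj_poly i x dvd ?f" "0 < i" for i x
  proof -
    have "x \<in># proots (conj_poly i x)" unfolding proots_conj_poly using that(2) by (auto intro!: image_eqI[of _ _ 0])
    then have "poly (conj_poly i x) x = 0" by (simp add: conj_poly_nonzero)
    then show ?thesis using that(1) by (auto elim!: dvdE)
  qed
  have "poly ?f 0 \<noteq> 0" using p'(3) by (simp add: poly_0_coeff_0 coeff_map_poly)
  then have nz: "x \<noteq> 0" if "poly ?f x = 0" for x using that by auto
  have finI: "finite (?I x)" for x by (rule finite_subset[of _ "{..j}"]) (use le in auto)
  have "j = size (proots ?f)" using proots_alg_closed(1)[OF f(2)] degf by simp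
  also have "\<dots> = (\<Sum>x\<in>?R. order x ?f)" using f(2) by (simp add: size_multiset_overloaded_eq)
  also have "\<dots> = (\<Sum>x\<in>?R. card (?I x))" by (intro sum.cong refl card_norm_poly_dvd[OF f, symmetric]) simp
  also have "\<dots> = card (Sigma ?R ?I)" using finR finI by simp
  also have "\<dots> = card (Sigma {1..j} (\<lambda>i. {x \<in> ext_field i - {0}. norm_poly i x dvd p}))"
  proof (rule bij_betw_same_card[of "\<lambda>(x, i). (i, x)"],
      rule bij_betw_byWitness[where f' = "\<lambda>(i, x). (x, i)"])
    show "(\<lambda>(x, i). (i, x)) ` Sigma ?R ?I \<subseteq> Sigma {1..j} (\<lambda>i. {x \<in> ext_field i - {0}. norm_poly i x dvd p})"
      using le nz by (auto simp: norm_poly_dvd_iff Suc_le_eq)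
    show "(\<lambda>(i, x). (x, i)) ` Sigma {1..j} (\<lambda>i. {x \<in> ext_field i - {0}. norm_poly i x dvd p}) \<subseteq> Sigma ?R ?I"
      using root by (auto simp: norm_poly_dvd_iff)
  qed auto
  also have "\<dots> = (\<Sum>i=1..j. card {x \<in> ext_field i - {0}. norm_poly i x dvd p})"
  proof (rule card_SigmaI)
    show "\<forall>i\<in>{1..j}. finite {x \<in> ext_field i - {0}. norm_poly i x dvd p}"
      using ext_field_card(1)[where 'a = 'a] by auto
  qed simp
  finally show ?thesis .
qed


section \<open>The multiplicative function and its L-function\<close>

definition root_char :: "('a::field \<Rightarrow> complex) \<Rightarrow> nat \<Rightarrow> 'a poly \<Rightarrow> complex" where
  "root_char \<psi> k p = \<psi> (of_ac (root_power_sum k p))"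

definition char_sum :: "('a::{finite,field} \<Rightarrow> complex) \<Rightarrow> nat \<Rightarrow> nat \<Rightarrow> complex" where
  "char_sum \<psi> k i = (\<Sum>x\<in>ext_field i - {0}. \<psi> (of_ac (\<Sum>t<i. (x ^ k) ^ (CARD('a) ^ t))))"

lemma finite_monic_unit_polys: "finite (monic_unit_polys j :: 'a::{finite,field} poly set)"
proof -
  have "bij_betw char_poly (companions j) (monic_unit_polys j :: 'a poly set)"
    by (rule bij_betw_companions_char_poly)
  from bij_betw_finite[OF this] show ?thesis by (simp add: finite_companions)
qed

lemma root_char_mult:
  fixes p r :: "'a::field poly"
  assumes \<psi>: "\<And>x y. \<psi> (x + y) = \<psi> x * \<psi> y" and p: "p \<in> monic_unit_polys i" "r \<in> monic_unit_polys j"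
  shows "root_char \<psi> k (p * r) = root_char \<psi> k p * root_char \<psi> k r"
proof -
  have "p \<noteq> 0" "r \<noteq> 0" using p by (auto simp: monic_unit_polys_def)
  moreover obtain a b where "root_power_sum k p = to_ac a" "root_power_sum k r = to_ac b"
    using root_power_sum_range[OF p(1)] root_power_sum_range[OF p(2)] by blast
  ultimately show ?thesis
    by (simp add: root_char_def root_power_sum_mult \<psi> flip: to_ac_add)
qed

lemma monic_unit_polys_mult_iff:
  fixes p r :: "'a::field poly"
  assumes "p \<in> monic_unit_polys i" "i \<le> j"
  shows "p * r \<in> monic_unit_polys j \<longleftrightarrow> r \<in> monic_unit_polys (j - i)"
proof -
  have p: "degree p = i" "coeff p i = 1" "p \<noteq> 0" "coeff p 0 \<noteq> 0" using assms by (auto simp: monic_unit_polys_def)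
  show ?thesis
  proof (cases "r = 0")
    case False
    then have "degree (p * r) = i + degree r" using p by (simp add: degree_mult_eq)
    moreover have "lead_coeff (p * r) = lead_coeff r" using p by (simp add: lead_coeff_mult)
    ultimately show ?thesis using p assms(2) by (auto simp: monic_unit_polys_def coeff_mult_0)
  qed (simp add: monic_unit_polys_def)
qed

text \<open>The logarithmic derivative of the L-function of the character \<open>root_char \<psi> k\<close>, read off coefficientwise.\<close>

lemma root_char_sum_recursion:
  fixes \<psi> :: "'a::{finite,field} \<Rightarrow> complex"
  assumes \<psi>: "\<And>x y. \<psi> (x + y) = \<psi> x * \<psi> y"
  shows "of_nat j * (\<Sum>p\<in>monic_unit_polys j. root_char \<psi> k p) =
    (\<Sum>i=1..j. char_sum \<psi> k i * (\<Sum>p\<in>monic_unit_polys (j - i). root_char \<psi> k p))"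
proof -
  let ?W = "\<lambda>j. monic_unit_polys j :: 'a poly set" and ?\<chi> = "root_char \<psi> k"
  have fin: "finite (ext_field i - {0} :: 'a alg_closure set)" if "i \<in> {1..j}" for i
    using ext_field_card(1)[of i, where 'a = 'a] that by auto
  \<comment> \<open>The factor \<open>j\<close> becomes a count of divisors
    \<open>norm_poly i x\<close> of \<open>p\<close>; interchanging the sums then fixes the divisor
    and leaves the cofactor free.\<close>
  have "of_nat j * (\<Sum>p\<in>?W j. ?\<chi> p) =
      (\<Sum>p\<in>?W j. of_nat (\<Sum>i=1..j. card {x \<in> ext_field i - {0}. norm_poly i x dvd p}) * ?\<chi> p)"
    unfolding sum_distrib_left
    by (rule sum.cong[OF refl], rule arg_cong[where f = "\<lambda>n. of_nat n * _"], rule degree_eq_sum_norm_poly)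
  also have "\<dots> = (\<Sum>p\<in>?W j. \<Sum>i=1..j. \<Sum>x\<in>{x \<in> ext_field i - {0}. norm_poly i x dvd p}. ?\<chi> p)"
    by (simp add: sum_distrib_right)
  also have "\<dots> = (\<Sum>p\<in>?W j. \<Sum>i=1..j. \<Sum>x\<in>ext_field i - {0}. if norm_poly i x dvd p then ?\<chi> p else 0)"
    by (rule sum.cong[OF refl], rule sum.cong[OF refl], rule sum.inter_filter, rule fin)
  also have "\<dots> = (\<Sum>i=1..j. \<Sum>x\<in>ext_field i - {0}. \<Sum>p\<in>?W j. if norm_poly i x dvd p then ?\<chi> p else 0)"
    by (subst sum.swap, rule sum.cong[OF refl], rule sum.swap)
  also have "\<dots> = (\<Sum>i=1..j. \<Sum>x\<in>ext_field i - {0}. ?\<chi> (norm_poly i x) * (\<Sum>r\<in>?W (j - i). ?\<chi> r))"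
  proof (intro sum.cong refl)
    fix i x assume i: "i \<in> {1..j}" and x: "x \<in> ext_field i - {0 :: 'a alg_closure}"
    have N: "norm_poly i x \<in> ?W i" using x norm_poly_in_monic_unit_polys by blast
    have N0: "norm_poly i x \<noteq> 0" using N by (auto simp: monic_unit_polys_def)
    have ij: "i \<le> j" using i by simp
    have "(\<Sum>p\<in>?W j. if norm_poly i x dvd p then ?\<chi> p else 0) = (\<Sum>p\<in>{p \<in> ?W j. norm_poly i x dvd p}. ?\<chi> p)"
      by (rule sum.inter_filter[symmetric], rule finite_monic_unit_polys)
    also have "{p \<in> ?W j. norm_poly i x dvd p} = (\<lambda>r. norm_poly i x * r) ` ?W (j - i)"
      using monic_unit_polys_mult_iff[OF N ij] by (auto elim!: dvdE)
    also have "(\<Sum>p\<in>(\<lambda>r. norm_poly i x * r) ` ?W (j - i). ?\<chi> p) = (\<Sum>r\<in>?W (j - i). ?\<chi> (norm_poly i x * r))"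
      using N0 by (subst sum.reindex) (auto simp: inj_on_def)
    also have "\<dots> = ?\<chi> (norm_poly i x) * (\<Sum>r\<in>?W (j - i). ?\<chi> r)"
      unfolding sum_distrib_left by (intro sum.cong refl root_char_mult[OF \<psi> N])
    finally show "(\<Sum>p\<in>?W j. if norm_poly i x dvd p then ?\<chi> p else 0) = ?\<chi> (norm_poly i x) * (\<Sum>r\<in>?W (j - i). ?\<chi> r)" .
  qed
  also have "\<dots> = (\<Sum>i=1..j. char_sum \<psi> k i * (\<Sum>r\<in>?W (j - i). ?\<chi> r))"
    unfolding char_sum_def sum_distrib_right
    by (intro sum.cong refl) (simp add: root_char_def root_power_sum_norm_poly)
  finally show ?thesis .
qed

subsection \<open>Character sums over extension fields\<close>

definition additive_char :: "('a::ab_group_add \<Rightarrow> complex) \<Rightarrow> bool" where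
  "additive_char \<psi> \<longleftrightarrow> (\<forall>x y. \<psi> (x + y) = \<psi> x * \<psi> y) \<and> (\<forall>x. norm (\<psi> x) = 1)"

lemma additive_char_add: "additive_char \<psi> \<Longrightarrow> \<psi> (x + y) = \<psi> x * \<psi> y"
  and additive_char_norm: "additive_char \<psi> \<Longrightarrow> norm (\<psi> x) = 1"
  by (simp_all add: additive_char_def)

lemma additive_char_0: "additive_char \<psi> \<Longrightarrow> \<psi> 0 = 1"
  using additive_char_add[of \<psi> 0 0] additive_char_norm[of \<psi> 0] by force

definition ext_trace :: "nat \<Rightarrow> 'a::{finite,field} alg_closure \<Rightarrow> 'a alg_closure" where
  "ext_trace i y = (\<Sum>t<i. y ^ (CARD('a) ^ t))"

lemma ext_trace_add: "ext_trace i (x + y) = ext_trace i x + ext_trace i y"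
  by (simp add: ext_trace_def frob_pow_add sum.distrib)

lemma ext_trace_range:
  fixes y :: "'a::{finite,field} alg_closure"
  assumes "y \<in> ext_field i"
  shows "ext_trace i y \<in> range to_ac"
proof -
  have "frob (ext_trace i y) = (\<Sum>t<i. y ^ (CARD('a) ^ Suc t))"
    unfolding ext_trace_def frob.hom_sum by (simp add: power_mult[symmetric] mult.commute)
  also have "y ^ (CARD('a) ^ 0) + \<dots> = (\<Sum>t<Suc i. y ^ (CARD('a) ^ t))" by (simp only: sum.lessThan_Suc_shift)
  also have "\<dots> = ext_trace i y + y" using assms by (simp add: ext_trace_def ext_field_def)
  finally have "frob (ext_trace i y) = ext_trace i y" by simp
  then show ?thesis by (simp only: frob_eq_iff)
qed

lemma to_ac_frob_pow: "to_ac c ^ (CARD('a) ^ t) = to_ac (c :: 'a::{finite,field})"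
proof (induction t)
  case (Suc t)
  have "to_ac c ^ (CARD('a) ^ Suc t) = (to_ac c ^ (CARD('a) ^ t)) ^ CARD('a)"
    by (simp add: power_mult[symmetric] mult.commute)
  then show ?case using Suc power_card_field[of c] by (simp flip: to_ac_power)
qed simp

lemma ext_trace_scale: "ext_trace i (to_ac c * y) = to_ac (c :: 'a::{finite,field}) * ext_trace i y"
  by (simp add: ext_trace_def power_mult_distrib to_ac_frob_pow sum_distrib_left)

text \<open>The trace is a polynomial of degree at most \<open>q^(i-1)\<close>, too small to vanish
  on \<open>q^i\<close> elements, and it is not the zero polynomial because its linear coefficient
  is 1.\<close>

lemma ext_trace_nonzero:
  assumes "i > 0"
  shows "\<exists>y\<in>ext_field i. ext_trace i y \<noteq> (0 :: 'a::{finite,field} alg_closure)"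
proof (rule ccontr)
  assume *: "\<not> ?thesis"
  let ?q = "CARD('a)"
  have q: "?q > 1" using CARD_ge_2[where 'a = 'a] by simp
  let ?T = "\<Sum>t<i. monom 1 (?q ^ t) :: 'a alg_closure poly"
  have "degree ?T \<le> ?q ^ (i - 1)"
  proof (rule degree_sum_le)
    fix t assume "t \<in> {..<i}"
    then have "?q ^ t \<le> ?q ^ (i - 1)" using q by (intro power_increasing) auto
    then show "degree (monom 1 (?q ^ t) :: 'a alg_closure poly) \<le> ?q ^ (i - 1)"
      using degree_monom_le le_trans by blast
  qed simp
  also have "\<dots> < ?q ^ i" using q assms by (intro power_strict_increasing) auto
  also have "\<dots> = card (ext_field i :: 'a alg_closure set)" using ext_field_card(2)[OF assms, where 'a = 'a] by simp
  finally have "?T = 0"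
    using * ext_field_card(1)[OF assms, where 'a = 'a]
    by (intro poly_eq_0_if_many_roots[of "ext_field i"]) (auto simp: poly_sum poly_monom ext_trace_def)
  moreover have "coeff ?T 1 = 1"
  proof -
    have "coeff ?T 1 = (\<Sum>t<i. if t = 0 then 1 else 0)"
      unfolding coeff_sum using q by (intro sum.cong refl) (auto simp: nat_power_eq_Suc_0_iff)
    then show ?thesis using assms by (simp add: sum.delta)
  qed
  ultimately show False by (metis coeff_0 zero_neq_one)
qed

definition ext_char :: "('a::{finite,field} \<Rightarrow> complex) \<Rightarrow> nat \<Rightarrow> 'a alg_closure \<Rightarrow> complex" where
  "ext_char \<psi> i y = \<psi> (of_ac (ext_trace i y))"

lemma char_sum_eq: "char_sum \<psi> k i = (\<Sum>x\<in>ext_field i - {0}. ext_char \<psi> i (x ^ k))"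
  by (simp add: char_sum_def ext_char_def ext_trace_def)

lemma ext_char_norm: "additive_char \<psi> \<Longrightarrow> norm (ext_char \<psi> i y) = 1"
  by (simp add: ext_char_def additive_char_norm)

lemma ext_char_add:
  assumes "additive_char \<psi>" "x \<in> ext_field i" "y \<in> ext_field i"
  shows "ext_char \<psi> i (x + y) = ext_char \<psi> i x * ext_char \<psi> i y"
proof -
  obtain a b where "ext_trace i x = to_ac a" "ext_trace i y = to_ac b"
    using ext_trace_range[OF assms(2)] ext_trace_range[OF assms(3)] by blast
  then show ?thesis
    using assms(1) by (simp add: ext_char_def ext_trace_add additive_char_add flip: to_ac_add)
qed

lemma ext_field_uminus:
  fixes x :: "'a::{finite,field} alg_closure"
  assumes "x \<in> ext_field i"
  shows "- x \<in> ext_field i"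
proof -
  have "x ^ (CARD('a) ^ i) + (- x) ^ (CARD('a) ^ i) = (x + - x) ^ (CARD('a) ^ i)" by (rule frob_pow_add[symmetric])
  also have "\<dots> = 0" by (simp add: zero_power)
  finally have "x + (- x) ^ (CARD('a) ^ i) = 0" using assms by (simp add: ext_field_def)
  then show ?thesis unfolding ext_field_def by (simp add: add_eq_0_iff)
qed

lemma ext_char_diff:
  assumes "additive_char \<psi>" "x \<in> ext_field i" "y \<in> ext_field i"
  shows "ext_char \<psi> i (x - y) = ext_char \<psi> i x * cnj (ext_char \<psi> i y)"
proof -
  have d: "x - y \<in> ext_field i" using ext_field_add[OF assms(2) ext_field_uminus[OF assms(3)]] by simp
  have "ext_char \<psi> i x = ext_char \<psi> i (x - y) * ext_char \<psi> i y"
    using ext_char_add[OF assms(1) d assms(3)] by simp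
  moreover have "ext_char \<psi> i y * cnj (ext_char \<psi> i y) = 1"
    using ext_char_norm[OF assms(1), of i y] by (simp add: complex_norm_square[symmetric])
  ultimately show ?thesis by (simp add: mult.assoc)
qed

lemma ext_char_nontrivial:
  fixes \<psi> :: "'a::{finite,field} \<Rightarrow> complex"
  assumes "i > 0" "\<psi> b \<noteq> 1"
  shows "\<exists>y\<in>ext_field i. ext_char \<psi> i y \<noteq> 1"
proof -
  obtain y where y: "y \<in> ext_field i" "ext_trace i y \<noteq> (0 :: 'a alg_closure)" using ext_trace_nonzero[OF assms(1)] by blast
  obtain c where c: "ext_trace i y = to_ac c" using ext_trace_range[OF y(1)] by blast
  then have "c \<noteq> 0" using y(2) by auto
  have "to_ac (b / c) \<in> ext_field i" using to_ac_frob_pow[of "b / c"] by (simp add: ext_field_def del: to_ac_divide)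
  then have "to_ac (b / c) * y \<in> ext_field i" using y(1) by (rule ext_field_mult)
  moreover have "ext_trace i (to_ac (b / c) * y) = to_ac b"
    unfolding ext_trace_scale c using \<open>c \<noteq> 0\<close> by simp
  then have "ext_char \<psi> i (to_ac (b / c) * y) \<noteq> 1" using assms(2) unfolding ext_char_def by (metis of_ac_to_ac)
  ultimately show ?thesis by blast
qed

lemma ext_char_orthogonal:
  fixes \<psi> :: "'a::{finite,field} \<Rightarrow> complex"
  assumes "i > 0" "additive_char \<psi>" "\<psi> b \<noteq> 1" and h: "h \<in> ext_field i"
  shows "(\<Sum>a\<in>ext_field i. ext_char \<psi> i (a * h)) = (if h = 0 then of_nat (CARD('a) ^ i) else 0)"
proof (cases "h = 0")
  case True
  have "ext_char \<psi> i 0 = 1" using ext_char_diff[OF assms(2) h h] ext_char_norm[OF assms(2), of i h]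
    by (simp add: complex_norm_square[symmetric])
  then show ?thesis using True ext_field_card(2)[OF assms(1), where 'a = 'a] by simp
next
  case False
  have "bij_betw (\<lambda>a. a * h) (ext_field i) (ext_field i)"
  proof (rule bij_betw_byWitness[where f' = "\<lambda>a. a * inverse h"])
    show "(\<lambda>a. a * h) ` ext_field i \<subseteq> ext_field i" using h by (auto intro: ext_field_mult)
    show "(\<lambda>a. a * inverse h) ` ext_field i \<subseteq> ext_field i" using h by (auto intro: ext_field_mult ext_field_inverse)
  qed (use False in \<open>auto simp: mult.assoc\<close>)
  then have 1: "(\<Sum>a\<in>ext_field i. ext_char \<psi> i (a * h)) = (\<Sum>a\<in>ext_field i. ext_char \<psi> i a)"
    by (rule sum.reindex_bij_betw)
  obtain y where y: "y \<in> ext_field i" "ext_char \<psi> i y \<noteq> 1" using ext_char_nontrivial[of i \<psi>, OF assms(1,3)] by blast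
  have "bij_betw (\<lambda>a. a + y) (ext_field i) (ext_field i)"
  proof (rule bij_betw_byWitness[where f' = "\<lambda>a. a + - y"])
    show "(\<lambda>a. a + y) ` ext_field i \<subseteq> ext_field i" using y(1) by (auto intro: ext_field_add)
    show "(\<lambda>a. a + - y) ` ext_field i \<subseteq> ext_field i"
      using ext_field_add[OF _ ext_field_uminus[OF y(1)]] by (intro image_subsetI)
  qed auto
  then have "(\<Sum>a\<in>ext_field i. ext_char \<psi> i a) = (\<Sum>a\<in>ext_field i. ext_char \<psi> i (a + y))"
    by (rule sum.reindex_bij_betw[symmetric])
  also have "\<dots> = (\<Sum>a\<in>ext_field i. ext_char \<psi> i a) * ext_char \<psi> i y"
    unfolding sum_distrib_right using y(1) by (intro sum.cong refl ext_char_add[OF assms(2)])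
  finally have "(\<Sum>a\<in>ext_field i. ext_char \<psi> i a) = 0" using y(2) by (metis mult_cancel_left mult.right_neutral)
  with 1 False show ?thesis by simp
qed

text \<open>The fibre of the power map through \<open>x\<close> is a coset of the group of
  \<open>k\<close>-th roots of unity.\<close>

lemma card_kth_roots:
  fixes x :: "'a::{finite,field} alg_closure"
  assumes "x \<in> ext_field i - {0}"
  shows "card {y \<in> ext_field i - {0}. y ^ k = x ^ k} = card {z \<in> ext_field i - {0 :: 'a alg_closure}. z ^ k = 1}"
proof (rule bij_betw_same_card[of "\<lambda>y. y * inverse x"], rule bij_betw_byWitness[where f' = "\<lambda>z. z * x"])
  show "(\<lambda>y. y * inverse x) ` {y \<in> ext_field i - {0}. y ^ k = x ^ k} \<subseteq> {z \<in> ext_field i - {0}. z ^ k = 1}"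
    using assms by (auto intro!: ext_field_mult ext_field_inverse simp: power_mult_distrib power_inverse)
  show "(\<lambda>z. z * x) ` {z \<in> ext_field i - {0}. z ^ k = 1} \<subseteq> {y \<in> ext_field i - {0}. y ^ k = x ^ k}"
    using assms by (auto intro!: ext_field_mult simp: power_mult_distrib)
qed (use assms in \<open>auto simp: mult.assoc\<close>)

text \<open>Second moment over all twists \<open>a\<close>: the twist by a \<open>k\<close>-th power does not change the sum.\<close>

lemma char_sum_bound:
  fixes \<psi> :: "'a::{finite,field} \<Rightarrow> complex"
  assumes i: "i > 0" and \<psi>: "additive_char \<psi>" "\<psi> b \<noteq> 1"
  shows "(norm (char_sum \<psi> k i))\<^sup>2 \<le>
    (real (card {z \<in> ext_field i - {0 :: 'a alg_closure}. z ^ k = 1}))\<^sup>2 * real (CARD('a) ^ i)"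
proof -
  let ?F = "ext_field i :: 'a alg_closure set" and ?U = "ext_field i - {0} :: 'a alg_closure set"
  let ?m = "card {z \<in> ?U. z ^ k = 1}"
  define S where "S a = (\<Sum>x\<in>?U. ext_char \<psi> i (a * x ^ k))" for a
  have fin: "finite ?F" "finite ?U" using ext_field_card(1)[OF i, where 'a = 'a] by auto
  have Sk: "S (c ^ k) = char_sum \<psi> k i" if c: "c \<in> ?U" for c
  proof -
    have "bij_betw (\<lambda>x. c * x) ?U ?U"
    proof (rule bij_betw_byWitness[where f' = "\<lambda>x. inverse c * x"])
      show "(\<lambda>x. c * x) ` ?U \<subseteq> ?U" using c by (auto intro: ext_field_mult)
      show "(\<lambda>x. inverse c * x) ` ?U \<subseteq> ?U" using c by (auto intro: ext_field_mult ext_field_inverse)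
    qed (use c in \<open>auto simp: mult.assoc[symmetric]\<close>)
    from sum.reindex_bij_betw[OF this, of "\<lambda>x. ext_char \<psi> i (x ^ k)"]
    show ?thesis by (simp add: S_def char_sum_eq power_mult_distrib)
  qed
  \<comment> \<open>Parseval: by orthogonality the second moment counts the pairs with equal
    \<open>k\<close>-th powers.\<close>
  have "of_real (\<Sum>a\<in>?F. (norm (S a))\<^sup>2) = (\<Sum>a\<in>?F. S a * cnj (S a))"
    unfolding of_real_sum complex_norm_square ..
  also have "\<dots> = (\<Sum>a\<in>?F. \<Sum>x\<in>?U. \<Sum>y\<in>?U. ext_char \<psi> i (a * (x ^ k - y ^ k)))"
  proof (rule sum.cong[OF refl])
    fix a assume a: "a \<in> ?F"
    have "S a * cnj (S a) = (\<Sum>x\<in>?U. \<Sum>y\<in>?U. ext_char \<psi> i (a * x ^ k) * cnj (ext_char \<psi> i (a * y ^ k)))"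
      unfolding S_def cnj_sum by (rule sum_product)
    also have "\<dots> = (\<Sum>x\<in>?U. \<Sum>y\<in>?U. ext_char \<psi> i (a * (x ^ k - y ^ k)))"
    proof (rule sum.cong[OF refl], rule sum.cong[OF refl])
      fix x y assume "x \<in> ?U" "y \<in> ?U"
      then have "a * x ^ k \<in> ?F" "a * y ^ k \<in> ?F" using a by (auto intro!: ext_field_mult ext_field_power)
      from ext_char_diff[OF \<psi>(1) this]
      show "ext_char \<psi> i (a * x ^ k) * cnj (ext_char \<psi> i (a * y ^ k)) = ext_char \<psi> i (a * (x ^ k - y ^ k))"
        by (simp add: algebra_simps)
    qed
    finally show "S a * cnj (S a) = (\<Sum>x\<in>?U. \<Sum>y\<in>?U. ext_char \<psi> i (a * (x ^ k - y ^ k)))" .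
  qed
  also have "\<dots> = (\<Sum>x\<in>?U. \<Sum>y\<in>?U. \<Sum>a\<in>?F. ext_char \<psi> i (a * (x ^ k - y ^ k)))"
    by (subst sum.swap, rule sum.cong[OF refl], rule sum.swap)
  also have "\<dots> = (\<Sum>x\<in>?U. \<Sum>y\<in>?U. if y ^ k = x ^ k then of_nat (CARD('a) ^ i) else 0)"
  proof (rule sum.cong[OF refl], rule sum.cong[OF refl])
    fix x y assume "x \<in> ?U" "y \<in> ?U"
    then have "x ^ k - y ^ k \<in> ?F"
      using ext_field_add[OF ext_field_power ext_field_uminus[OF ext_field_power], of x i y k k] by simp
    from ext_char_orthogonal[OF i \<psi> this]
    show "(\<Sum>a\<in>?F. ext_char \<psi> i (a * (x ^ k - y ^ k))) = (if y ^ k = x ^ k then of_nat (CARD('a) ^ i) else 0)"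
      by (cases "x ^ k = y ^ k") auto
  qed
  also have "\<dots> = (\<Sum>x\<in>?U. of_nat (card {y \<in> ?U. y ^ k = x ^ k}) * of_nat (CARD('a) ^ i))"
  proof (rule sum.cong[OF refl])
    fix x
    show "(\<Sum>y\<in>?U. if y ^ k = x ^ k then of_nat (CARD('a) ^ i) else 0) =
       of_nat (card {y \<in> ?U. y ^ k = x ^ k}) * (of_nat (CARD('a) ^ i) :: complex)"
      by (subst sum.inter_filter[OF fin(2), symmetric]) simp
  qed
  also have "\<dots> = (\<Sum>x\<in>?U. of_nat ?m * of_nat (CARD('a) ^ i))"
    by (rule sum.cong[OF refl], subst card_kth_roots, assumption, rule refl)
  also have "\<dots> = of_real (real (card ?U) * (real ?m * real (CARD('a) ^ i)))"
    by (simp only: sum_constant of_real_mult of_real_of_nat_eq)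
  finally have second: "(\<Sum>a\<in>?F. (norm (S a))\<^sup>2) = real (card ?U) * (real ?m * real (CARD('a) ^ i))"
    by (simp only: of_real_eq_iff)
  \<comment> \<open>Each nonzero \<open>k\<close>-th power is \<open>c ^ k\<close> for exactly
    \<open>?m\<close> elements \<open>c\<close>, so \<open>card ?U\<close> copies of the wanted
    square are contained in \<open>?m\<close> copies of the second moment.\<close>
  have "real (card ?U) * (norm (char_sum \<psi> k i))\<^sup>2 = (\<Sum>c\<in>?U. (norm (S (c ^ k)))\<^sup>2)"
    by (simp add: Sk)
  also have "\<dots> = (\<Sum>a\<in>(\<lambda>c. c ^ k) ` ?U. \<Sum>c\<in>{c \<in> ?U. c ^ k = a}. (norm (S (c ^ k)))\<^sup>2)"
    by (rule sum.image_gen[OF fin(2)])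
  also have "\<dots> = (\<Sum>a\<in>(\<lambda>c. c ^ k) ` ?U. real ?m * (norm (S a))\<^sup>2)"
  proof (rule sum.cong[OF refl])
    fix a assume "a \<in> (\<lambda>c. c ^ k) ` ?U"
    then obtain c where c: "c \<in> ?U" "a = c ^ k" by blast
    have "(\<Sum>c\<in>{c \<in> ?U. c ^ k = a}. (norm (S (c ^ k)))\<^sup>2) = (\<Sum>c\<in>{c \<in> ?U. c ^ k = a}. (norm (S a))\<^sup>2)"
      by (rule sum.cong) auto
    also have "\<dots> = real (card {y \<in> ?U. y ^ k = c ^ k}) * (norm (S a))\<^sup>2" by (simp add: c(2))
    also have "card {y \<in> ?U. y ^ k = c ^ k} = ?m" by (rule card_kth_roots[OF c(1)])
    finally show "(\<Sum>c\<in>{c \<in> ?U. c ^ k = a}. (norm (S (c ^ k)))\<^sup>2) = real ?m * (norm (S a))\<^sup>2" .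
  qed
  also have "\<dots> \<le> (\<Sum>a\<in>?F. real ?m * (norm (S a))\<^sup>2)"
    by (rule sum_mono2[OF fin(1)]) (auto intro: ext_field_power)
  also have "\<dots> = real ?m * (real (card ?U) * (real ?m * real (CARD('a) ^ i)))"
    unfolding sum_distrib_left[symmetric] second ..
  finally have "real (card ?U) * (norm (char_sum \<psi> k i))\<^sup>2 \<le> real (card ?U) * ((real ?m)\<^sup>2 * real (CARD('a) ^ i))"
    by (simp add: power2_eq_square algebra_simps)
  moreover have "1 \<in> ?U" by simp
  then have "card ?U > 0" using fin(2) card_gt_0_iff by blast
  ultimately show ?thesis by simp
qed

text \<open>The order of a nonzero element divides \<open>q^i - 1\<close>, so Bezout turns
  \<open>z^k = 1\<close> into \<open>z^g = 1\<close> for the gcd \<open>g\<close>, an equation with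
  at most \<open>g\<close> roots.\<close>

lemma card_roots_of_unity_le:
  assumes "i > 0" "k > 0"
  shows "card {z \<in> ext_field i - {0 :: 'a::{finite,field} alg_closure}. z ^ k = 1} \<le> gcd k (CARD('a) ^ i - 1)"
proof -
  let ?Q = "CARD('a) ^ i" and ?g = "gcd k (CARD('a) ^ i - 1)"
  have g: "?g > 0" using assms(2) by (intro gcd_pos_nat[THEN iffD2]) simp
  have zg: "z ^ ?g = 1" if "z \<in> ext_field i - {0 :: 'a alg_closure}" "z ^ k = 1" for z
  proof -
    have "z * z ^ (?Q - 1) = z" by (subst power_Suc[symmetric]) (use that(1) in \<open>simp add: ext_field_def\<close>)
    then have zq: "z ^ (?Q - 1) = 1" using that(1) by simp
    have "k \<noteq> 0" using assms(2) by simp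
    from bezout_nat[OF this, of "?Q - 1"] obtain x y where "k * x = (?Q - 1) * y + ?g" by blast
    then have "z ^ (k * x) = z ^ ((?Q - 1) * y + ?g)" by simp
    then show ?thesis using zq that(2) by (simp add: power_mult power_add)
  qed
  let ?p = "monom 1 ?g - 1 :: 'a alg_closure poly"
  have "coeff (1 :: 'a alg_closure poly) ?g = 0" using g by (intro coeff_eq_0) simp
  then have "coeff ?p ?g = 1" by (simp only: coeff_diff coeff_monom if_True diff_zero simp_thms)
  then have p0: "?p \<noteq> 0" by (metis coeff_0 zero_neq_one)
  have "degree ?p \<le> ?g" by (intro degree_diff_le degree_monom_le) simp
  then have "card {x. poly ?p x = 0} \<le> ?g" using card_poly_roots_bound[OF p0] by simp
  moreover have "card {z \<in> ext_field i - {0 :: 'a alg_closure}. z ^ k = 1} \<le> card {x. poly ?p x = 0}"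
    using zg by (intro card_mono poly_roots_finite[OF p0]) (auto simp: poly_monom)
  ultimately show ?thesis by simp
qed

lemma char_sum_trivial_bound:
  fixes \<psi> :: "'a::{finite,field} \<Rightarrow> complex"
  assumes "i > 0" "additive_char \<psi>"
  shows "norm (char_sum \<psi> k i) \<le> real (CARD('a) ^ i - 1)"
proof -
  have "norm (char_sum \<psi> k i) \<le> (\<Sum>x\<in>ext_field i - {0 :: 'a alg_closure}. norm (ext_char \<psi> i (x ^ k)))"
    unfolding char_sum_eq by (rule norm_sum)
  also have "\<dots> = real (CARD('a) ^ i - 1)"
    using ext_field_card[OF assms(1), where 'a = 'a] by (simp add: ext_char_norm[OF assms(2)] card_Diff_singleton)
  finally show ?thesis .
qed

subsection \<open>Solving the recursions\<close>

text \<open>The operation is the substitution of \<open>c u\<close> for \<open>u\<close>, which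
  respects products.\<close>

lemma fps_scale_mult:
  fixes f g :: "complex fps"
  shows "Abs_fps (\<lambda>n. c ^ n * fps_nth (f * g) n) = Abs_fps (\<lambda>n. c ^ n * fps_nth f n) * Abs_fps (\<lambda>n. c ^ n * fps_nth g n)"
proof (rule fps_ext)
  fix n
  have "c ^ n * (fps_nth f i * fps_nth g (n - i)) = c ^ i * fps_nth f i * (c ^ (n - i) * fps_nth g (n - i))" if "i \<le> n" for i
  proof -
    have "c ^ n = c ^ i * c ^ (n - i)" using that by (simp flip: power_add)
    then show ?thesis by simp
  qed
  then show "fps_nth (Abs_fps (\<lambda>n. c ^ n * fps_nth (f * g) n)) n = fps_nth (Abs_fps (\<lambda>n. c ^ n * fps_nth f n) * Abs_fps (\<lambda>n. c ^ n * fps_nth g n)) n"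
    unfolding fps_nth_Abs_fps fps_mult_nth sum_distrib_left by (intro sum.cong refl) simp
qed

text \<open>The Leibniz rule for the operator \<open>u d/du\<close>.\<close>

lemma fps_euler_mult:
  fixes f g :: "complex fps"
  shows "Abs_fps (\<lambda>n. of_nat n * fps_nth (f * g) n) = Abs_fps (\<lambda>n. of_nat n * fps_nth f n) * g + f * Abs_fps (\<lambda>n. of_nat n * fps_nth g n)"
proof (rule fps_ext)
  fix n
  have "of_nat n * (fps_nth f i * fps_nth g (n - i)) = of_nat i * fps_nth f i * fps_nth g (n - i) + fps_nth f i * (of_nat (n - i) * fps_nth g (n - i))"
    if "i \<le> n" for i
    using that by (simp add: of_nat_diff algebra_simps)
  then show "fps_nth (Abs_fps (\<lambda>n. of_nat n * fps_nth (f * g) n)) n =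
      fps_nth (Abs_fps (\<lambda>n. of_nat n * fps_nth f n) * g + f * Abs_fps (\<lambda>n. of_nat n * fps_nth g n)) n"
    by (simp add: fps_mult_nth sum_distrib_left sum.distrib)
qed

text \<open>If \<open>F(qu) = A(u) F(u)\<close> and \<open>u A'(u) = S(u) A(u)\<close>, then \<open>G = u F' - s F\<close> with
  \<open>s\<^sub>i = S\<^sub>i / (q\<^sup>i - 1)\<close> satisfies \<open>G(qu) = A(u) G(u)\<close> as well; as it has no constant term, it vanishes.\<close>

lemma q_recursion_solution:
  fixes E A S :: "nat \<Rightarrow> complex" and q :: nat
  assumes q: "q > 1" and A0: "A 0 = 1"
    and E: "\<And>n. of_nat (q ^ n) * E n = (\<Sum>j\<le>n. A j * E (n - j))"
    and A: "\<And>j. of_nat j * A j = (\<Sum>i=1..j. S i * A (j - i))"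
  shows "of_nat n * E n = (\<Sum>i=1..n. S i / of_nat (q ^ i - 1) * E (n - i))"
proof -
  \<comment> \<open>Index 0 is set apart: the denominator vanishes there, and the series must have
    no constant term.\<close>
  define s where "s i = (if i = 0 then 0 else S i / of_nat (q ^ i - 1))" for i
  let ?sc = "\<lambda>f. Abs_fps (\<lambda>n. of_nat q ^ n * fps_nth f n) :: complex fps"
  let ?D = "\<lambda>f. Abs_fps (\<lambda>n. of_nat n * fps_nth f n) :: complex fps"
  let ?F = "Abs_fps E" and ?A = "Abs_fps A" and ?s = "Abs_fps s"
  let ?S = "Abs_fps (\<lambda>i. if i = 0 then 0 else S i)"
  have qi: "of_nat (q ^ i - 1) = (of_nat q ^ i - 1 :: complex)" for i
    using q by (simp add: of_nat_diff)
  have qne: "of_nat q ^ i - (1 :: complex) \<noteq> 0" if "i > 0" for i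
  proof -
    have "1 < q ^ i" using q that by (rule one_less_power)
    then have "of_nat (q ^ i - 1) \<noteq> (0 :: complex)" unfolding of_nat_eq_0_iff by simp
    then show ?thesis unfolding qi .
  qed
  have FA: "?sc ?F = ?A * ?F"
    by (rule fps_ext) (use E in \<open>simp add: fps_mult_nth atLeast0AtMost\<close>)
  have drop0: "(\<Sum>i=0..n. f i) = (\<Sum>i=1..n. f i)" if "f 0 = 0" for f :: "nat \<Rightarrow> complex" and n
    using that by (simp add: sum.atLeast_Suc_atMost)
  have DA: "?D ?A = ?S * ?A"
  proof (rule fps_ext)
    fix j
    have "fps_nth (?S * ?A) j = (\<Sum>i=1..j. (if i = 0 then 0 else S i) * A (j - i))"
      unfolding fps_mult_nth by (subst drop0) auto
    also have "\<dots> = (\<Sum>i=1..j. S i * A (j - i))" by (rule sum.cong) auto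
    finally show "fps_nth (?D ?A) j = fps_nth (?S * ?A) j" using A[of j] by simp
  qed
  \<comment> \<open>The defining property of the denominators:
    \<open>q^i s_i = S_i + s_i\<close>.\<close>
  have ss: "?sc ?s = ?S + ?s"
  proof (rule fps_ext)
    fix i
    show "fps_nth (?sc ?s) i = fps_nth (?S + ?s) i"
    proof (cases "i = 0")
      case False
      then have "s i = S i / (of_nat q ^ i - 1)" by (simp only: s_def qi if_False)
      then have "of_nat q ^ i * s i = S i + s i" using qne[of i] False by (simp add: field_simps)
      then show ?thesis using False by simp
    qed (simp add: s_def)
  qed
  define G where "G = ?D ?F - ?s * ?F"
  have "?sc G = ?sc (?D ?F) - ?sc (?s * ?F)" unfolding G_def by (rule fps_ext) (simp add: algebra_simps)
  also have "?sc (?D ?F) = ?D (?sc ?F)" by (rule fps_ext) simp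
  also have "\<dots> = ?S * ?A * ?F + ?A * ?D ?F" unfolding FA fps_euler_mult DA ..
  also have "?sc (?s * ?F) = (?S + ?s) * (?A * ?F)" unfolding fps_scale_mult ss FA ..
  finally have scG: "?sc G = ?A * G" by (simp add: G_def algebra_simps)
  \<comment> \<open>For \<open>n > 0\<close> the lower coefficients vanish by induction, and
    \<open>A 0 = 1\<close> leaves \<open>(q^n - 1) G_n = 0\<close>.\<close>
  have "fps_nth G n = 0" for n
  proof (induction n rule: less_induct)
    case (less n)
    show ?case
    proof (cases "n = 0")
      case True
      then show ?thesis by (simp add: G_def s_def)
    next
      case False
      have "of_nat q ^ n * fps_nth G n = (\<Sum>i=0..n. A i * fps_nth G (n - i))"
        using arg_cong[OF scG, of "\<lambda>f. fps_nth f n"] by (simp add: fps_mult_nth)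
      also have "\<dots> = A 0 * fps_nth G n + (\<Sum>i=1..n. A i * fps_nth G (n - i))" by (simp add: sum.atLeast_Suc_atMost)
      also have "(\<Sum>i=1..n. A i * fps_nth G (n - i)) = 0" by (rule sum.neutral) (use less in auto)
      finally have "(of_nat q ^ n - 1) * fps_nth G n = 0" using A0 by (simp add: algebra_simps)
      then show ?thesis using qne[of n] False by simp
    qed
  qed
  then have "of_nat n * E n = (\<Sum>i=0..n. s i * E (n - i))"
    by (simp add: G_def fps_mult_nth)
  also have "\<dots> = (\<Sum>i=1..n. s i * E (n - i))" by (rule drop0) (simp add: s_def)
  also have "\<dots> = (\<Sum>i=1..n. S i / of_nat (q ^ i - 1) * E (n - i))" by (rule sum.cong) (auto simp: s_def)
  finally show ?thesis .
qed

lemma sum_inverse_le_ln: "(\<Sum>i=1..n. 1 / real i) \<le> 1 + ln (real n)" if "n \<ge> 1"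
  using that
proof (induction n rule: dec_induct)
  case (step n)
  have "ln (real n / real (Suc n)) \<le> real n / real (Suc n) - 1"
    using step by (intro ln_le_minus_one) simp
  also have "\<dots> = - (1 / real (Suc n))" by (simp add: field_simps)
  finally have "1 / real (Suc n) \<le> ln (real (Suc n)) - ln (real n)" using step by (simp add: ln_div)
  then show ?case using step by simp
qed simp

text \<open>With \<open>P(x) = \<Sum>\<^sub>j |E\<^sub>j| x\<^sup>j\<close> and \<open>T(x) = \<Sum>\<^sub>i |s\<^sub>i| x\<^sup>i\<close> the recursion gives \<open>x P' \<le> T P\<close>,
  hence \<open>P(1) \<le> exp (\<Sum>\<^sub>i |s\<^sub>i| / i)\<close>.\<close>

lemma log_recursion_bound:
  fixes E s :: "nat \<Rightarrow> complex"
  assumes E0: "E 0 = 1" and rec: "\<And>n. of_nat n * E n = (\<Sum>i=1..n. s i * E (n - i))"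
    and s1: "\<And>i. i \<ge> 1 \<Longrightarrow> norm (s i) \<le> 1" and n: "n \<ge> 1"
  shows "norm (E n) \<le> exp 1 * exp (- (\<Sum>i=1..n. (1 - norm (s i)) / real i))"
proof -
  let ?u = "\<lambda>j. norm (E j)" and ?t = "\<lambda>i. norm (s i)"
  have urec: "real m * ?u m \<le> (\<Sum>i=1..m. ?t i * ?u (m - i))" for m
  proof -
    have "real m * ?u m = norm (of_nat m * E m)" by (simp add: norm_mult)
    also have "\<dots> \<le> (\<Sum>i=1..m. norm (s i * E (m - i)))" unfolding rec by (rule norm_sum)
    finally show ?thesis by (simp add: norm_mult)
  qed
  \<comment> \<open>Both series are cut off at \<open>n\<close>, so only polynomials are
    differentiated; \<open>L\<close> is the integral of \<open>T(x) / x\<close>.\<close>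
  define P where "P x = (\<Sum>j\<le>n. ?u j * x ^ j)" for x :: real
  define P' where "P' x = (\<Sum>j\<le>n. ?u j * (real j * x ^ (j - 1)))" for x :: real
  define L where "L x = (\<Sum>i=1..n. ?t i / real i * x ^ i)" for x :: real
  define L' where "L' x = (\<Sum>i=1..n. ?t i / real i * (real i * x ^ (i - 1)))" for x :: real
  have dP: "(P has_real_derivative P' x) (at x)" for x
    unfolding P_def P'_def by (auto intro!: derivative_eq_intros sum.cong)
  have dL: "(L has_real_derivative L' x) (at x)" for x
    unfolding L_def L'_def by (auto intro!: derivative_eq_intros sum.cong)
  have key: "P' x \<le> L' x * P x" if x: "x > 0" for x
  proof -
    have pw: "x * x ^ (i - 1) = x ^ i" if "i \<ge> 1" for i using that by (cases i) auto
    have "x * P' x = (\<Sum>m\<le>n. real m * ?u m * x ^ m)"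
      unfolding P'_def sum_distrib_left
    proof (rule sum.cong[OF refl])
      fix m
      show "x * (?u m * (real m * x ^ (m - 1))) = real m * ?u m * x ^ m" using pw[of m] by (cases m) (auto simp: algebra_simps)
    qed
    also have "\<dots> \<le> (\<Sum>m\<le>n. (\<Sum>i=1..m. ?t i * ?u (m - i)) * x ^ m)"
      using x by (intro sum_mono mult_right_mono urec) auto
    also have "\<dots> = (\<Sum>m\<le>n. \<Sum>i=1..m. (?t i * x ^ i) * (?u (m - i) * x ^ (m - i)))"
      unfolding sum_distrib_right
    proof (rule sum.cong[OF refl], rule sum.cong[OF refl])
      fix m i :: nat assume "i \<in> {1..m}"
      then have "x ^ m = x ^ i * x ^ (m - i)" by (simp flip: power_add)
      then show "?t i * ?u (m - i) * x ^ m = (?t i * x ^ i) * (?u (m - i) * x ^ (m - i))" by simp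
    qed
    also have "\<dots> = (\<Sum>(m, i)\<in>Sigma {..n} (\<lambda>m. {1..m}). (?t i * x ^ i) * (?u (m - i) * x ^ (m - i)))"
      by (rule sum.Sigma) auto
    also have "\<dots> = (\<Sum>(i, j)\<in>{(i, j). i \<in> {1..n} \<and> i + j \<le> n}. (?t i * x ^ i) * (?u j * x ^ j))"
      by (rule sum.reindex_bij_witness[where i = "\<lambda>(i, j). (i + j, i)" and j = "\<lambda>(m, i). (i, m - i)"]) auto
    \<comment> \<open>The condition \<open>i + j \<le> n\<close> is dropped to obtain a product; all
      added terms are nonnegative.\<close>
    also have "\<dots> \<le> (\<Sum>(i, j)\<in>{1..n} \<times> {..n}. (?t i * x ^ i) * (?u j * x ^ j))"
      by (rule sum_mono2) (use x in auto)
    also have "\<dots> = (\<Sum>i=1..n. ?t i * x ^ i) * P x"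
      unfolding P_def sum_product by (simp add: sum.cartesian_product)
    also have "(\<Sum>i=1..n. ?t i * x ^ i) = x * L' x"
      unfolding L'_def sum_distrib_left
    proof (rule sum.cong[OF refl])
      fix i assume "i \<in> {1..n}"
      then show "?t i * x ^ i = x * (?t i / real i * (real i * x ^ (i - 1)))" using pw[of i] by (simp add: algebra_simps)
    qed
    finally have "x * P' x \<le> x * (L' x * P x)" by (simp add: mult.assoc)
    then show ?thesis using x by simp
  qed
  have "P 1 * exp (- L 1) \<le> P 0 * exp (- L 0)"
  proof (rule DERIV_nonpos_imp_nonincreasing[where f = "\<lambda>x. P x * exp (- L x)"])
    fix x :: real assume x: "0 \<le> x" "x \<le> 1"
    have d: "((\<lambda>x. P x * exp (- L x)) has_real_derivative (P' x - L' x * P x) * exp (- L x)) (at x)"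
      by (rule derivative_eq_intros dP dL refl)+ (simp add: algebra_simps)
    have "P' x - L' x * P x \<le> 0"
    proof (cases "x = 0")
      case False
      then show ?thesis using key[of x] x by simp
    next
      \<comment> \<open>\<open>key\<close> is proved after multiplication by \<open>x\<close>, so
        the left endpoint is checked separately from the lowest coefficients.\<close>
      case True
      have "P' 0 = (if n \<ge> 1 then ?u 1 else 0)"
      proof -
        have "P' 0 = (\<Sum>j\<le>n. if j = 1 then ?u 1 else 0)" unfolding P'_def
          by (rule sum.cong[OF refl]) (auto simp: power_0_left)
        then show ?thesis by (simp add: sum.delta)
      qed
      moreover have "L' 0 = ?t 1"
      proof -
        have "L' 0 = (\<Sum>j=1..n. if j = 1 then ?t 1 else 0)" unfolding L'_def
          by (rule sum.cong[OF refl]) (auto simp: power_0_left)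
        then show ?thesis using n by (simp add: sum.delta)
      qed
      moreover have "P 0 = 1"
      proof -
        have "P 0 = (\<Sum>j\<le>n. if j = 0 then ?u 0 else 0)" unfolding P_def
          by (rule sum.cong[OF refl]) (auto simp: power_0_left)
        then show ?thesis by (simp add: sum.delta E0)
      qed
      moreover have "?u 1 \<le> ?t 1" using urec[of 1] by (simp add: E0)
      ultimately show ?thesis using True by auto
    qed
    then have "(P' x - L' x * P x) * exp (- L x) \<le> 0" by (simp add: mult_le_0_iff)
    with d show "\<exists>y. ((\<lambda>x. P x * exp (- L x)) has_real_derivative y) (at x) \<and> y \<le> 0" by blast
  qed simp
  moreover have "P 0 = 1"
  proof -
    have "P 0 = (\<Sum>j\<le>n. if j = 0 then ?u 0 else 0)" unfolding P_def
      by (rule sum.cong[OF refl]) (auto simp: power_0_left)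
    then show ?thesis by (simp add: sum.delta E0)
  qed
  moreover have "L 0 = 0" unfolding L_def by (rule sum.neutral) auto
  ultimately have "P 1 \<le> exp (L 1)" by (simp add: exp_minus field_simps)
  \<comment> \<open>With \<open>norm (s i) \<le> 1\<close>, a bound on the sum of all
    \<open>norm (E j)\<close> becomes one on \<open>n * norm (E n)\<close>. The harmonic sum
    contained in \<open>L 1\<close> costs a factor \<open>e n\<close>, whose \<open>n\<close>
    cancels.\<close>
  have "real n * ?u n \<le> (\<Sum>i=1..n. ?t i * ?u (n - i))" by (rule urec)
  also have "\<dots> \<le> (\<Sum>i=1..n. 1 * ?u (n - i))" by (intro sum_mono mult_right_mono s1) auto
  also have "\<dots> = (\<Sum>j<n. ?u j)"
    by (rule sum.reindex_bij_witness[where i = "\<lambda>j. n - j" and j = "\<lambda>i. n - i"]) auto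
  also have "\<dots> \<le> (\<Sum>j\<le>n. ?u j)" by (rule sum_mono2) auto
  also have "\<dots> = P 1" by (simp add: P_def)
  also note \<open>P 1 \<le> exp (L 1)\<close>
  also have "L 1 = (\<Sum>i=1..n. 1 / real i) - (\<Sum>i=1..n. (1 - ?t i) / real i)"
    unfolding L_def sum_subtractf[symmetric] by (rule sum.cong[OF refl]) (simp add: diff_divide_distrib)
  also have "exp \<dots> \<le> exp (1 + ln (real n) - (\<Sum>i=1..n. (1 - ?t i) / real i))"
    using sum_inverse_le_ln[OF n] by simp
  also have "\<dots> = real n * (exp 1 * exp (- (\<Sum>i=1..n. (1 - ?t i) / real i)))"
    using n by (simp add: exp_add exp_diff exp_minus field_simps)
  finally show ?thesis using n by simp
qed

subsection \<open>Greatest common divisors with numbers of the form $q^d-1$\<close>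

text \<open>Modulo the gcd both \<open>q^d\<close> and \<open>q^e\<close> are 1; Bezout transfers
  this to the exponent \<open>gcd d e\<close>.\<close>

lemma gcd_power_minus_one_dvd:
  fixes q d e :: nat
  assumes "q > 0" "d > 0"
  shows "gcd (q ^ d - 1) (q ^ e - 1) dvd q ^ gcd d e - 1"
proof -
  let ?u = "gcd (q ^ d - 1) (q ^ e - 1)"
  have c: "[q ^ i = 1] (mod ?u)" if "?u dvd q ^ i - 1" for i
  proof -
    have "1 \<le> q ^ i" using assms(1) by simp
    then show ?thesis using that by (simp only: cong_altdef_nat)
  qed
  have cd: "[q ^ d = 1] (mod ?u)" "[q ^ e = 1] (mod ?u)"
    by (rule c, rule gcd_dvd1, rule c, rule gcd_dvd2)
  obtain x y where xy: "d * x = e * y + gcd d e" using bezout_nat[of d e] assms(2) by blast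
  have 1: "[q ^ (e * y) * q ^ gcd d e = 1] (mod ?u)"
    using cong_pow[OF cd(1), of x] by (simp only: power_mult[symmetric] xy power_add power_one)
  have 2: "[q ^ (e * y) * q ^ gcd d e = q ^ gcd d e] (mod ?u)"
    using cong_mult[OF cong_pow[OF cd(2), of y] cong_refl, of "q ^ gcd d e"]
    by (simp only: power_mult[symmetric] power_one mult_1)
  have "[q ^ gcd d e = 1] (mod ?u)" using cong_trans[OF cong_sym[OF 2] 1] .
  moreover have "1 \<le> q ^ gcd d e" using assms(1) by simp
  ultimately show ?thesis by (simp only: cong_altdef_nat)
qed

lemma gcd_Lcm_dvd:
  fixes f :: "'b \<Rightarrow> nat"
  assumes "finite B" "\<And>e. e \<in> B \<Longrightarrow> gcd x (f e) dvd P"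
  shows "gcd x (Lcm (f ` B)) dvd P"
  using assms
proof (induction B rule: finite_induct)
  case (insert e B)
  have "gcd x (Lcm (f ` insert e B)) = lcm (gcd x (f e)) (gcd x (Lcm (f ` B)))"
    by (simp add: gcd_lcm_distrib)
  then show ?case using insert by simp
qed simp

definition aliquot :: "nat \<Rightarrow> nat" where
  "aliquot d = (\<Sum>f | f dvd d \<and> f < d. f)"

text \<open>Distinct \<open>q\<^sup>d - 1\<close> share only factors of \<open>q\<^sup>f - 1\<close> with \<open>f\<close> a proper divisor of \<open>d\<close>.\<close>

lemma prod_gcd_power_minus_one_le:
  fixes q k :: nat
  assumes q: "q > 1" and k: "k > 0" and fin: "finite B"
    and pos: "\<And>d. d \<in> B \<Longrightarrow> d > 0" and ndvd: "\<And>d e. d \<in> B \<Longrightarrow> e \<in> B \<Longrightarrow> d \<noteq> e \<Longrightarrow> \<not> d dvd e"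
  shows "(\<Prod>d\<in>B. gcd k (q ^ d - 1)) \<le> k * (\<Prod>d\<in>B. q ^ aliquot d)"
proof -
  let ?a = "\<lambda>d. gcd k (q ^ d - 1)"
  \<comment> \<open>For the induction the least common multiple replaces \<open>k\<close>. Since
    \<open>a * L = gcd a L * lcm a L\<close>, adjoining a number \<open>a\<close> to
    \<open>B\<close> loses only its gcd with the previous multiple.\<close>
  have "(\<Prod>d\<in>B. ?a d) \<le> Lcm (?a ` B) * (\<Prod>d\<in>B. q ^ aliquot d)"
    using fin pos ndvd
  proof (induction B rule: finite_induct)
    case (insert d B)
    let ?L = "Lcm (?a ` B)"
    let ?Pf = "\<Prod>f | f dvd d \<and> f < d. q ^ f - 1"
    have d: "d > 0" using insert.prems by simp
    have Pf: "?Pf > 0"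
    proof (rule prod_pos)
      fix f assume "f \<in> {f. f dvd d \<and> f < d}"
      then have "f > 0" using d by (intro Nat.gr0I) auto
      then have "1 < q ^ f" using q by (intro one_less_power)
      then show "0 < q ^ f - 1" by simp
    qed
    have finf: "finite {f. f dvd d \<and> f < d}" by (rule finite_subset[of _ "{..<d}"]) auto
    have "gcd (?a d) ?L dvd ?Pf"
    proof (rule gcd_Lcm_dvd[OF insert.hyps(1)])
      fix e assume e: "e \<in> B"
      have "d \<noteq> e" using e insert.hyps by auto
      then have "\<not> d dvd e" using e insert.prems(2)[of d e] by simp
      then have "gcd d e \<noteq> d" by (metis gcd_dvd2)
      moreover have "gcd d e \<le> d" using d by (intro gcd_le1_nat) simp
      ultimately have "gcd d e < d" by simp
      then have 1: "q ^ gcd d e - 1 dvd ?Pf" by (intro dvd_prodI[OF finf]) simp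
      have 2: "gcd (?a d) (?a e) dvd gcd (q ^ d - 1) (q ^ e - 1)" by (rule gcd_mono; rule gcd_dvd2)
      have 3: "gcd (q ^ d - 1) (q ^ e - 1) dvd q ^ gcd d e - 1"
        using q d by (intro gcd_power_minus_one_dvd) auto
      show "gcd (?a d) (?a e) dvd ?Pf" by (rule dvd_trans[OF 2 dvd_trans[OF 3 1]])
    qed
    then have "gcd (?a d) ?L \<le> ?Pf" using Pf by (rule dvd_imp_le)
    also have "?Pf \<le> (\<Prod>f | f dvd d \<and> f < d. q ^ f)" by (rule prod_mono) auto
    also have "\<dots> = q ^ aliquot d" by (simp add: power_sum aliquot_def)
    finally have g: "gcd (?a d) ?L \<le> q ^ aliquot d" .
    have "(\<Prod>d\<in>insert d B. ?a d) = ?a d * (\<Prod>d\<in>B. ?a d)" using insert.hyps by simp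
    also have "\<dots> \<le> ?a d * (?L * (\<Prod>d\<in>B. q ^ aliquot d))"
      using insert.IH insert.prems by (intro mult_left_mono) auto
    also have "\<dots> = gcd (?a d) ?L * lcm (?a d) ?L * (\<Prod>d\<in>B. q ^ aliquot d)"
      unfolding prod_gcd_lcm_nat[symmetric] by (rule mult.assoc[symmetric])
    also have "\<dots> \<le> q ^ aliquot d * lcm (?a d) ?L * (\<Prod>d\<in>B. q ^ aliquot d)"
      using g by (intro mult_right_mono) auto
    also have "\<dots> = Lcm (?a ` insert d B) * (\<Prod>d\<in>insert d B. q ^ aliquot d)"
      unfolding prod.insert[OF insert.hyps] image_insert Lcm_insert by (simp only: mult_ac)
    finally show ?case .
  qed simp
  also have "Lcm (?a ` B) \<le> k"
    by (rule dvd_imp_le[OF _ k]) (auto intro: Lcm_least)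
  finally show ?thesis by simp
qed

section \<open>Divisor sums along an arithmetic progression\<close>

text \<open>No element of such an interval divides another one, and coprimality to 6 makes every
  proper divisor at most a fifth of the number.\<close>

definition progression :: "nat \<Rightarrow> nat set" where
  "progression N = {d \<in> {N<..2 * N}. d mod 6 = 1}"

lemma finite_progression: "finite (progression N)"
  by (simp add: progression_def)

lemma progression_coprime_6: "d \<in> progression N \<Longrightarrow> coprime d 6"
proof -
  assume "d \<in> progression N"
  then have "gcd d 6 = gcd 1 6" using gcd_red_nat[of d 6] by (simp add: progression_def gcd.commute)
  then show "coprime d 6" by (simp add: coprime_iff_gcd_eq_1)
qed

text \<open>If anything is counted, \<open>m\<close> is coprime to 6, so any two multiples in the
  progression differ by a multiple of \<open>6 * m\<close>.\<close>

lemma card_multiples_in_progression: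
  assumes "m > 0" "N > 0"
  shows "real (card {d \<in> progression N. m dvd d}) \<le> real N / (6 * real m) + 1"
proof (cases "{d \<in> progression N. m dvd d} = {}")
  case False
  then obtain d0 where "d0 \<in> progression N" "m dvd d0" by blast
  then have cop: "coprime m 6" using progression_coprime_6 coprime_divisors[of m d0 6 6] by simp
  \<comment> \<open>The number of the block of length \<open>6 * m\<close> that contains
    \<open>d\<close>, counted from \<open>N + 1\<close>; each block holds at most one
    multiple.\<close>
  let ?h = "\<lambda>d. (d - Suc N) div (6 * m)"
  have key: False if "d \<in> progression N" "e \<in> progression N" "m dvd d" "m dvd e" "d < e" "?h d = ?h e" for d e
  proof -
    have "6 dvd e - d" using that by (intro mod_eq_dvd_iff_nat[THEN iffD1]) (auto simp: progression_def)
    moreover have "m dvd e - d" using that by (simp add: dvd_diff_nat)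
    ultimately have "6 * m dvd e - d" using cop by (simp add: coprime_commute divides_mult)
    then have le: "6 * m \<le> e - d" using that by (intro dvd_imp_le) auto
    have Nd: "Suc N \<le> d" using that by (simp add: progression_def)
    have "(d - Suc N) + 6 * m \<le> e - Suc N" using le Nd that by linarith
    then have "((d - Suc N) + 6 * m) div (6 * m) \<le> ?h e" by (rule div_le_mono)
    then have "Suc (?h d) \<le> ?h e" using assms by simp
    then show False using that by simp
  qed
  have "inj_on ?h {d \<in> progression N. m dvd d}"
  proof (rule inj_onI)
    fix d e assume "d \<in> {d \<in> progression N. m dvd d}" "e \<in> {d \<in> progression N. m dvd d}" "?h d = ?h e"
    then show "d = e" using key[of d e] key[of e d] linorder_neqE_nat[of d e] by auto
  qed
  moreover have "?h ` {d \<in> progression N. m dvd d} \<subseteq> {..(N - 1) div (6 * m)}"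
    by (auto simp: progression_def intro!: div_le_mono)
  ultimately have "card {d \<in> progression N. m dvd d} \<le> card {..(N - 1) div (6 * m)}"
    by (intro card_inj_on_le[of ?h]) auto
  then have "real (card {d \<in> progression N. m dvd d}) \<le> real ((N - 1) div (6 * m)) + 1" by simp
  also have "real ((N - 1) div (6 * m)) \<le> real (N - 1) / real (6 * m)" by (rule of_nat_div_le_of_nat)
  also have "\<dots> \<le> real N / (6 * real m)" using assms by (simp add: divide_right_mono)
  finally show ?thesis by simp
next
  case True
  show ?thesis unfolding True by simp
qed

text \<open>A proper divisor is \<open>d div m\<close> for a cofactor \<open>m\<close> that is
  coprime to 6 and different from 1, hence odd and at least 5.\<close>

lemma aliquot_le:
  assumes "d \<in> progression N"
  shows "aliquot d \<le> (\<Sum>l \<in> {l \<in> {2..N}. (2 * l + 1) dvd d}. d div (2 * l + 1))"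
proof -
  have d: "d > 0" "d \<le> 2 * N" using assms by (auto simp: progression_def)
  have cop: "coprime d 6" by (rule progression_coprime_6[OF assms])
  have "{f. f dvd d \<and> f < d} \<subseteq> (\<lambda>l. d div (2 * l + 1)) ` {l \<in> {2..N}. (2 * l + 1) dvd d}"
  proof
    fix f assume "f \<in> {f. f dvd d \<and> f < d}"
    then obtain m where m: "d = f * m" "f < d" by auto
    have mc: "coprime m 6" using cop m(1) by simp
    have "odd m"
    proof
      assume "even m"
      then show False using coprime_common_divisor[OF mc, of 2] by simp
    qed
    then obtain l where l: "m = 2 * l + 1" by (elim oddE)
    have "m \<noteq> 1" using m by auto
    moreover have "m \<noteq> 3"
    proof
      assume "m = 3"
      then show False using coprime_common_divisor[OF mc, of 3] by simp
    qed
    ultimately have "2 \<le> l" using l by (cases "l = 0 \<or> l = 1") auto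
    have f0: "f > 0" using m d by (intro Nat.gr0I) auto
    then have "m \<le> d" using m(1) by simp
    then have "l \<le> N" using l d by simp
    have "m \<noteq> 0" using l by simp
    then have "d div m = f" unfolding m(1) by (rule nonzero_mult_div_cancel_right)
    then have "f = d div (2 * l + 1)" unfolding l by (rule sym)
    moreover have "m dvd d" unfolding m(1) by (rule dvd_triv_right)
    then have "(2 * l + 1) dvd d" unfolding l .
    ultimately show "f \<in> (\<lambda>l. d div (2 * l + 1)) ` {l \<in> {2..N}. (2 * l + 1) dvd d}"
      using \<open>2 \<le> l\<close> \<open>l \<le> N\<close> by (intro image_eqI[of _ _ l]) auto
  qed
  then have "aliquot d \<le> (\<Sum>f\<in>(\<lambda>l. d div (2 * l + 1)) ` {l \<in> {2..N}. (2 * l + 1) dvd d}. f)"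
    unfolding aliquot_def by (intro sum_mono2) auto
  also have "\<dots> \<le> (\<Sum>l \<in> {l \<in> {2..N}. (2 * l + 1) dvd d}. d div (2 * l + 1))"
    using sum_image_le[of "{l \<in> {2..N}. (2 * l + 1) dvd d}" "\<lambda>f. f" "\<lambda>l. d div (2 * l + 1)"] by (simp add: o_def)
  finally show ?thesis .
qed

text \<open>Comparison with the telescoping terms \<open>1 / (4 * l * (l + 1))\<close>, whose sum
  from \<open>l = 2\<close> on is 1/8.\<close>

lemma sum_inverse_odd_squares_le: "(\<Sum>l=2..N. 1 / (real (2 * l + 1))\<^sup>2) \<le> 1 / 8"
proof -
  have "(\<Sum>l=2..N. 1 / (real (2 * l + 1))\<^sup>2) \<le> 1 / 8 - 1 / (4 * real (Suc N))" if "N \<ge> 1" for N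
    using that
  proof (induction N rule: dec_induct)
    case (step N)
    have tel: "1 / (4 * x * (x + 1)) = 1 / (4 * x) - 1 / (4 * (x + 1))" if "x > 0" for x :: real
      using that by (simp add: field_simps)
    have e: "real (Suc (Suc N)) = real (Suc N) + 1" by simp
    have "1 / (real (2 * Suc N + 1))\<^sup>2 \<le> 1 / (4 * real (Suc N) * real (Suc (Suc N)))"
    proof (rule divide_left_mono)
      show "4 * real (Suc N) * real (Suc (Suc N)) \<le> (real (2 * Suc N + 1))\<^sup>2"
        by (simp add: power2_eq_square algebra_simps)
      show "0 < (real (2 * Suc N + 1))\<^sup>2 * (4 * real (Suc N) * real (Suc (Suc N)))"
        by (intro mult_pos_pos zero_less_power) auto
    qed simp
    also have "\<dots> = 1 / (4 * real (Suc N)) - 1 / (4 * real (Suc (Suc N)))"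
      unfolding e by (rule tel) simp
    finally show ?case using step by simp
  qed simp
  then show ?thesis
  proof (cases "N \<ge> 1")
    case True
    have "1 / (4 * real (Suc N)) \<ge> 0" by simp
    then show ?thesis using \<open>\<And>N. N \<ge> 1 \<Longrightarrow> _\<close>[OF True] by linarith
  qed simp
qed

text \<open>After interchanging the sums, each \<open>m = 2 * l + 1\<close> has about
  \<open>N / (6 m)\<close> multiples, with quotients of at most \<open>2 N / m\<close>. The inverse
  squares give the main term \<open>N^2/3 * 1/8\<close>, the rounding error 1 per \<open>m\<close>
  the logarithmic term.\<close>

lemma sum_aliquot_le:
  assumes N: "N \<ge> 1"
  shows "(\<Sum>d\<in>progression N. real (aliquot d)) \<le> (real N)\<^sup>2 / 24 + real N * ln (real N)"
proof -
  have "(\<Sum>d\<in>progression N. real (aliquot d)) \<le>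
      (\<Sum>d\<in>progression N. \<Sum>l \<in> {l \<in> {2..N}. (2 * l + 1) dvd d}. 2 * real N / real (2 * l + 1))"
  proof (rule sum_mono)
    fix d assume d: "d \<in> progression N"
    have "real (aliquot d) \<le> (\<Sum>l \<in> {l \<in> {2..N}. (2 * l + 1) dvd d}. real (d div (2 * l + 1)))"
      unfolding of_nat_sum[symmetric] of_nat_le_iff by (rule aliquot_le[OF d])
    also have "\<dots> \<le> (\<Sum>l \<in> {l \<in> {2..N}. (2 * l + 1) dvd d}. 2 * real N / real (2 * l + 1))"
    proof (rule sum_mono)
      fix l
      have "real (d div (2 * l + 1)) \<le> real d / real (2 * l + 1)" by (rule of_nat_div_le_of_nat)
      also have "\<dots> \<le> 2 * real N / real (2 * l + 1)" using d by (intro divide_right_mono) (auto simp: progression_def)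
      finally show "real (d div (2 * l + 1)) \<le> 2 * real N / real (2 * l + 1)" .
    qed
    finally show "real (aliquot d) \<le> (\<Sum>l \<in> {l \<in> {2..N}. (2 * l + 1) dvd d}. 2 * real N / real (2 * l + 1))" .
  qed
  also have "\<dots> = (\<Sum>d\<in>progression N. \<Sum>l=2..N. if (2 * l + 1) dvd d then 2 * real N / real (2 * l + 1) else 0)"
    by (rule sum.cong[OF refl], rule sum.inter_filter) simp
  also have "\<dots> = (\<Sum>l=2..N. \<Sum>d\<in>progression N. if (2 * l + 1) dvd d then 2 * real N / real (2 * l + 1) else 0)"
    by (rule sum.swap)
  also have "\<dots> = (\<Sum>l=2..N. real (card {d \<in> progression N. (2 * l + 1) dvd d}) * (2 * real N / real (2 * l + 1)))"
    by (rule sum.cong[OF refl], subst sum.inter_filter[OF finite_progression, symmetric]) simp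
  also have "\<dots> \<le> (\<Sum>l=2..N. (real N / (6 * real (2 * l + 1)) + 1) * (2 * real N / real (2 * l + 1)))"
    using N by (intro sum_mono mult_right_mono card_multiples_in_progression) auto
  also have "\<dots> = (\<Sum>l=2..N. (real N)\<^sup>2 / 3 * (1 / (real (2 * l + 1))\<^sup>2) + real N * (2 / real (2 * l + 1)))"
  proof (rule sum.cong[OF refl])
    fix l :: nat
    have gen: "(n / (6 * c) + 1) * (2 * n / c) = n\<^sup>2 / 3 * (1 / c\<^sup>2) + n * (2 / c)" for n c :: real
      by (simp add: distrib_right add_divide_distrib power2_eq_square)
    show "(real N / (6 * real (2 * l + 1)) + 1) * (2 * real N / real (2 * l + 1)) =
        (real N)\<^sup>2 / 3 * (1 / (real (2 * l + 1))\<^sup>2) + real N * (2 / real (2 * l + 1))"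
      by (rule gen)
  qed
  also have "\<dots> = (real N)\<^sup>2 / 3 * (\<Sum>l=2..N. 1 / (real (2 * l + 1))\<^sup>2) + real N * (\<Sum>l=2..N. 2 / real (2 * l + 1))"
    by (simp only: sum.distrib sum_distrib_left)
  also have "\<dots> \<le> (real N)\<^sup>2 / 3 * (1 / 8) + real N * ln (real N)"
  proof (intro add_mono mult_left_mono sum_inverse_odd_squares_le)
    have "(\<Sum>l=2..N. 2 / real (2 * l + 1)) \<le> (\<Sum>l=2..N. 1 / real l)"
    proof (rule sum_mono)
      fix l assume "l \<in> {2..N}"
      then show "2 / real (2 * l + 1) \<le> 1 / real l" by (simp add: divide_simps)
    qed
    also have "{1..N} = insert 1 {2..N}" using N by auto
    then have "(\<Sum>l=2..N. 1 / real l) = (\<Sum>l=1..N. 1 / real l) - 1" by simp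
    also have "\<dots> \<le> ln (real N)" using sum_inverse_le_ln[OF N] by simp
    finally show "(\<Sum>l=2..N. 2 / real (2 * l + 1)) \<le> ln (real N)" .
  qed auto
  finally show ?thesis by simp
qed

lemma card_progression_ge: "N \<le> 6 * card (progression N) + 6"
proof (cases "N = 0")
  case False
  let ?J = "{N div 6 + 1..(2 * N - 1) div 6}"
  have bounds: "N < 6 * (N div 6) + 6" "6 * ((2 * N - 1) div 6) + 1 \<le> 2 * N"
      "6 * (N div 6) \<le> N" "2 * N < 6 * ((2 * N - 1) div 6) + 7"
    using dividend_less_times_div[of 6 N] times_div_less_eq_dividend[of 6 "2 * N - 1"]
      dividend_less_times_div[of 6 "2 * N - 1"] False by auto
  have "(\<lambda>j. 6 * j + 1) ` ?J \<subseteq> progression N"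
  proof
    fix x assume "x \<in> (\<lambda>j. 6 * j + 1) ` ?J"
    then obtain j where j: "x = 6 * j + 1" "N div 6 + 1 \<le> j" "j \<le> (2 * N - 1) div 6" by auto
    have "N < 6 * j + 1" using j(2) bounds(1) by linarith
    moreover have "6 * j + 1 \<le> 2 * N" using j(3) bounds(2) by linarith
    moreover have "(6 * j + 1) mod 6 = 1" by simp
    ultimately show "x \<in> progression N" unfolding progression_def j(1) by simp
  qed
  then have "card ((\<lambda>j. 6 * j + 1) ` ?J) \<le> card (progression N)" by (rule card_mono[OF finite_progression])
  also have "card ((\<lambda>j. 6 * j + 1) ` ?J) = card ?J" by (rule card_image) (auto simp: inj_on_def)
  finally have "(2 * N - 1) div 6 \<le> card (progression N) + N div 6" by simp
  then show ?thesis using bounds(3,4) by linarith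
qed simp

section \<open>Lower bounds for the exponent of decay\<close>

text \<open>If \<open>N/8\<close> indices had a large gcd, these gcds would multiply to about
  \<open>q^(N^2/16)\<close>, of which overlaps explain at most about \<open>q^(N^2/24)\<close>. The
  gap \<open>1/16 - 1/24 = 1/48\<close> is split evenly: 1/96 for \<open>ln k\<close>, 1/96 for the
  lower order terms.\<close>

lemma block_lower_bound:
  fixes q k N :: nat and t :: "nat \<Rightarrow> real"
  assumes q: "q > 1" and k: "k > 0"
    and t1: "\<And>d. d \<ge> 1 \<Longrightarrow> t d \<le> 1"
    and t2: "\<And>d. d \<ge> 1 \<Longrightarrow> t d \<le> 2 * real (gcd k (q ^ d - 1)) / sqrt (real (q ^ d))"
    and N: "N \<ge> 48" "ln 4 \<le> real N / 2 * ln (real q)"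
      "real N * ln 4 / 8 + ln (real q) * (real N * ln (real N)) \<le> ln (real q) * (real N)\<^sup>2 / 96"
    and lnk: "ln (real k) < ln (real q) * (real N)\<^sup>2 / 96"
  shows "1 / 192 \<le> (\<Sum>d\<in>{N<..2 * N}. (1 - t d) / real d)"
proof -
  \<comment> \<open>Exactly the threshold at which the second bound on \<open>t\<close> still gives
    \<open>t d \<le> 1/2\<close> outside \<open>Bad\<close>.\<close>
  define Bad where "Bad = {d \<in> progression N. sqrt (real (q ^ d)) < 4 * real (gcd k (q ^ d - 1))}"
  have BadP: "Bad \<subseteq> progression N" by (auto simp: Bad_def)
  have finB: "finite Bad" by (rule finite_subset[OF BadP finite_progression])
  have dN: "N < d" "d \<le> 2 * N" if "d \<in> progression N" for d using that by (auto simp: progression_def)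
  have lq: "ln (real q) > 0" using q by simp
  have g0: "gcd k (q ^ d - 1) > 0" for d using k by simp
  have "real (card Bad) < real N / 8"
  proof (rule ccontr)
    assume "\<not> ?thesis"
    then have cB: "real N / 8 \<le> real (card Bad)" by simp
    have le: "(\<Prod>d\<in>Bad. gcd k (q ^ d - 1)) \<le> k * (\<Prod>d\<in>Bad. q ^ aliquot d)"
    proof (rule prod_gcd_power_minus_one_le[OF q k finB])
      fix d e assume de: "d \<in> Bad" "e \<in> Bad" "d \<noteq> e"
      then have "N < d" "d \<le> 2 * N" "N < e" "e \<le> 2 * N" using dN BadP by auto
      show "\<not> d dvd e"
      proof
        assume "d dvd e"
        then obtain c where c: "e = d * c" ..
        have "c \<noteq> 1" using c de(3) by auto
        moreover have "c \<noteq> 0" by (rule notI) (use c \<open>N < e\<close> in simp)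
        ultimately have "2 \<le> c" by simp
        then have "d * 2 \<le> e" unfolding c by (rule mult_le_mono2)
        then show False using \<open>N < d\<close> \<open>e \<le> 2 * N\<close> by simp
      qed
    qed (use dN BadP in force)
    have pp: "0 < (\<Prod>d\<in>Bad. real q ^ aliquot d)" using q by (intro prod_pos) auto
    have "real (\<Prod>d\<in>Bad. gcd k (q ^ d - 1)) \<le> real (k * (\<Prod>d\<in>Bad. q ^ aliquot d))"
      using le by (simp only: of_nat_le_iff)
    then have "ln (real (\<Prod>d\<in>Bad. gcd k (q ^ d - 1))) \<le> ln (real (k * (\<Prod>d\<in>Bad. q ^ aliquot d)))"
    proof (subst ln_le_cancel_iff)
      show "0 < real (\<Prod>d\<in>Bad. gcd k (q ^ d - 1))" unfolding of_nat_0_less_iff by (intro prod_pos g0)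
      show "0 < real (k * (\<Prod>d\<in>Bad. q ^ aliquot d))" using pp k by simp
    qed
    moreover have "ln (real (\<Prod>d\<in>Bad. gcd k (q ^ d - 1))) = (\<Sum>d\<in>Bad. ln (real (gcd k (q ^ d - 1))))"
      unfolding of_nat_prod using k by (intro ln_prod finB) auto
    moreover have "ln (real (k * (\<Prod>d\<in>Bad. q ^ aliquot d))) = ln (real k) + (\<Sum>d\<in>Bad. real (aliquot d) * ln (real q))"
    proof -
      have "ln (real (k * (\<Prod>d\<in>Bad. q ^ aliquot d))) = ln (real k) + ln (\<Prod>d\<in>Bad. real q ^ aliquot d)"
        using k pp by (simp add: ln_mult)
      also have "ln (\<Prod>d\<in>Bad. real q ^ aliquot d) = (\<Sum>d\<in>Bad. ln (real q ^ aliquot d))"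
        using q by (intro ln_prod finB) auto
      also have "\<dots> = (\<Sum>d\<in>Bad. real (aliquot d) * ln (real q))" using q by (simp add: ln_realpow)
      finally show ?thesis .
    qed
    ultimately have up: "(\<Sum>d\<in>Bad. ln (real (gcd k (q ^ d - 1)))) \<le> ln (real k) + (\<Sum>d\<in>Bad. real (aliquot d)) * ln (real q)"
      by (simp add: sum_distrib_right)
    have al: "(\<Sum>d\<in>Bad. real (aliquot d)) \<le> (real N)\<^sup>2 / 24 + real N * ln (real N)"
    proof -
      have "(\<Sum>d\<in>Bad. real (aliquot d)) \<le> (\<Sum>d\<in>progression N. real (aliquot d))"
        by (rule sum_mono2[OF finite_progression BadP]) auto
      also have "\<dots> \<le> (real N)\<^sup>2 / 24 + real N * ln (real N)" using N(1) by (intro sum_aliquot_le) simp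
      finally show ?thesis .
    qed
    let ?c = "real N / 2 * ln (real q) - ln 4"
    have c0: "?c \<ge> 0" using N(2) by simp
    have each: "?c \<le> ln (real (gcd k (q ^ d - 1)))" if d: "d \<in> Bad" for d
    proof -
      have "real N \<le> real d" using dN[of d] BadP d by auto
      then have "real N / 2 * ln (real q) \<le> real d / 2 * ln (real q)" using lq by (intro mult_right_mono) auto
      also have "\<dots> = ln (sqrt (real (q ^ d)))" using q by (simp add: ln_sqrt ln_realpow)
      also have "\<dots> \<le> ln (4 * real (gcd k (q ^ d - 1)))"
        using d q k by (subst ln_le_cancel_iff) (auto simp: Bad_def)
      also have "\<dots> = ln 4 + ln (real (gcd k (q ^ d - 1)))" using k by (subst ln_mult) auto
      finally show ?thesis by simp
    qed
    have "real N / 8 * ?c \<le> real (card Bad) * ?c" using cB c0 by (rule mult_right_mono)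
    also have "\<dots> \<le> (\<Sum>d\<in>Bad. ln (real (gcd k (q ^ d - 1))))"
      using sum_mono[of Bad "\<lambda>_. ?c" "\<lambda>d. ln (real (gcd k (q ^ d - 1)))"] each by simp
    also note up
    also have "ln (real k) + (\<Sum>d\<in>Bad. real (aliquot d)) * ln (real q) <
        ln (real q) * (real N)\<^sup>2 / 96 + ((real N)\<^sup>2 / 24 + real N * ln (real N)) * ln (real q)"
      using lnk al lq by (intro add_less_le_mono mult_right_mono) auto
    finally have "real N / 8 * ?c < ln (real q) * (real N)\<^sup>2 / 96 + ((real N)\<^sup>2 / 24 + real N * ln (real N)) * ln (real q)" .
    moreover have "real N / 8 * ?c = ln (real q) * (real N)\<^sup>2 / 16 - real N * ln 4 / 8"
      by (simp add: power2_eq_square algebra_simps)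
    moreover have "((real N)\<^sup>2 / 24 + real N * ln (real N)) * ln (real q) =
        ln (real q) * (real N)\<^sup>2 / 24 + ln (real q) * (real N * ln (real N))" by (simp add: algebra_simps)
    ultimately show False using N(3) by linarith
  qed
  moreover have "card (progression N - Bad) = card (progression N) - card Bad"
    by (rule card_Diff_subset[OF finB BadP])
  moreover have "card Bad \<le> card (progression N)" by (rule card_mono[OF finite_progression BadP])
  moreover have "real N \<le> 6 * real (card (progression N)) + 6" using card_progression_ge[of N] by linarith
  ultimately have cG: "real N / 48 \<le> real (card (progression N - Bad))" using N(1) by (simp add: of_nat_diff)
  \<comment> \<open>At least \<open>N/6 - 1 - N/8\<close> indices are good, which is no less than
    \<open>N/48\<close> once \<open>N \<ge> 48\<close>; each contributes at least
    \<open>(1/2) / (2 N)\<close>.\<close>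
  have "1 / 192 = real N / 48 * (1 / (4 * real N))" using N(1) by simp
  also have "\<dots> \<le> real (card (progression N - Bad)) * (1 / (4 * real N))" using cG by (intro mult_right_mono) auto
  also have "\<dots> = (\<Sum>d\<in>progression N - Bad. 1 / (4 * real N))" by simp
  also have "\<dots> \<le> (\<Sum>d\<in>progression N - Bad. (1 - t d) / real d)"
  proof (rule sum_mono)
    fix d assume d: "d \<in> progression N - Bad"
    then have d': "N < d" "d \<le> 2 * N" "4 * real (gcd k (q ^ d - 1)) \<le> sqrt (real (q ^ d))"
      using dN[of d] by (auto simp: Bad_def)
    have "sqrt (real (q ^ d)) > 0" using q by simp
    then have "2 * real (gcd k (q ^ d - 1)) / sqrt (real (q ^ d)) \<le> 1 / 2"
      using d'(3) by (subst pos_divide_le_eq) linarith+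
    then have "t d \<le> 1 / 2" using t2[of d] d'(1) by linarith
    then have "1 / 2 \<le> 1 - t d" by simp
    have "1 / (4 * real N) = (1 / 2) / (2 * real N)" by simp
    also have "\<dots> \<le> (1 / 2) / real d" using d' by (intro divide_left_mono) auto
    also have "\<dots> \<le> (1 - t d) / real d" using \<open>1 / 2 \<le> 1 - t d\<close> by (intro divide_right_mono) auto
    finally show "1 / (4 * real N) \<le> (1 - t d) / real d" .
  qed
  also have "\<dots> \<le> (\<Sum>d\<in>{N<..2 * N}. (1 - t d) / real d)"
    by (rule sum_mono2) (use t1 in \<open>auto simp: progression_def\<close>)
  finally show ?thesis .
qed

text \<open>Rounding down keeps the dyadic intervals disjoint but may leave gaps, whose nonnegative
  terms are discarded.\<close>

lemma dyadic_lower_bound: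
  fixes t :: "nat \<Rightarrow> real"
  assumes t1: "\<And>d. d \<ge> 1 \<Longrightarrow> t d \<le> 1"
    and block: "\<And>i. i \<in> {1..T} \<Longrightarrow> c \<le> (\<Sum>d\<in>{n div 2 ^ i<..2 * (n div 2 ^ i)}. (1 - t d) / real d)"
  shows "real T * c \<le> (\<Sum>d\<in>{n div 2 ^ T<..n}. (1 - t d) / real d)"
  using block
proof (induction T)
  case (Suc T)
  let ?f = "\<lambda>d. (1 - t d) / real d" and ?M = "n div 2 ^ T" and ?M' = "n div 2 ^ Suc T"
  have M: "2 * ?M' \<le> ?M" by (simp add: div_mult2_eq mult.commute[of 2])
  have nn: "?f d \<ge> 0" if "d \<ge> 1" for d using t1[OF that] by simp
  have "c \<le> (\<Sum>d\<in>{?M'<..2 * ?M'}. ?f d)" by (rule Suc.prems) simp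
  also have "\<dots> \<le> (\<Sum>d\<in>{?M'<..?M}. ?f d)" by (rule sum_mono2) (use M nn in auto)
  finally have "real (Suc T) * c \<le> (\<Sum>d\<in>{?M'<..?M}. ?f d) + (\<Sum>d\<in>{?M<..n}. ?f d)"
    using Suc.IH Suc.prems by (simp add: algebra_simps)
  also have "\<dots> = (\<Sum>d\<in>{?M'<..?M} \<union> {?M<..n}. ?f d)" by (rule sum.union_disjoint[symmetric]) auto
  also have "{?M'<..?M} \<union> {?M<..n} = {?M'<..n}"
  proof -
    have "?M' \<le> ?M" using M by linarith
    moreover have "?M \<le> n" by (rule div_le_dividend)
    ultimately show ?thesis by (rule ivl_disj_un_two(6))
  qed
  finally show ?case .
qed simp

lemma sum_defect_unbounded:
  fixes k :: "nat \<Rightarrow> nat" and t :: "nat \<Rightarrow> nat \<Rightarrow> real" and q :: nat and C :: real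
  assumes q: "q > 1" and k: "\<And>n. n \<ge> 1 \<Longrightarrow> k n \<ge> 1"
    and lnk: "(\<lambda>n. ln (real (k n))) \<in> o(\<lambda>n. (real n)\<^sup>2)"
    and t1: "\<And>n d. d \<ge> 1 \<Longrightarrow> t n d \<le> 1"
    and t2: "\<And>n d. n \<ge> 1 \<Longrightarrow> d \<ge> 1 \<Longrightarrow> t n d \<le> 2 * real (gcd (k n) (q ^ d - 1)) / sqrt (real (q ^ d))"
  shows "eventually (\<lambda>n. C \<le> (\<Sum>d=1..n. (1 - t n d) / real d)) at_top"
proof -
  define L where "L = ln (real q)"
  have L: "L > 0" using q by (simp add: L_def)
  have "eventually (\<lambda>N. N \<ge> 48 \<and> ln 4 \<le> real N / 2 * L \<and>
      real N * ln 4 / 8 + L * (real N * ln (real N)) \<le> L * (real N)\<^sup>2 / 96) at_top"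
  proof (intro eventually_conj eventually_ge_at_top)
    show "eventually (\<lambda>N. ln 4 \<le> real N / 2 * L) at_top" using L by real_asymp
    show "eventually (\<lambda>N. real N * ln 4 / 8 + L * (real N * ln (real N)) \<le> L * (real N)\<^sup>2 / 96) at_top"
      using L by real_asymp
  qed
  then obtain N0 where N0: "\<And>N. N \<ge> N0 \<Longrightarrow> N \<ge> 48 \<and> ln 4 \<le> real N / 2 * L \<and>
      real N * ln 4 / 8 + L * (real N * ln (real N)) \<le> L * (real N)\<^sup>2 / 96"
    unfolding eventually_at_top_linorder by blast
  \<comment> \<open>Each dyadic interval yields 1/192, so \<open>T\<close> of them reach
    \<open>C\<close>.\<close>
  define T where "T = nat \<lceil>192 * C\<rceil>"
  have T: "C \<le> real T * (1 / 192)" unfolding T_def by linarith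
  \<comment> \<open>All \<open>T\<close> starting points \<open>N\<close> satisfy
    \<open>n \<le> 2 * 2 ^ T * N\<close>, so \<open>c * n^2\<close> is at most half of the allowed
    \<open>L * N^2 / 96\<close>; the half makes the inequality strict.\<close>
  define c where "c = L / (96 * (2 * 2 ^ T)\<^sup>2) / 2"
  have c: "c > 0" using L by (simp add: c_def)
  have ev1: "eventually (\<lambda>n. norm (ln (real (k n))) \<le> c * norm ((real n)\<^sup>2)) at_top"
    using landau_o.smallD[OF lnk c] .
  have ev2: "eventually (\<lambda>n. n \<ge> 2 ^ T * (N0 + 2)) at_top" by (rule eventually_ge_at_top)
  show ?thesis using ev1 ev2
  proof eventually_elim
    case (elim n)
    have "1 \<le> 2 ^ T * (N0 + 2)" by (simp add: Suc_le_eq)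
    then have n1: "n \<ge> 1" using elim(2) by (rule le_trans)
    have "1 / 192 \<le> (\<Sum>d\<in>{n div 2 ^ i<..2 * (n div 2 ^ i)}. (1 - t n d) / real d)" if i: "i \<in> {1..T}" for i
    proof -
      let ?N = "n div 2 ^ i"
      have pw: "(2::nat) ^ i \<le> 2 ^ T" using i by (intro power_increasing) auto
      have "2 ^ i * (N0 + 2) \<le> n" using pw elim(2) by (meson le_trans mult_le_mono1)
      then have NN: "N0 + 2 \<le> ?N" by (simp add: less_eq_div_iff_mult_less_eq mult.commute)
      have "n < 2 ^ i * (?N + 1)" by (simp add: dividend_less_times_div)
      also have "\<dots> \<le> 2 ^ T * (2 * ?N)" using pw NN by (intro mult_le_mono) auto
      finally have "real n < real (2 ^ T * (2 * ?N))" by (simp only: of_nat_less_iff)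
      then have nN: "real n \<le> 2 * 2 ^ T * real ?N" by simp
      have "ln (real (k n)) \<le> c * (real n)\<^sup>2" using elim(1) by simp
      also have "\<dots> \<le> c * (2 * 2 ^ T * real ?N)\<^sup>2" using nN c by (intro mult_left_mono power_mono) auto
      also have "\<dots> = L * (real ?N)\<^sup>2 / 96 / 2" by (simp add: c_def power_mult_distrib)
      also have "\<dots> < L * (real ?N)\<^sup>2 / 96"
      proof -
        have "0 < L * (real ?N)\<^sup>2 / 96" using L NN by simp
        then show ?thesis by linarith
      qed
      finally have lk: "ln (real (k n)) < L * (real ?N)\<^sup>2 / 96" .
      have "N0 \<le> ?N" using NN by simp
      from N0[OF this] have N: "?N \<ge> 48" "ln 4 \<le> real ?N / 2 * L"
        "real ?N * ln 4 / 8 + L * (real ?N * ln (real ?N)) \<le> L * (real ?N)\<^sup>2 / 96" by blast+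
      have kn: "k n > 0" using k[OF n1] by simp
      show ?thesis by (rule block_lower_bound[OF q kn t1 t2[OF n1] N[unfolded L_def] lk[unfolded L_def]])
    qed
    then have "real T * (1 / 192) \<le> (\<Sum>d\<in>{n div 2 ^ T<..n}. (1 - t n d) / real d)"
      using t1 by (intro dyadic_lower_bound) auto
    also have "\<dots> \<le> (\<Sum>d=1..n. (1 - t n d) / real d)"
      by (rule sum_mono2) (use t1 in auto)
    finally show ?case using T by linarith
  qed
qed

subsection \<open>Equidistribution\<close>

definition trace_avg :: "('a::{finite,field} \<Rightarrow> complex) \<Rightarrow> nat \<Rightarrow> nat \<Rightarrow> complex" where
  "trace_avg \<psi> k n = (\<Sum>g\<in>GL n. \<psi> (mat_trace (g ^\<^sub>m k))) / of_nat (card (GL n :: 'a mat set))"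

lemma card_GL_pos: "card (GL n :: 'a::{finite,field} mat set) > 0"
  using finite_GL GL_nonempty card_gt_0_iff by blast

lemma trace_avg_q_recursion:
  fixes \<psi> :: "'a::{finite,field} \<Rightarrow> complex"
  assumes \<psi>: "additive_char \<psi>"
  shows "of_nat (CARD('a) ^ n) * trace_avg \<psi> k n =
    (\<Sum>j\<le>n. (\<Sum>p\<in>monic_unit_polys j. root_char \<psi> k p) * trace_avg \<psi> k (n - j))"
proof -
  have "of_nat (CARD('a) ^ n) * (\<Sum>g\<in>GL n. \<psi> (mat_trace (g ^\<^sub>m k))) / of_nat (card (GL n :: 'a mat set)) =
    (\<Sum>j\<le>n. (\<Sum>C\<in>companions j. \<psi> (mat_trace (C ^\<^sub>m k))) * ((\<Sum>G\<in>GL (n - j). \<psi> (mat_trace (G ^\<^sub>m k))) / of_nat (card (GL (n - j) :: 'a mat set))))"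
  proof (rule sum_GL_recursion)
    fix M b :: "'a mat" assume "M \<in> GL n" "b \<in> GL n"
    then show "\<psi> (mat_trace ((M * (b * GL_inv n M)) ^\<^sub>m k)) = \<psi> (mat_trace (b ^\<^sub>m k))"
      using mat_trace_pow_similar[OF GL_conj_similar] GL_carrier by metis
  next
    fix j and C D G :: "'a mat" assume *: "j \<le> n" "C \<in> GL j" "D \<in> carrier_mat j (n - j)" "G \<in> GL (n - j)"
    then show "\<psi> (mat_trace ((four_block_mat C D (0\<^sub>m (n - j) j) G) ^\<^sub>m k)) = \<psi> (mat_trace (C ^\<^sub>m k)) * \<psi> (mat_trace (G ^\<^sub>m k))"
      using mat_trace_pow_four_block[OF GL_carrier[OF *(2)] *(3) GL_carrier[OF *(4)], of k] additive_char_add[OF \<psi>] by simp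
  qed
  then show ?thesis unfolding trace_avg_def sum_companions root_char_def by simp
qed

lemma trace_avg_recursion:
  fixes \<psi> :: "'a::{finite,field} \<Rightarrow> complex"
  assumes \<psi>: "additive_char \<psi>"
  shows "of_nat n * trace_avg \<psi> k n =
    (\<Sum>i=1..n. char_sum \<psi> k i / of_nat (CARD('a) ^ i - 1) * trace_avg \<psi> k (n - i))"
proof (rule q_recursion_solution[where A = "\<lambda>j. \<Sum>p\<in>monic_unit_polys j. root_char \<psi> k p"])
  show "1 < CARD('a)" using CARD_ge_2[where 'a = 'a] by simp
  have "(monic_unit_polys 0 :: 'a poly set) = {1}"
    by (auto simp: monic_unit_polys_def intro: monic_degree_0[THEN iffD1])
  then show "(\<Sum>p\<in>monic_unit_polys 0. root_char \<psi> k p) = 1"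
    using additive_char_0[OF \<psi>] by (simp add: root_char_def root_power_sum_def)
qed (rule trace_avg_q_recursion[OF \<psi>], rule root_char_sum_recursion[OF additive_char_add[OF \<psi>]])

lemma trace_avg_0:
  fixes \<psi> :: "'a::{finite,field} \<Rightarrow> complex"
  assumes \<psi>: "additive_char \<psi>"
  shows "trace_avg \<psi> k 0 = 1"
proof -
  have "\<psi> (mat_trace (g ^\<^sub>m k)) = 1" if "g \<in> GL 0" for g
    using GL_carrier[OF that] additive_char_0[OF \<psi>] by (simp add: mat_trace_def)
  then show ?thesis unfolding trace_avg_def using card_GL_pos[of 0, where 'a = 'a] by simp
qed

text \<open>The factor 2 pays for replacing \<open>q^i - 1\<close> by \<open>q^i\<close> in the
  denominator.\<close>

lemma norm_char_sum_ratio: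
  fixes \<psi> :: "'a::{finite,field} \<Rightarrow> complex"
  assumes \<psi>: "additive_char \<psi>" and i: "i \<ge> 1"
  shows "norm (char_sum \<psi> k i / of_nat (CARD('a) ^ i - 1)) \<le> 1"
    and "\<psi> b \<noteq> 1 \<Longrightarrow> k \<ge> 1 \<Longrightarrow> norm (char_sum \<psi> k i / of_nat (CARD('a) ^ i - 1)) \<le>
      2 * real (gcd k (CARD('a) ^ i - 1)) / sqrt (real (CARD('a) ^ i))"
proof -
  let ?Q = "CARD('a) ^ i"
  have "1 < CARD('a)" using CARD_ge_2[where 'a = 'a] by simp
  then have Q: "1 < ?Q" using i by (intro one_less_power) auto
  have Q1: "0 < real (?Q - 1)" using Q by (simp only: of_nat_0_less_iff zero_less_diff)
  have Q2: "0 < real ?Q / 2" using Q by simp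
  have i0: "i > 0" using i by simp
  have n: "norm (char_sum \<psi> k i / of_nat (?Q - 1)) = norm (char_sum \<psi> k i) / real (?Q - 1)"
    by (simp only: norm_divide norm_of_nat)
  show "norm (char_sum \<psi> k i / of_nat (?Q - 1)) \<le> 1"
    unfolding n using char_sum_trivial_bound[OF i0 \<psi>, of k] Q1 by (simp only: divide_le_eq_1_pos)
  assume b: "\<psi> b \<noteq> 1" and k: "k \<ge> 1"
  let ?m = "card {z \<in> ext_field i - {0 :: 'a alg_closure}. z ^ k = 1}" and ?g = "gcd k (?Q - 1)"
  have "?m \<le> ?g" using card_roots_of_unity_le[OF i0, of k, where 'a = 'a] k by simp
  then have mg: "real ?m \<le> real ?g" by simp
  have "norm (char_sum \<psi> k i) \<le> sqrt ((real ?m)\<^sup>2 * real ?Q)"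
    using char_sum_bound[OF i0 \<psi> b, of k] by (rule real_le_rsqrt)
  also have "\<dots> = real ?m * sqrt (real ?Q)" by (simp add: real_sqrt_mult)
  also have "\<dots> \<le> real ?g * sqrt (real ?Q)" using mg by (rule mult_right_mono) simp
  finally have "norm (char_sum \<psi> k i) / real (?Q - 1) \<le> real ?g * sqrt (real ?Q) / real (?Q - 1)"
    by (rule divide_right_mono) simp
  also have "\<dots> \<le> real ?g * sqrt (real ?Q) / (real ?Q / 2)"
  proof (rule divide_left_mono)
    have "?Q \<le> 2 * (?Q - 1)" using Q by linarith
    then have "real ?Q \<le> 2 * real (?Q - 1)" by (metis of_nat_le_iff of_nat_mult of_nat_numeral)
    then show "real ?Q / 2 \<le> real (?Q - 1)" by linarith
    show "0 < real (?Q - 1) * (real ?Q / 2)" using Q1 Q2 by (rule mult_pos_pos)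
  qed simp
  also have "\<dots> = 2 * real ?g * (sqrt (real ?Q) / real ?Q)" by simp
  also have "sqrt (real ?Q) / real ?Q = 1 / sqrt (real ?Q)"
    using real_div_sqrt[of "real ?Q"] Q by (simp add: field_simps)
  finally show "norm (char_sum \<psi> k i / of_nat (?Q - 1)) \<le> 2 * real ?g / sqrt (real ?Q)" unfolding n by simp
qed

lemma trace_avg_tendsto_0:
  fixes \<psi> :: "'a::{finite,field} \<Rightarrow> complex" and k :: "nat \<Rightarrow> nat"
  assumes \<psi>: "additive_char \<psi>" "\<psi> b \<noteq> 1"
    and k: "\<And>n. n \<ge> 1 \<Longrightarrow> k n \<ge> 1" and lnk: "(\<lambda>n. ln (real (k n))) \<in> o(\<lambda>n. (real n)\<^sup>2)"
  shows "(\<lambda>n. trace_avg \<psi> (k n) n) \<longlonglongrightarrow> 0"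
proof (rule tendstoI)
  fix \<epsilon> :: real assume \<epsilon>: "\<epsilon> > 0"
  let ?s = "\<lambda>n i. char_sum \<psi> (k n) i / of_nat (CARD('a) ^ i - 1)"
  \<comment> \<open>Chosen so that \<open>exp 1 * exp (- C)\<close> equals
    \<open>\<epsilon> / e\<close>.\<close>
  define C where "C = 2 - ln \<epsilon>"
  have "1 < CARD('a)" using CARD_ge_2[where 'a = 'a] by simp
  then have "eventually (\<lambda>n. C \<le> (\<Sum>d=1..n. (1 - norm (?s n d)) / real d)) at_top"
  proof (rule sum_defect_unbounded[OF _ k lnk])
    show "norm (?s n d) \<le> 1" if "d \<ge> 1" for n d by (rule norm_char_sum_ratio(1)[OF \<psi>(1) that])
    show "norm (?s n d) \<le> 2 * real (gcd (k n) (CARD('a) ^ d - 1)) / sqrt (real (CARD('a) ^ d))"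
      if "n \<ge> 1" "d \<ge> 1" for n d by (rule norm_char_sum_ratio(2)[OF \<psi>(1) that(2) \<psi>(2) k[OF that(1)]])
  qed
  moreover have "eventually (\<lambda>n :: nat. n \<ge> 1) at_top" by (rule eventually_ge_at_top)
  ultimately show "eventually (\<lambda>n. dist (trace_avg \<psi> (k n) n) 0 < \<epsilon>) sequentially"
  proof eventually_elim
    case (elim n)
    have "norm (trace_avg \<psi> (k n) n) \<le> exp 1 * exp (- (\<Sum>i=1..n. (1 - norm (?s n i)) / real i))"
      by (rule log_recursion_bound[OF trace_avg_0[OF \<psi>(1)] trace_avg_recursion[OF \<psi>(1)] norm_char_sum_ratio(1)[OF \<psi>(1)] elim(2)])
    also have "\<dots> \<le> exp 1 * exp (- C)" using elim(1) by simp
    also have "\<dots> = exp (ln \<epsilon> + - 1)" by (simp add: C_def flip: exp_add)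
    also have "\<dots> = \<epsilon> * exp (- 1)" using \<epsilon> by (simp only: exp_add exp_ln)
    also have "\<dots> < \<epsilon>" using \<epsilon> by simp
    finally show ?case by simp
  qed
qed

text \<open>Let \<open>H\<close> be a maximal proper subgroup, \<open>y \<notin> H\<close> and \<open>m\<close> the order of \<open>y\<close> modulo \<open>H\<close>. Every
  element is \<open>h + a y\<close> with \<open>h \<in> H\<close>, and \<open>h + a y \<mapsto> exp (2\<pi>i a / m)\<close> is the character.\<close>

lemma exists_nontrivial_additive_char:
  "\<exists>\<psi> :: 'a::{finite,field} \<Rightarrow> complex. additive_char \<psi> \<and> (\<exists>b. \<psi> b \<noteq> 1)"
proof -
  define sub where "sub H \<longleftrightarrow> 0 \<in> H \<and> (\<forall>x\<in>H. \<forall>y\<in>H. x - y \<in> H)" for H :: "'a set"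
  have subdiff: "x - y \<in> H" if "sub H" "x \<in> H" "y \<in> H" for H x y
    using that unfolding sub_def by blast
  have subadd: "x + y \<in> H" if "sub H" "x \<in> H" "y \<in> H" for H x y
  proof -
    have "0 \<in> H" using that(1) unfolding sub_def by blast
    then have "x - (0 - y) \<in> H" using that by (intro subdiff)
    then show ?thesis by simp
  qed
  have "(1 :: 'a) \<notin> {0}" by simp
  then have "{0} \<noteq> (UNIV :: 'a set)" by blast
  moreover have "sub {0}" by (simp add: sub_def)
  ultimately have P0: "sub {0} \<and> {0} \<noteq> (UNIV :: 'a set)" by blast
  have bd: "\<forall>H. sub H \<and> H \<noteq> UNIV \<longrightarrow> card H < Suc CARD('a)"
    by (intro allI impI le_imp_less_Suc card_mono) auto
  have "\<exists>H. (sub H \<and> H \<noteq> UNIV) \<and> (\<forall>H'. sub H' \<and> H' \<noteq> UNIV \<longrightarrow> card H' \<le> card H)"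
    by (rule ex_has_greatest_nat[OF P0 bd])
  then obtain H where H: "sub H" "H \<noteq> UNIV" and max: "\<And>H'. sub H' \<Longrightarrow> H' \<noteq> UNIV \<Longrightarrow> card H' \<le> card H"
    by blast
  have H0: "0 \<in> H" using H(1) unfolding sub_def by blast
  obtain y where y: "y \<notin> H" using H(2) by blast
  have mul: "of_int a * x \<in> H" if "x \<in> H" for a x
  proof -
    have n: "of_nat n * x \<in> H" for n
    proof (induction n)
      case (Suc n)
      have "of_nat n * x + x \<in> H" by (rule subadd[OF H(1) Suc that])
      then show ?case by (simp add: algebra_simps)
    qed (simp add: H0)
    show ?thesis
    proof (cases a rule: int_cases2)
      case (nonneg n)
      then show ?thesis using n[of n] by simp
    next
      case (nonpos n)
      have "0 - of_nat n * x \<in> H" by (rule subdiff[OF H(1) H0 n])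
      then show ?thesis using nonpos by simp
    qed
  qed
  \<comment> \<open>The subgroup generated by \<open>H\<close> and \<open>y\<close>; it has more
    elements than \<open>H\<close>, so it is the whole field.\<close>
  let ?H' = "{x. \<exists>a. x - of_int a * y \<in> H}"
  have "sub ?H'"
    unfolding sub_def
  proof (intro conjI ballI)
    have "0 - of_int 0 * y \<in> H" using H0 by simp
    then show "0 \<in> ?H'" by blast
    fix u v assume "u \<in> ?H'" "v \<in> ?H'"
    then obtain a b where "u - of_int a * y \<in> H" "v - of_int b * y \<in> H" by blast
    then have "(u - of_int a * y) - (v - of_int b * y) \<in> H" by (rule subdiff[OF H(1)])
    then have "(u - v) - of_int (a - b) * y \<in> H" by (simp add: algebra_simps)
    then show "u - v \<in> ?H'" by blast
  qed
  moreover have "H \<subset> ?H'"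
  proof
    show "H \<subseteq> ?H'"
    proof
      fix x assume "x \<in> H"
      then have "x - of_int 0 * y \<in> H" by simp
      then show "x \<in> ?H'" by blast
    qed
    have "y - of_int 1 * y \<in> H" using H0 by simp
    then have "y \<in> ?H'" by blast
    then show "H \<noteq> ?H'" using y by blast
  qed
  then have "card H < card ?H'" by (intro psubset_card_mono) auto
  ultimately have U: "?H' = UNIV" using max[of ?H'] by linarith
  let ?P = "\<lambda>m :: nat. m > 0 \<and> of_nat m * y \<in> H"
  define m where "m = Least ?P"
  have "of_nat CARD('a) = (0 :: 'a)" using CHAR_dvd_CARD[where 'a = 'a] by (simp add: of_nat_eq_0_iff_char_dvd)
  then have "?P CARD('a)" using H0 by simp
  then have m: "?P m" unfolding m_def by (rule LeastI)
  have min: "m \<le> j" if "?P j" for j unfolding m_def using that by (rule Least_le)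
  have "m \<noteq> 1" using m y by auto
  then have m2: "m \<ge> 2" using m by linarith
  \<comment> \<open>This makes the character independent of the choice of \<open>a\<close>: a
    nonzero remainder modulo \<open>m\<close> would contradict the minimality of
    \<open>m\<close>.\<close>
  have dvd: "int m dvd a" if a: "of_int a * y \<in> H" for a
  proof -
    let ?r = "a mod int m"
    have "of_int a * y - of_int (a div int m) * (of_nat m * y) \<in> H"
      using m by (intro subdiff[OF H(1)] a mul) simp
    moreover have "of_int a * y - of_int (a div int m) * (of_nat m * y) = of_int (a - a div int m * int m) * y"
      by (simp add: algebra_simps)
    moreover have "a - a div int m * int m = ?r" by (simp add: minus_div_mult_eq_mod)
    ultimately have "of_int ?r * y \<in> H" by simp
    moreover have "of_int ?r = (of_nat (nat ?r) :: 'a)" using m by (intro of_nat_nat[symmetric]) simp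
    ultimately have "of_nat (nat ?r) * y \<in> H" by simp
    moreover have "nat ?r < m" using m by (simp add: nat_less_iff)
    ultimately have "\<not> nat ?r > 0" using min[of "nat ?r"] by linarith
    then have "?r = 0" using m pos_mod_sign[of "int m" a] by linarith
    then show ?thesis by (simp add: dvd_eq_mod_eq_0)
  qed
  define e where "e a = cis (2 * pi * real_of_int a / real m)" for a :: int
  have eadd: "e (a + b) = e a * e b" for a b by (simp add: e_def cis_mult algebra_simps add_divide_distrib)
  have e1: "e a = 1" if dv: "int m dvd a" for a
  proof -
    obtain c where c: "a = int m * c" using dv by blast
    have "2 * pi * real_of_int a / real m = 2 * pi * real_of_int c" using m c by simp
    then show ?thesis unfolding e_def by (simp add: cis_multiple_2pi)
  qed
  define idx where "idx x = (SOME a. x - of_int a * y \<in> H)" for x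
  have idx: "x - of_int (idx x) * y \<in> H" for x
    unfolding idx_def by (rule someI_ex) (use U in blast)
  have eidx: "e (idx x) = e a" if a: "x - of_int a * y \<in> H" for x a
  proof -
    have "(x - of_int a * y) - (x - of_int (idx x) * y) \<in> H" by (rule subdiff[OF H(1) a idx])
    then have "of_int (idx x - a) * y \<in> H" by (simp add: algebra_simps)
    then have "e (idx x - a) = 1" by (intro e1 dvd)
    then show ?thesis using eadd[of "idx x - a" a] by simp
  qed
  define \<psi> where "\<psi> x = e (idx x)" for x
  have "\<psi> (u + v) = \<psi> u * \<psi> v" for u v
  proof -
    have "(u - of_int (idx u) * y) + (v - of_int (idx v) * y) \<in> H" by (rule subadd[OF H(1) idx idx])
    then have "(u + v) - of_int (idx u + idx v) * y \<in> H" by (simp add: algebra_simps)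
    from eidx[OF this] show ?thesis unfolding \<psi>_def eadd .
  qed
  then have "additive_char \<psi>" by (simp add: additive_char_def \<psi>_def e_def)
  moreover have "\<psi> y \<noteq> 1"
  proof -
    have "y - of_int 1 * y \<in> H" using H0 by simp
    then have "\<psi> y = e 1" unfolding \<psi>_def by (rule eidx)
    \<comment> \<open>As \<open>m \<ge> 2\<close>, the angle \<open>2 * pi / m\<close> lies in the
      half period on which the cosine strictly decreases from 1.\<close>
    moreover have "e 1 \<noteq> 1"
    proof
      assume "e 1 = 1"
      then have "cos (2 * pi / real m) = 1" by (simp add: e_def complex_eq_iff)
      moreover have "cos (2 * pi / real m) < cos 0"
      proof (rule cos_monotone_0_pi)
        show "2 * pi / real m \<le> pi" using m2 by (simp add: divide_le_eq)
        show "0 < 2 * pi / real m" using m by simp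
      qed simp
      ultimately show False by simp
    qed
    ultimately show ?thesis by simp
  qed
  ultimately show ?thesis by blast
qed

lemma additive_char_scale: "additive_char \<psi> \<Longrightarrow> additive_char (\<lambda>x :: 'a::comm_ring. \<psi> (a * x))"
  by (simp add: additive_char_def distrib_left)

lemma additive_char_orthogonal:
  fixes \<psi> :: "'a::{finite,field} \<Rightarrow> complex"
  assumes \<psi>: "additive_char \<psi>" "\<psi> b \<noteq> 1"
  shows "(\<Sum>a\<in>UNIV. \<psi> (a * x)) = (if x = 0 then of_nat CARD('a) else 0)"
proof (cases "x = 0")
  case True
  then show ?thesis using additive_char_0[OF \<psi>(1)] by simp
next
  case False
  have "bij (\<lambda>a. a + b / x)" by (rule bij_plus_right)
  then have "(\<Sum>a\<in>UNIV. \<psi> (a * x)) = (\<Sum>a\<in>UNIV. \<psi> ((a + b / x) * x))"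
    using sum.reindex_bij_betw[of "\<lambda>a. a + b / x" UNIV UNIV "\<lambda>a. \<psi> (a * x)"] by simp
  also have "\<dots> = (\<Sum>a\<in>UNIV. \<psi> (a * x)) * \<psi> b"
    using False by (simp add: distrib_right additive_char_add[OF \<psi>(1)] sum_distrib_right)
  finally have "(\<Sum>a\<in>UNIV. \<psi> (a * x)) = 0" using \<psi>(2) by (metis mult_cancel_left mult.right_neutral)
  then show ?thesis using False by simp
qed

text \<open>Fourier inversion on the base field: the frequency \<open>a = 0\<close> gives the
  uniform probability, the others give means of twisted characters. The resulting bound is the same
  for every \<open>x\<close>; the factor \<open>1/q\<close> is given away.\<close>

lemma prob_trace_bound:
  fixes \<psi> :: "'a::{finite,field} \<Rightarrow> complex"
  assumes \<psi>: "additive_char \<psi>" "\<psi> b \<noteq> 1"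
  shows "\<bar>measure_pmf.prob (pmf_of_set (GL n :: 'a mat set)) {g. mat_trace (g ^\<^sub>m k) = x} - 1 / real CARD('a)\<bar>
    \<le> (\<Sum>a\<in>UNIV - {0}. norm (trace_avg (\<lambda>y. \<psi> (a * y)) k n))"
proof -
  let ?GL = "GL n :: 'a mat set" and ?q = "of_nat CARD('a) :: complex"
  let ?c = "of_nat (card ?GL) :: complex"
  let ?p = "measure_pmf.prob (pmf_of_set ?GL) {g. mat_trace (g ^\<^sub>m k) = x}"
  have c0: "?c \<noteq> 0" using card_GL_pos[of n, where 'a = 'a] by simp
  have "?p = real (card (?GL \<inter> {g. mat_trace (g ^\<^sub>m k) = x})) / real (card ?GL)"
    by (rule measure_pmf_of_set[OF GL_nonempty finite_GL])
  moreover have "?q * of_nat (card (?GL \<inter> {g. mat_trace (g ^\<^sub>m k) = x})) =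
      (\<Sum>g\<in>?GL. if mat_trace (g ^\<^sub>m k) = x then ?q else 0)"
  proof -
    have "?GL \<inter> {g. mat_trace (g ^\<^sub>m k) = x} = {g \<in> ?GL. mat_trace (g ^\<^sub>m k) = x}" by blast
    then show ?thesis by (subst sum.inter_filter[OF finite_GL, symmetric]) simp
  qed
  moreover have "\<dots> = (\<Sum>g\<in>?GL. \<Sum>a\<in>UNIV. \<psi> (a * (mat_trace (g ^\<^sub>m k) - x)))"
    by (rule sum.cong[OF refl]) (simp add: additive_char_orthogonal[OF \<psi>])
  moreover have "\<dots> = (\<Sum>g\<in>?GL. \<Sum>a\<in>UNIV. \<psi> (- (a * x)) * \<psi> (a * mat_trace (g ^\<^sub>m k)))"
    by (intro sum.cong refl) (simp add: additive_char_add[OF \<psi>(1), symmetric] algebra_simps)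
  moreover have "\<dots> = (\<Sum>a\<in>UNIV. \<psi> (- (a * x)) * (\<Sum>g\<in>?GL. \<psi> (a * mat_trace (g ^\<^sub>m k))))"
    unfolding sum_distrib_left by (rule sum.swap)
  ultimately have "?q * of_real ?p = (\<Sum>a\<in>UNIV. \<psi> (- (a * x)) * (\<Sum>g\<in>?GL. \<psi> (a * mat_trace (g ^\<^sub>m k)))) / ?c"
    by simp
  also have "\<dots> = (\<Sum>a\<in>UNIV. \<psi> (- (a * x)) * trace_avg (\<lambda>y. \<psi> (a * y)) k n)"
    unfolding trace_avg_def times_divide_eq_right by (rule sum_divide_distrib)
  also have "\<dots> = 1 + (\<Sum>a\<in>UNIV - {0}. \<psi> (- (a * x)) * trace_avg (\<lambda>y. \<psi> (a * y)) k n)"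
    using c0 additive_char_0[OF \<psi>(1)] by (subst sum.remove[of UNIV 0]) (auto simp: trace_avg_def)
  finally have eq: "?q * of_real ?p - 1 = (\<Sum>a\<in>UNIV - {0}. \<psi> (- (a * x)) * trace_avg (\<lambda>y. \<psi> (a * y)) k n)" by simp
  have "real CARD('a) * \<bar>?p - 1 / real CARD('a)\<bar> = \<bar>real CARD('a) * (?p - 1 / real CARD('a))\<bar>" by (simp add: abs_mult)
  also have "real CARD('a) * (?p - 1 / real CARD('a)) = real CARD('a) * ?p - 1" by (simp add: right_diff_distrib)
  also have "\<bar>real CARD('a) * ?p - 1\<bar> = norm (?q * of_real ?p - 1)"
  proof -
    have "?q * of_real ?p - 1 = of_real (real CARD('a) * ?p - 1)" by simp
    then show ?thesis by (simp only: norm_of_real)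
  qed
  also have "\<dots> \<le> (\<Sum>a\<in>UNIV - {0}. norm (\<psi> (- (a * x)) * trace_avg (\<lambda>y. \<psi> (a * y)) k n))"
    unfolding eq by (rule norm_sum)
  also have "\<dots> = (\<Sum>a\<in>UNIV - {0}. norm (trace_avg (\<lambda>y. \<psi> (a * y)) k n))"
    by (simp add: norm_mult additive_char_norm[OF \<psi>(1)])
  finally have le: "real CARD('a) * \<bar>?p - 1 / real CARD('a)\<bar> \<le> (\<Sum>a\<in>UNIV - {0}. norm (trace_avg (\<lambda>y. \<psi> (a * y)) k n))" .
  have "1 * \<bar>?p - 1 / real CARD('a)\<bar> \<le> real CARD('a) * \<bar>?p - 1 / real CARD('a)\<bar>"
    using CARD_ge_2[where 'a = 'a] by (intro mult_right_mono) auto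
  with le show ?thesis by simp
qed

theorem theorem1p1:
  fixes k :: "nat \<Rightarrow> nat"
  assumes "\<And>n. n \<ge> 1 \<Longrightarrow> k n \<ge> 1"
    and "(\<lambda>n. ln (real (k n))) \<in> o(\<lambda>n. (real n)\<^sup>2)"
  shows "(\<lambda>n. \<Sum>x\<in>(UNIV :: 'a::{finite,field} set).
      \<bar>measure_pmf.prob (pmf_of_set (GL n :: 'a mat set)) {g. mat_trace (g ^\<^sub>m k n) = x}
        - 1 / real CARD('a)\<bar>) \<longlonglongrightarrow> 0"
proof -
  obtain \<psi> :: "'a \<Rightarrow> complex" and b where \<psi>: "additive_char \<psi>" "\<psi> b \<noteq> 1"
    using exists_nontrivial_additive_char by blast
  \<comment> \<open>Scaling by \<open>a \<noteq> 0\<close> keeps the character nontrivial, with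
    witness \<open>b / a\<close>.\<close>
  have avg: "(\<lambda>n. trace_avg (\<lambda>y. \<psi> (a * y)) (k n) n) \<longlonglongrightarrow> 0" if "a \<noteq> 0" for a
  proof (rule trace_avg_tendsto_0[OF additive_char_scale[OF \<psi>(1)] _ assms])
    show "\<psi> (a * (b / a)) \<noteq> 1" using that \<psi>(2) by simp
  qed
  have "(\<lambda>n. \<Sum>x\<in>(UNIV :: 'a set). \<Sum>a\<in>UNIV - {0}. norm (trace_avg (\<lambda>y. \<psi> (a * y)) (k n) n)) \<longlonglongrightarrow>
      (\<Sum>x\<in>(UNIV :: 'a set). \<Sum>a\<in>UNIV - {0 :: 'a}. 0)"
    using avg by (intro tendsto_sum tendsto_norm_zero) auto
  then have "(\<lambda>n. \<Sum>x\<in>(UNIV :: 'a set). \<Sum>a\<in>UNIV - {0}. norm (trace_avg (\<lambda>y. \<psi> (a * y)) (k n) n)) \<longlonglongrightarrow> 0"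
    by simp
  then show ?thesis
  proof (rule Lim_null_comparison[rotated])
    show "eventually (\<lambda>n. norm (\<Sum>x\<in>(UNIV :: 'a set).
        \<bar>measure_pmf.prob (pmf_of_set (GL n :: 'a mat set)) {g. mat_trace (g ^\<^sub>m k n) = x} - 1 / real CARD('a)\<bar>) \<le>
        (\<Sum>x\<in>(UNIV :: 'a set). \<Sum>a\<in>UNIV - {0}. norm (trace_avg (\<lambda>y. \<psi> (a * y)) (k n) n))) sequentially"
    proof (rule always_eventually, rule allI)
      fix n
      have "norm (\<Sum>x\<in>(UNIV :: 'a set).
        \<bar>measure_pmf.prob (pmf_of_set (GL n :: 'a mat set)) {g. mat_trace (g ^\<^sub>m k n) = x} - 1 / real CARD('a)\<bar>) =
        (\<Sum>x\<in>(UNIV :: 'a set).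
        \<bar>measure_pmf.prob (pmf_of_set (GL n :: 'a mat set)) {g. mat_trace (g ^\<^sub>m k n) = x} - 1 / real CARD('a)\<bar>)"
        unfolding real_norm_def by (rule abs_of_nonneg) (auto intro: sum_nonneg)
      also have "\<dots> \<le> (\<Sum>x\<in>(UNIV :: 'a set). \<Sum>a\<in>UNIV - {0}. norm (trace_avg (\<lambda>y. \<psi> (a * y)) (k n) n))"
        by (rule sum_mono) (rule prob_trace_bound[OF \<psi>])
      finally show "norm (\<Sum>x\<in>(UNIV :: 'a set).
        \<bar>measure_pmf.prob (pmf_of_set (GL n :: 'a mat set)) {g. mat_trace (g ^\<^sub>m k n) = x} - 1 / real CARD('a)\<bar>) \<le>
        (\<Sum>x\<in>(UNIV :: 'a set). \<Sum>a\<in>UNIV - {0}. norm (trace_avg (\<lambda>y. \<psi> (a * y)) (k n) n))" .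
    qed
  qed
qed

end
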